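(* Let $f:M\to M$ be a $C^1$ expanding map of an $m_0$-dimensional compact smooth Riemannian manifold $M$, and let $\Lambda_f$ be a repeller for $f$ such that $f|\Lambda_f$ is topologically transitive. Then for each $0\le t\le m_0$ the map $f\mapsto P(f|_{\Lambda_f},\Phi_f(t))$ is upper semi-continuous, i.e., for every $\varepsilon>0$ there is a $\delta>0$ such that $$P(h|_{\Lambda_h},\Phi_h(t))\le P(f|_{\Lambda_f},\Phi_f(t))+\varepsilon$$ for every $C^1$ map $h:M\to M$ with $\|f-h\|_{C^1}<\delta$.
   Context: Repellers. Let $f:M\to M$ be a smooth map of a compact smooth Riemannian manifold and let $\Lambda$ be a compact $f$-invariant subset of $M$. $\Lambda$ is called a repeller for $f$, and $f$ expanding, if (1) there is an open neighborhood $U$ of $\Lambda$ such that $\Lambda=\{x\in U: f^n(x)\in U \text{ for all } n\ge 0\}$; (2) there is $\kappa>1$ such that $\|D_xf v\|\ge\kappa\|v\|$ for all $x\in\Lambda$ and $v\in T_xM$. If $h$ is a $C^1$ map sufficiently $C^1$-close to $f$, then $h$ admits a repeller $\Lambda_h$ for which there is a homeomorphism $\pi:\Lambda_f\to\Lambda_h$, close to the identity, with $\pi\circ f=h\circ\pi$; $\Lambda_h$ always denotes this repeller (and $\delta$ is small enough that it is defined). Singular valued potential. For $x$ in the repeller and $n\ge1$ let $\alpha_1(x,f^n)\ge\dots\ge\alpha_{m_0}(x,f^n)$ be the singular values of $D_xf^n:T_xM\to T_{f^n(x)}M$. For $t\in[0,m_0]$ put $$\varphi^t(x,f^n)=\sum_{i=m_0-[t]+1}^{m_0}\log\alpha_i(x,f^n)+(t-[t])\log\alpha_{m_0-[t]}(x,f^n)$$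 (the last term is $0$ if $t=m_0$), and $\Phi_f(t)=\{-\varphi^t(\cdot,f^n)\}_{n\ge1}$. This sequence is sub-additive, where $\{\varphi_n\}_{n\ge1}$ is sub-additive for $f$ if $\varphi_{m+n}\le\varphi_n+\varphi_m\circ f^n$ for all $m,n\ge1$. $\Phi_h(t)$ is defined in the same way from $h$. Sub-additive pressure. For a continuous map $f:X\to X$ of a compact metric space $(X,d)$, let $d_n(x,y)=\max_{0\le i<n}d(f^ix,f^iy)$; a set $E\subset X$ is $(n,\varepsilon)$-separated if $d_n(x,y)>\varepsilon$ for any two distinct points $x,y\in E$. For a sub-additive sequence of continuous functions $\Phi=\{\varphi_n\}_{n\ge1}$, $$P(f,\Phi)=\lim_{\varepsilon\to0}\limsup_{n\to\infty}\frac1n\log\sup\Big\{\sum_{x\in E}e^{\varphi_n(x)}: E\text{ is an }(n,\varepsilon)\text{-separated subset of }X\Big\}.$$ *)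

theory Defs
  imports "HOL-Analysis.Analysis" "HOL-Library.Multiset"
begin

section \<open>Smooth manifolds\<close>

text \<open>The manifold is a whole type \<open>'m\<close>, whose topology is given by its \<open>metric_space\<close>
  structure; \<open>dist\<close> is any metric inducing the manifold topology.  It is modelled on
  \<open>'e::euclidean_space\<close>, so its dimension is \<open>DIM('e)\<close>.\<close>

text \<open>Only meaningful for open \<open>S\<close>.  In finite dimension, continuity of
  \<open>x \<mapsto> Df(x) v\<close> for every \<open>v\<close> is continuity of \<open>x \<mapsto> Df(x)\<close>.\<close>

primrec Ck_on :: "nat \<Rightarrow> ('a::euclidean_space \<Rightarrow> 'b::euclidean_space) \<Rightarrow> 'a set \<Rightarrow> bool" where
  "Ck_on 0 f S \<longleftrightarrow> continuous_on S f"
| "Ck_on (Suc k) f S \<longleftrightarrow>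
     (\<exists>f'. (\<forall>x\<in>S. (f has_derivative f' x) (at x)) \<and> (\<forall>v. Ck_on k (\<lambda>x. f' x v) S))"

definition smooth_on :: "('a::euclidean_space \<Rightarrow> 'b::euclidean_space) \<Rightarrow> 'a set \<Rightarrow> bool" where
  "smooth_on f S \<longleftrightarrow> (\<forall>k. Ck_on k f S)"

text \<open>A chart is its domain together with its coordinate map; values of the coordinate map
  outside the domain are irrelevant.\<close>

type_synonym ('m, 'e) chart = "'m set \<times> ('m \<Rightarrow> 'e)"

definition chart_inv :: "('m, 'e) chart \<Rightarrow> 'e \<Rightarrow> 'm" where
  "chart_inv c = inv_into (fst c) (snd c)"

definition chart_image :: "('m, 'e) chart \<Rightarrow> 'e set" where
  "chart_image c = snd c ` fst c"

definition is_chart :: "('m::metric_space, 'e::euclidean_space) chart \<Rightarrow> bool" where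
  "is_chart c \<longleftrightarrow> open (fst c) \<and> open (chart_image c) \<and>
     homeomorphism (fst c) (chart_image c) (snd c) (chart_inv c)"

definition smooth_atlas :: "('m::metric_space, 'e::euclidean_space) chart set \<Rightarrow> bool" where
  "smooth_atlas A \<longleftrightarrow>
     (\<forall>c\<in>A. is_chart c) \<and> (\<Union>c\<in>A. fst c) = UNIV \<and>
     (\<forall>c\<in>A. \<forall>c'\<in>A. smooth_on (snd c' \<circ> chart_inv c) (snd c ` (fst c \<inter> fst c')))"

text \<open>The tangent space at \<open>x\<close> is a copy of the model space \<open>'e\<close>, identified with it through a
  preferred chart \<open>chart_at A x\<close> around \<open>x\<close>; the derivatives \<open>manifold_deriv\<close> and
  \<open>vector_deriv\<close> below are taken with respect to these identifications.\<close>

definition chart_at :: "('m, 'e) chart set \<Rightarrow> 'm \<Rightarrow> ('m, 'e) chart" where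
  "chart_at A x = (SOME c. c \<in> A \<and> x \<in> fst c)"

definition C1_map ::
  "('m::metric_space, 'e::euclidean_space) chart set \<Rightarrow> ('m \<Rightarrow> 'm) \<Rightarrow> bool" where
  "C1_map A f \<longleftrightarrow> continuous_on UNIV f \<and>
     (\<forall>c\<in>A. \<forall>c'\<in>A. Ck_on 1 (snd c' \<circ> f \<circ> chart_inv c) (snd c ` (fst c \<inter> f -` fst c')))"

definition manifold_deriv ::
  "('m::metric_space, 'e::euclidean_space) chart set \<Rightarrow> ('m \<Rightarrow> 'm) \<Rightarrow> 'm \<Rightarrow> 'e \<Rightarrow> 'e" where
  "manifold_deriv A f x =
     frechet_derivative (snd (chart_at A (f x)) \<circ> f \<circ> chart_inv (chart_at A x))
       (at (snd (chart_at A x) x))"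

definition vector_deriv ::
  "('m::metric_space, 'e::euclidean_space) chart set \<Rightarrow> ('m \<Rightarrow> 'b::euclidean_space) \<Rightarrow> 'm \<Rightarrow> 'e \<Rightarrow> 'b" where
  "vector_deriv A u x =
     frechet_derivative (u \<circ> chart_inv (chart_at A x)) (at (snd (chart_at A x) x))"

text \<open>\<open>g x\<close> is an inner product on the tangent space at \<open>x\<close>.  Smoothness is smoothness of the
  components of \<open>g\<close> in each chart \<open>c\<close>; as \<open>g x\<close> is expressed in the chart \<open>chart_at A x\<close>, the
  coordinate vectors of \<open>c\<close> are first transported by \<open>chart_change A c y\<close>.\<close>

definition chart_change ::
  "('m::metric_space, 'e::euclidean_space) chart set \<Rightarrow> ('m, 'e) chart \<Rightarrow> 'e \<Rightarrow> 'e \<Rightarrow> 'e" where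
  "chart_change A c y =
     frechet_derivative (snd (chart_at A (chart_inv c y)) \<circ> chart_inv c) (at y)"

definition riemannian_metric ::
  "('m::metric_space, 'e::euclidean_space) chart set \<Rightarrow> ('m \<Rightarrow> 'e \<Rightarrow> 'e \<Rightarrow> real) \<Rightarrow> bool" where
  "riemannian_metric A g \<longleftrightarrow>
     (\<forall>x. bilinear (g x) \<and> (\<forall>u v. g x u v = g x v u) \<and> (\<forall>v. v \<noteq> 0 \<longrightarrow> g x v v > 0)) \<and>
     (\<forall>c\<in>A. \<forall>u v. smooth_on
        (\<lambda>y. g (chart_inv c y) (chart_change A c y u) (chart_change A c y v)) (chart_image c))"

definition compact_riemannian_manifold ::
  "('m::metric_space, 'e::euclidean_space) chart set \<Rightarrow> ('m \<Rightarrow> 'e \<Rightarrow> 'e \<Rightarrow> real) \<Rightarrow> bool" where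
  "compact_riemannian_manifold A g \<longleftrightarrow>
     compact (UNIV :: 'm set) \<and> smooth_atlas A \<and> riemannian_metric A g"

definition tnorm :: "('m \<Rightarrow> 'e \<Rightarrow> 'e \<Rightarrow> real) \<Rightarrow> 'm \<Rightarrow> 'e \<Rightarrow> real" where
  "tnorm g x v = sqrt (g x v v)"

section \<open>The \<open>C\<^sup>1\<close> distance\<close>

text \<open>The difference of two maps into \<open>M\<close> is formed in a Euclidean space in which \<open>M\<close> is
  smoothly embedded.  On a compact manifold an injective immersion is an embedding, and all
  choices of the embedding \<open>\<iota>\<close> give the same \<open>C\<^sup>1\<close>-neighbourhoods.\<close>

definition smooth_embedding ::
  "('m::metric_space, 'e::euclidean_space) chart set \<Rightarrow> ('m \<Rightarrow> 'b::euclidean_space) \<Rightarrow> bool" where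
  "smooth_embedding A \<iota> \<longleftrightarrow>
     inj \<iota> \<and> (\<forall>c\<in>A. smooth_on (\<iota> \<circ> chart_inv c) (chart_image c)) \<and>
     (\<forall>x. inj (vector_deriv A \<iota> x))"

definition C1_norm ::
  "('m::metric_space, 'e::euclidean_space) chart set \<Rightarrow> ('m \<Rightarrow> 'e \<Rightarrow> 'e \<Rightarrow> real) \<Rightarrow>
     ('m \<Rightarrow> 'b::euclidean_space) \<Rightarrow> real" where
  "C1_norm A g u =
     (SUP x. norm (u x)) + (SUP (x, v)\<in>{(x, v). tnorm g x v = 1}. norm (vector_deriv A u x v))"

definition C1_dist ::
  "('m::metric_space, 'e::euclidean_space) chart set \<Rightarrow> ('m \<Rightarrow> 'e \<Rightarrow> 'e \<Rightarrow> real) \<Rightarrow>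
     ('m \<Rightarrow> 'b::euclidean_space) \<Rightarrow> ('m \<Rightarrow> 'm) \<Rightarrow> ('m \<Rightarrow> 'm) \<Rightarrow> real" where
  "C1_dist A g \<iota> f h = C1_norm A g (\<lambda>x. \<iota> (f x) - \<iota> (h x))"

section \<open>Repellers\<close>

definition repeller ::
  "('m::metric_space, 'e::euclidean_space) chart set \<Rightarrow> ('m \<Rightarrow> 'e \<Rightarrow> 'e \<Rightarrow> real) \<Rightarrow>
     ('m \<Rightarrow> 'm) \<Rightarrow> 'm set \<Rightarrow> bool" where
  "repeller A g f \<Lambda> \<longleftrightarrow>
     compact \<Lambda> \<and> f ` \<Lambda> \<subseteq> \<Lambda> \<and>
     (\<exists>U. open U \<and> \<Lambda> \<subseteq> U \<and> \<Lambda> = {x \<in> U. \<forall>n. (f ^^ n) x \<in> U}) \<and>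
     (\<exists>\<kappa>>1. \<forall>x\<in>\<Lambda>. \<forall>v. tnorm g (f x) (manifold_deriv A f x v) \<ge> \<kappa> * tnorm g x v)"

definition topologically_transitive_on :: "'m::topological_space set \<Rightarrow> ('m \<Rightarrow> 'm) \<Rightarrow> bool" where
  "topologically_transitive_on X f \<longleftrightarrow>
     (\<forall>U V. openin (top_of_set X) U \<and> openin (top_of_set X) V \<and> U \<noteq> {} \<and> V \<noteq> {} \<longrightarrow>
        (\<exists>n. (f ^^ n) ` U \<inter> V \<noteq> {}))"

text \<open>\<open>\<Lambda>'\<close> is a repeller \<open>\<Lambda>\<^sub>h\<close> of \<open>h\<close> that is conjugate to the repeller \<open>\<Lambda>\<close> of \<open>f\<close> by a
  homeomorphism \<open>\<eta>\<close>-close to the identity.\<close>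

definition repeller_continuation ::
  "('m::metric_space, 'e::euclidean_space) chart set \<Rightarrow> ('m \<Rightarrow> 'e \<Rightarrow> 'e \<Rightarrow> real) \<Rightarrow> real \<Rightarrow>
     ('m \<Rightarrow> 'm) \<Rightarrow> 'm set \<Rightarrow> ('m \<Rightarrow> 'm) \<Rightarrow> 'm set \<Rightarrow> bool" where
  "repeller_continuation A g \<eta> f \<Lambda> h \<Lambda>' \<longleftrightarrow>
     repeller A g h \<Lambda>' \<and>
     (\<exists>\<pi> \<rho>. homeomorphism \<Lambda> \<Lambda>' \<pi> \<rho> \<and> (\<forall>x\<in>\<Lambda>. dist (\<pi> x) x < \<eta>) \<and>
            (\<forall>x\<in>\<Lambda>. \<pi> (f x) = h (\<pi> x)))"

section \<open>The singular valued potential\<close>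

text \<open>For inner products \<open>G\<close>, \<open>H\<close> on source and target, the eigenspace of \<open>L\<^sup>*L\<close> for \<open>\<mu>\<close> is
  \<open>{u. \<forall>v. H (L u) (L v) = \<mu> * G u v}\<close>.  The singular values are the nonnegative square roots of
  the eigenvalues of \<open>L\<^sup>*L\<close>, listed in non-increasing order with multiplicity.\<close>

definition singular_values ::
  "('e::euclidean_space \<Rightarrow> 'e \<Rightarrow> real) \<Rightarrow> ('e \<Rightarrow> 'e \<Rightarrow> real) \<Rightarrow> ('e \<Rightarrow> 'e) \<Rightarrow> real list" where
  "singular_values G H L = rev (sorted_list_of_multiset (Abs_multiset
     (\<lambda>\<sigma>. if \<sigma> \<ge> 0 then dim {u. \<forall>v. H (L u) (L v) = \<sigma>\<^sup>2 * G u v} else 0)))"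

text \<open>\<open>singular_value A g f n x i\<close> is \<open>\<alpha>\<^sub>i(x, f\<^sup>n)\<close> for \<open>1 \<le> i \<le> DIM('e)\<close>.\<close>

definition singular_value ::
  "('m::metric_space, 'e::euclidean_space) chart set \<Rightarrow> ('m \<Rightarrow> 'e \<Rightarrow> 'e \<Rightarrow> real) \<Rightarrow>
     ('m \<Rightarrow> 'm) \<Rightarrow> nat \<Rightarrow> 'm \<Rightarrow> nat \<Rightarrow> real" where
  "singular_value A g f n x i =
     singular_values (g x) (g ((f ^^ n) x)) (manifold_deriv A (f ^^ n) x) ! (i - 1)"

text \<open>For \<open>t = DIM('e)\<close> the last summand vanishes because of its first factor.\<close>

definition singular_potential ::
  "('m::metric_space, 'e::euclidean_space) chart set \<Rightarrow> ('m \<Rightarrow> 'e \<Rightarrow> 'e \<Rightarrow> real) \<Rightarrow>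
     ('m \<Rightarrow> 'm) \<Rightarrow> real \<Rightarrow> nat \<Rightarrow> 'm \<Rightarrow> real" where
  "singular_potential A g f t n x =
     (let k = nat \<lfloor>t\<rfloor>; \<alpha> = singular_value A g f n x in
       (\<Sum>i = DIM('e) - k + 1..DIM('e). ln (\<alpha> i)) + (t - real k) * ln (\<alpha> (DIM('e) - k)))"

definition potential_seq ::
  "('m::metric_space, 'e::euclidean_space) chart set \<Rightarrow> ('m \<Rightarrow> 'e \<Rightarrow> 'e \<Rightarrow> real) \<Rightarrow>
     ('m \<Rightarrow> 'm) \<Rightarrow> real \<Rightarrow> nat \<Rightarrow> 'm \<Rightarrow> real" where
  "potential_seq A g f t n x = - singular_potential A g f t n x"

section \<open>Sub-additive topological pressure\<close>

text \<open>Only meaningful for \<open>n \<ge> 1\<close>.\<close>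

definition bowen_dist :: "('m::metric_space \<Rightarrow> 'm) \<Rightarrow> nat \<Rightarrow> 'm \<Rightarrow> 'm \<Rightarrow> real" where
  "bowen_dist f n x y = Max ((\<lambda>i. dist ((f ^^ i) x) ((f ^^ i) y)) ` {..<n})"

definition separated :: "('m::metric_space \<Rightarrow> 'm) \<Rightarrow> nat \<Rightarrow> real \<Rightarrow> 'm set \<Rightarrow> bool" where
  "separated f n \<epsilon> E \<longleftrightarrow> (\<forall>x\<in>E. \<forall>y\<in>E. x \<noteq> y \<longrightarrow> bowen_dist f n x y > \<epsilon>)"

text \<open>The pressure of the restriction of \<open>f\<close> to the compact invariant set \<open>X\<close>.  Separated
  subsets of a compact set are finite, and for \<open>\<phi> n\<close> continuous the inner supremum is over a
  bounded set of reals.\<close>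

definition pressure :: "'m::metric_space set \<Rightarrow> ('m \<Rightarrow> 'm) \<Rightarrow> (nat \<Rightarrow> 'm \<Rightarrow> real) \<Rightarrow> ereal" where
  "pressure X f \<phi> =
     Lim (at_right (0::real)) (\<lambda>\<epsilon>. limsup (\<lambda>n. ereal (1 / real n *
       ln (SUP E\<in>{E. E \<subseteq> X \<and> separated f n \<epsilon> E}. \<Sum>x\<in>E. exp (\<phi> n x)))))"

end

theory Submission
  imports Defs "Jordan_Normal_Form.Determinant"
begin

text \<open>Every map \<open>h\<close> that is \<open>C\<^sup>1\<close>-close to \<open>f\<close> is, in charts near a point of \<open>\<Lambda>\<close>, a small Lipschitz
  perturbation of the derivative of \<open>f\<close>.  Hence it expands there and covers small balls, so orbits
  of \<open>f\<close> and of \<open>h\<close> near \<open>\<Lambda>\<close> shadow each other uniquely; this gives the conjugacy and the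
  uniqueness of \<open>\<Lambda>\<^sub>h\<close>.

  For the pressure, fix a large \<open>N\<close> and a maximal \<open>(N, \<rho>)\<close>-separated set \<open>E\<close>, and let \<open>W\<close> be the sum
  over \<open>E\<close> of the suprema of \<open>exp \<phi>\<^sub>N\<close> on \<open>(N, \<rho>)\<close>-Bowen balls.  By expansivity such
  balls overlap with a multiplicity that does not depend on \<open>N\<close>, so \<open>ln W / N\<close> exceeds the pressure
  of \<open>f\<close> by little, although \<open>\<phi>\<^sub>N\<close> need not have bounded distortion.  Sub-additivity of the
  potential of \<open>h\<close> and coding of orbits by \<open>N\<close>-blocks bound the pressure of \<open>h\<close> by \<open>ln W / N\<close>, up to the
  distance between the two potentials at the single time \<open>N\<close>.\<close>

section \<open>Simultaneous diagonalization and volume distortion\<close>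

text \<open>The shaping obstacle is geometric. Tangent spaces are read in preferred charts that jump
  from point to point, while the distance of maps is measured in an ambient Euclidean space. Every
  local estimate is therefore made in the one chart preferred at a fixed point \<open>x\<close>:
  \<open>frame\<close> transports vectors from nearby points, and \<open>Q\<close> replaces the
  Riemannian distance. \<open>Q\<close> must be accurate up to factors near 1, since a one-step
  expansion by some \<kappa> > 1 would be lost to any fixed distortion. The estimates concern pairs
  of points (\<open>strict_deriv\<close>), so that one inequality yields expansion, covering and
  derivatives at neighbouring points, and passes to iterates by composition. In each of them one
  number \<open>d\<close> is both the radius and the size of the admissible perturbation; this lets
  \<open>compact_local_uniform\<close> remove the dependence on \<open>x\<close>. Singular values
  enter as eigenvalues of quadratic forms: the minimax principle gives their continuity, and the
  distortion of volumes gives sub-additivity of the potential. The block data are extracted from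
  \<open>f\<close> alone, before the neighbourhood of \<open>f\<close> is fixed.\<close>

definition sym_form :: "('e::euclidean_space \<Rightarrow> 'e \<Rightarrow> real) \<Rightarrow> bool" where
  "sym_form b \<longleftrightarrow> bilinear b \<and> (\<forall>u v. b u v = b v u)"

definition inner_form :: "('e::euclidean_space \<Rightarrow> 'e \<Rightarrow> real) \<Rightarrow> bool" where
  "inner_form G \<longleftrightarrow> sym_form G \<and> (\<forall>v. v \<noteq> 0 \<longrightarrow> G v v > 0)"

text \<open>Measured against an inner product \<open>G\<close> on the source, this is the quadratic
  form of \<open>L^*L\<close>; diagonalizing it relative to \<open>G\<close> yields the squared
  singular values of \<open>L\<close>.\<close>

definition pullback_form :: "('e \<Rightarrow> 'e \<Rightarrow> real) \<Rightarrow> ('e \<Rightarrow> 'e) \<Rightarrow> 'e \<Rightarrow> 'e \<Rightarrow> real" where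
  "pullback_form H L u v = H (L u) (L v)"

lemma sym_form_linear: "sym_form b \<Longrightarrow> linear (b u)" "sym_form b \<Longrightarrow> linear (\<lambda>u. b u v)"
  by (auto simp: sym_form_def bilinear_def)

lemma sym_form_sym: "sym_form b \<Longrightarrow> b u v = b v u"
  by (auto simp: sym_form_def)

lemma inner_form_sym_form: "inner_form G \<Longrightarrow> sym_form G"
  by (auto simp: inner_form_def)

lemma inner_form_nonneg: "inner_form G \<Longrightarrow> 0 \<le> G v v"
  using linear_0[OF sym_form_linear(1)[OF inner_form_sym_form, of G 0]]
  by (cases "v = 0") (auto simp: inner_form_def intro: less_imp_le)

lemma inner_form_pos: "inner_form G \<Longrightarrow> v \<noteq> 0 \<Longrightarrow> 0 < G v v"
  by (auto simp: inner_form_def)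

lemma sym_form_pullback: "sym_form H \<Longrightarrow> linear L \<Longrightarrow> sym_form (pullback_form H L)"
  unfolding sym_form_def bilinear_def pullback_form_def
  by (auto intro: linear_compose[unfolded o_def])

lemma sym_form_simps:
  assumes "sym_form b"
  shows "b (u + v) w = b u w + b v w" "b u (v + w) = b u v + b u w"
    "b (u - v) w = b u w - b v w" "b u (v - w) = b u v - b u w"
    "b (c *\<^sub>R u) w = c * b u w" "b u (c *\<^sub>R w) = c * b u w"
    "b 0 w = 0" "b u 0 = 0"
    "b (sum f I) w = (\<Sum>i\<in>I. b (f i) w)" "b u (sum f I) = (\<Sum>i\<in>I. b u (f i))"
  using sym_form_linear[OF assms]
  by (simp_all add: linear_add[OF sym_form_linear(1)[OF assms]] linear_add[OF sym_form_linear(2)[OF assms]]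
      linear_diff[OF sym_form_linear(1)[OF assms]] linear_diff[OF sym_form_linear(2)[OF assms]]
      linear_cmul[OF sym_form_linear(1)[OF assms]] linear_cmul[OF sym_form_linear(2)[OF assms]]
      linear_0[OF sym_form_linear(1)[OF assms]] linear_0[OF sym_form_linear(2)[OF assms]]
      linear_sum[OF sym_form_linear(1)[OF assms]] linear_sum[OF sym_form_linear(2)[OF assms]])

lemma sym_form_continuous:
  assumes "sym_form b"
  shows "continuous_on S (\<lambda>v. b v v)"
proof -
  have "bounded_bilinear b"
    using assms by (simp add: sym_form_def bilinear_conv_bounded_bilinear)
  from bounded_bilinear.continuous_on[OF this continuous_on_id continuous_on_id]
  show ?thesis .
qed

text \<open>The Rayleigh quotient is homogeneous of degree 0, so its infimum is attained on the
  compact Euclidean unit sphere of \<open>S\<close>; the minimizer is then rescaled.\<close>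

lemma rayleigh_minimizer:
  assumes G: "inner_form G" and b: "sym_form b" and S: "subspace S" "S \<noteq> {0}"
  obtains e where "e \<in> S" "G e e = 1" "\<And>v. v \<in> S \<Longrightarrow> b e e * G v v \<le> b v v"
proof -
  note Gs = inner_form_sym_form[OF G]
  let ?K = "S \<inter> sphere 0 1"
  have "compact ?K" using S by (intro closed_Int_compact closed_subspace) auto
  moreover obtain v0 where v0: "v0 \<in> S" "v0 \<noteq> 0" using S subspace_0 by blast
  then have "v0 /\<^sub>R norm v0 \<in> ?K" using S(1) by (auto intro: subspace_mul)
  then have "?K \<noteq> {}" by blast
  moreover have "continuous_on ?K (\<lambda>v. b v v / G v v)"
  proof (intro continuous_on_divide sym_form_continuous[OF Gs] sym_form_continuous[OF b] ballI)
    fix v assume "v \<in> ?K"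
    then have "v \<noteq> 0" by auto
    then show "G v v \<noteq> 0" using inner_form_pos[OF G, of v] by simp
  qed
  ultimately obtain e where e: "e \<in> ?K" "\<And>v. v \<in> ?K \<Longrightarrow> b e e / G e e \<le> b v v / G v v"
    using continuous_attains_inf[of ?K "\<lambda>v. b v v / G v v"] by blast
  have e0: "e \<noteq> 0" using e by auto
  let ?e = "e /\<^sub>R sqrt (G e e)"
  have Ge: "G e e > 0" using inner_form_pos[OF G e0] .
  have sc: "c (u /\<^sub>R r) (u /\<^sub>R r) = c u u / r\<^sup>2" if "sym_form c" for c r u
    by (simp add: sym_form_simps[OF that] divide_inverse power2_eq_square)
  show ?thesis
  proof
    show "?e \<in> S" using e S by (auto intro: subspace_mul)
    show "G ?e ?e = 1" using Ge by (simp add: sc[OF Gs])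
    fix v assume v: "v \<in> S"
    show "b ?e ?e * G v v \<le> b v v"
    proof (cases "v = 0")
      case True then show ?thesis by (simp add: sym_form_simps[OF Gs] sym_form_simps[OF b])
    next
      case False
      have "b e e / G e e \<le> b v v / G v v"
        using e(2)[of "v /\<^sub>R norm v"] v False S
        by (simp add: sc[OF Gs] sc[OF b] subspace_mul)
      moreover have "b ?e ?e = b e e / G e e" using Ge by (simp only: sc[OF b]) simp
      ultimately show ?thesis using inner_form_pos[OF G False] by (simp add: pos_le_divide_eq)
    qed
  qed
qed

text \<open>First variation: along \<open>e + t v\<close> minimality gives a quadratic polynomial in
  \<open>t\<close> that vanishes at 0 and is never negative, so its linear coefficient
  vanishes.\<close>

lemma rayleigh_critical:
  assumes G: "sym_form G" and b: "sym_form b" and S: "subspace S"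
    and e: "e \<in> S" "G e e = 1" "\<And>v. v \<in> S \<Longrightarrow> b e e * G v v \<le> b v v" and v: "v \<in> S"
  shows "b e v = b e e * G e v"
proof -
  define q where "q = b e v - b e e * G e v"
  define p where "p = b v v - b e e * G v v"
  have *: "0 \<le> 2 * t * q + t\<^sup>2 * p" for t
  proof -
    have "e + t *\<^sub>R v \<in> S" using S e v by (auto intro: subspace_add subspace_mul)
    from e(3)[OF this] show ?thesis
      using e(2) sym_form_sym[OF G, of e v] sym_form_sym[OF b, of e v]
      by (simp add: sym_form_simps[OF G] sym_form_simps[OF b] q_def p_def algebra_simps power2_eq_square)
  qed
  have "q = 0"
  proof (cases "p = 0")
    case True
    then show ?thesis using *[of "-q"] zero_le_square[of q] by simp
  next
    case False
    have "p \<ge> 0" unfolding p_def using e(3)[OF v] by simp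
    then have "p > 0" using False by simp
    have "2 * (-q/p) * q + (-q/p)\<^sup>2 * p = - (q\<^sup>2 / p)"
      using False by (simp add: field_simps power2_eq_square)
    with *[of "-q/p"] have "q\<^sup>2 / p \<le> 0" by simp
    then show ?thesis using \<open>p > 0\<close> by (simp add: divide_le_0_iff)
  qed
  then show ?thesis by (simp add: q_def)
qed

text \<open>The eigenvalues ascend, opposite to the listing of singular values: minimization finds
  the smallest one first, and the potential is built from the smallest ones. The last conjunct says
  that the orthonormal \<open>w i\<close> span \<open>S\<close>.\<close>

definition diagonalizes ::
  "'e::euclidean_space set \<Rightarrow> ('e \<Rightarrow> 'e \<Rightarrow> real) \<Rightarrow> ('e \<Rightarrow> 'e \<Rightarrow> real) \<Rightarrow> nat \<Rightarrow> (nat \<Rightarrow> 'e) \<Rightarrow> (nat \<Rightarrow> real) \<Rightarrow> bool" where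
  "diagonalizes S G b n w \<mu> \<longleftrightarrow> dim S = n \<and> (\<forall>i<n. w i \<in> S) \<and>
     (\<forall>i<n. \<forall>j<n. G (w i) (w j) = (if i = j then 1 else 0)) \<and>
     (\<forall>i<n. \<forall>j<n. b (w i) (w j) = (if i = j then \<mu> i else 0)) \<and>
     (\<forall>i j. i \<le> j \<longrightarrow> j < n \<longrightarrow> \<mu> i \<le> \<mu> j) \<and>
     (\<forall>v\<in>S. v = (\<Sum>i<n. G (w i) v *\<^sub>R w i))"

text \<open>By \<open>rayleigh_critical\<close> a minimizer is \<open>b\<close>-orthogonal to its
  \<open>G\<close>-orthogonal complement, so it can be split off and the induction continues there.
  Minimizing over smaller and smaller spaces puts the eigenvalues in order.\<close>

lemma diagonalizes_exists:
  assumes G: "inner_form G" and b: "sym_form b" and S: "subspace S"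
  obtains w \<mu> where "diagonalizes S G b (dim S) w \<mu>"
proof -
  note Gs = inner_form_sym_form[OF G]
  have "\<exists>w \<mu>. diagonalizes S G b n w \<mu>" if "dim S = n" "subspace S" for n S
    using that
  proof (induction n arbitrary: S)
    case 0
    then have "S = {0}" using subspace_0 by auto
    then show ?case by (auto simp: diagonalizes_def)
  next
    case (Suc n)
    have "S \<noteq> {0}" using Suc.prems(1) by auto
    then obtain e where e: "e \<in> S" "G e e = 1" "\<And>v. v \<in> S \<Longrightarrow> b e e * G v v \<le> b v v"
      using rayleigh_minimizer[OF G b Suc.prems(2)] by blast
    have crit: "b e v = b e e * G e v" if "v \<in> S" for v
      by (rule rayleigh_critical[OF Gs b Suc.prems(2) e(1,2) _ that]) (rule e(3))
    define S' where "S' = {v \<in> S. G e v = 0}"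
    have S': "subspace S'"
      using Suc.prems(2) by (auto simp: subspace_def S'_def sym_form_simps[OF Gs])
    have "span (insert e S') = S"
    proof
      show "span (insert e S') \<subseteq> S"
        using Suc.prems(2) e(1) by (intro span_minimal) (auto simp: S'_def)
      show "S \<subseteq> span (insert e S')"
      proof
        fix v assume "v \<in> S"
        then have "v - G e v *\<^sub>R e \<in> S'"
          using Suc.prems(2) e by (auto simp: S'_def sym_form_simps[OF Gs] subspace_diff subspace_mul)
        then have "(v - G e v *\<^sub>R e) + G e v *\<^sub>R e \<in> span (insert e S')"
          by (intro span_add span_mul span_base) auto
        then show "v \<in> span (insert e S')" by simp
      qed
    qed
    moreover have "e \<notin> span S'"
      using S' e(2) by (simp add: span_eq_iff[THEN iffD2]) (simp add: S'_def)
    ultimately have "dim S' = n"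
      using dim_insert[of e S'] Suc.prems(1) by (metis dim_span add_diff_cancel_right' Suc_eq_plus1)
    from Suc.IH[OF this S'] obtain w \<mu> where w: "diagonalizes S' G b n w \<mu>" by blast
    define w' where "w' = case_nat e w"
    define \<mu>' where "\<mu>' = case_nat (b e e) \<mu>"
    have wS: "w i \<in> S" "G e (w i) = 0" if "i < n" for i
      using w that by (auto simp: diagonalizes_def S'_def)
    have eb: "b e (w i) = 0" if "i < n" for i using crit[OF wS(1)[OF that]] wS(2)[OF that] by simp
    have wG: "G (w i) (w j) = (if i = j then 1 else 0)" and wb: "b (w i) (w j) = (if i = j then \<mu> i else 0)"
      if "i < n" "j < n" for i j using w that by (auto simp: diagonalizes_def)
    have wm: "\<mu> i \<le> \<mu> j" if "i \<le> j" "j < n" for i j using w that by (auto simp: diagonalizes_def)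
    have eb': "b (w i) e = 0" "G (w i) e = 0" if "i < n" for i
      using sym_form_sym[OF b, of "w i" e] sym_form_sym[OF Gs, of "w i" e] eb[OF that] wS(2)[OF that] by auto
    have mu: "b e e \<le> \<mu> i" if "i < n" for i
      using e(3)[OF wS(1)[OF that]] w that by (auto simp: diagonalizes_def)
    have "diagonalizes S G b (Suc n) w' \<mu>'"
      unfolding diagonalizes_def
    proof (intro conjI allI impI ballI)
      show "dim S = Suc n" by fact
      show "w' i \<in> S" if "i < Suc n" for i
        using that wS e(1) by (auto simp: w'_def split: nat.split)
      show "G (w' i) (w' j) = (if i = j then 1 else 0)" if "i < Suc n" "j < Suc n" for i j
        using that wG wS(2) e(2) eb' by (auto simp: w'_def split: nat.split)
      show "b (w' i) (w' j) = (if i = j then \<mu>' i else 0)" if "i < Suc n" "j < Suc n" for i j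
        using that wb eb eb' by (auto simp: w'_def \<mu>'_def split: nat.split)
      show "\<mu>' i \<le> \<mu>' j" if "i \<le> j" "j < Suc n" for i j
        using that wm mu by (auto simp: \<mu>'_def split: nat.split)
      fix v assume v: "v \<in> S"
      let ?v = "v - G e v *\<^sub>R e"
      have "?v \<in> S'"
          using v Suc.prems(2) e by (auto simp: S'_def sym_form_simps[OF Gs] subspace_diff subspace_mul)
      then have "?v = (\<Sum>i<n. G (w i) ?v *\<^sub>R w i)" using w by (auto simp: diagonalizes_def)
      also have "\<dots> = (\<Sum>i<n. G (w i) v *\<^sub>R w i)"
        by (intro sum.cong refl) (simp add: sym_form_simps[OF Gs] eb')
      finally show "v = (\<Sum>i<Suc n. G (w' i) v *\<^sub>R w' i)"
        by (simp add: sum.lessThan_Suc_shift w'_def algebra_simps del: sum.lessThan_Suc)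
    qed
    then show ?case by blast
  qed
  then show ?thesis using S that by blast
qed

section \<open>Coordinates in a diagonalizing basis\<close>

context
  fixes S :: "'e::euclidean_space set" and G b :: "'e \<Rightarrow> 'e \<Rightarrow> real" and n :: nat and w \<mu>
  assumes G: "inner_form G" and b: "sym_form b" and D: "diagonalizes S G b n w \<mu>"
begin

lemma diagonalizes_G: "i < n \<Longrightarrow> j < n \<Longrightarrow> G (w i) (w j) = (if i = j then 1 else 0)"
  and diagonalizes_b: "i < n \<Longrightarrow> j < n \<Longrightarrow> b (w i) (w j) = (if i = j then \<mu> i else 0)"
  and diagonalizes_in: "i < n \<Longrightarrow> w i \<in> S"
  and diagonalizes_dim: "dim S = n"
  and diagonalizes_mono: "i \<le> j \<Longrightarrow> j < n \<Longrightarrow> \<mu> i \<le> \<mu> j"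
  and diagonalizes_expand: "v \<in> S \<Longrightarrow> v = (\<Sum>i<n. G (w i) v *\<^sub>R w i)"
  using D by (auto simp: diagonalizes_def)

lemma diagonalizes_b_basis:
  assumes v: "v \<in> S" and i: "i < n"
  shows "b v (w i) = \<mu> i * G (w i) v"
proof -
  have "b v (w i) = b (\<Sum>j<n. G (w j) v *\<^sub>R w j) (w i)" using diagonalizes_expand[OF v] by simp
  also have "\<dots> = (\<Sum>j<n. if j = i then G (w i) v * \<mu> i else 0)"
    unfolding sym_form_simps[OF b] using i by (intro sum.cong) (auto simp: diagonalizes_b)
  finally show ?thesis using i by (simp add: mult.commute)
qed

lemma diagonalizes_b_expand:
  assumes v: "u \<in> S" "v \<in> S"
  shows "b u v = (\<Sum>i<n. \<mu> i * (G (w i) u * G (w i) v))"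
proof -
  have "b u v = b u (\<Sum>i<n. G (w i) v *\<^sub>R w i)" using diagonalizes_expand[OF v(2)] by simp
  also have "\<dots> = (\<Sum>i<n. \<mu> i * (G (w i) u * G (w i) v))"
    unfolding sym_form_simps[OF b] using v
    by (intro sum.cong) (auto simp: diagonalizes_b_basis)
  finally show ?thesis .
qed

lemma diagonalizes_G_expand:
  assumes v: "v \<in> S"
  shows "G u v = (\<Sum>i<n. G (w i) u * G (w i) v)"
proof -
  note Gs = inner_form_sym_form[OF G]
  have "G u v = G u (\<Sum>i<n. G (w i) v *\<^sub>R w i)" using diagonalizes_expand[OF v(1)] by simp
  also have "\<dots> = (\<Sum>i<n. G (w i) u * G (w i) v)"
    unfolding sym_form_simps[OF Gs] using v
    by (intro sum.cong) (auto simp: sym_form_sym[OF Gs, of u])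
  finally show ?thesis .
qed

lemma diagonalizes_inj: "inj_on w {..<n}"
  by (rule inj_onI) (metis diagonalizes_G lessThan_iff zero_neq_one)

lemma diagonalizes_independent:
  assumes "I \<subseteq> {..<n}"
  shows "independent (w ` I)" "dim (w ` I) = card I"
proof -
  have sp: "S \<subseteq> span (w ` {..<n})"
    using diagonalizes_expand by (metis (no_types, lifting) imageI span_base span_scale span_sum subsetI)
  have "independent (w ` {..<n})"
    by (rule card_le_dim_spanning[OF _ sp])
      (use diagonalizes_in diagonalizes_dim diagonalizes_inj in \<open>auto simp: card_image\<close>)
  then show i: "independent (w ` I)" using assms by (meson image_mono independent_mono)
  show "dim (w ` I) = card I"
    using dim_eq_card_independent[OF i] card_image[OF inj_on_subset[OF diagonalizes_inj assms]] by simp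
qed

lemma diagonalizes_span_zero:
  assumes I: "I \<subseteq> {..<n}" and v: "v \<in> span (w ` I)" and i: "i < n" "i \<notin> I"
  shows "G (w i) v = 0"
  using v
proof (induction rule: span_induct)
  case base
  show ?case by (auto simp: subspace_def sym_form_simps[OF inner_form_sym_form[OF G]])
next
  case (step x)
  then show ?case using I i by (force simp: diagonalizes_G)
qed

text \<open>Supplies the test space of the minimax principle: on the span of the first
  \<open>j + 1\<close> eigenvectors only eigenvalues up to \<open>\<mu> j\<close>
  contribute.\<close>

lemma diagonalizes_span_le:
  assumes S: "subspace S" and j: "j < n" and v: "v \<in> span (w ` {..j})"
  shows "b v v \<le> \<mu> j * G v v"
proof -
  have vS: "v \<in> S"
    using span_minimal[of "w ` {..j}" S] v S diagonalizes_in j by (force simp: image_subset_iff)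
  show ?thesis
    unfolding diagonalizes_b_expand[OF vS vS] diagonalizes_G_expand[OF vS, of v] sum_distrib_left
  proof (rule sum_mono)
    fix i assume i: "i \<in> {..<n}"
    show "\<mu> i * (G (w i) v * G (w i) v) \<le> \<mu> j * (G (w i) v * G (w i) v)"
    proof (cases "i \<le> j")
      case True then show ?thesis using j by (auto intro!: mult_right_mono diagonalizes_mono)
    next
      case False
      moreover have "{..j} \<subseteq> {..<n}" using j by auto
      ultimately have "G (w i) v = 0" using diagonalizes_span_zero[of "{..j}" v i] v i by auto
      then show ?thesis by simp
    qed
  qed
qed

end

text \<open>\<open>S\<close> has dimension above \<open>j\<close>, hence shares a nonzero vector
  with the space \<open>T\<close> cut out by \<open>j\<close> equations. On \<open>T\<close> the
  form \<open>b\<close> is at least \<open>\<mu> j * G\<close>; comparison at the common vector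
  gives the bound.\<close>

lemma courant_fischer:
  fixes G b :: "'e::euclidean_space \<Rightarrow> 'e \<Rightarrow> real"
  assumes G: "inner_form G" and b: "sym_form b"
    and D: "diagonalizes UNIV G b DIM('e) w \<mu>" and j: "j < DIM('e)"
    and S: "subspace S" "j < dim S" "\<And>v. v \<in> S \<Longrightarrow> b v v \<le> M * G v v"
  shows "\<mu> j \<le> M"
proof -
  note Gs = inner_form_sym_form[OF G]
  define T where "T = {v. \<forall>i<j. G (w i) v = 0}"
  have T: "subspace T" by (auto simp: T_def subspace_def sym_form_simps[OF Gs])
  let ?W = "span (w ` {..<j})"
  \<comment> \<open>Subtracting the projection to the first \<open>j\<close> eigenvectors lands in
    \<open>T\<close>, so \<open>T\<close> has codimension at most \<open>j\<close>.\<close>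
  have "{x + y |x y. x \<in> T \<and> y \<in> ?W} = UNIV"
  proof -
    have "\<exists>x y. v = x + y \<and> x \<in> T \<and> y \<in> ?W" for v
    proof (intro exI conjI)
      let ?y = "\<Sum>i<j. G (w i) v *\<^sub>R w i"
      show "v = (v - ?y) + ?y" by simp
      show "?y \<in> ?W" by (intro span_sum span_scale span_base) auto
      have "G (w i) ?y = G (w i) v" if "i < j" for i
      proof -
        have "G (w i) ?y = (\<Sum>l<j. if l = i then G (w i) v else 0)"
          unfolding sym_form_simps[OF Gs] using that j
          by (intro sum.cong) (auto simp: diagonalizes_G[OF G b D])
        then show ?thesis using that by simp
      qed
      then show "v - ?y \<in> T" by (simp add: T_def sym_form_simps(4)[OF Gs])
    qed
    then show ?thesis by auto
  qed
  moreover have "dim ?W \<le> j"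
    using dim_le_card[of "w ` {..<j}" "w ` {..<j}"] card_image_le[of "{..<j}" w] span_superset by force
  ultimately have "DIM('e) \<le> dim T + j"
    using dim_sums_Int[OF T subspace_span, of "w ` {..<j}"] by simp
  moreover have "dim {x + y |x y. x \<in> S \<and> y \<in> T} \<le> DIM('e)" by (rule dim_subset_UNIV)
  ultimately have "dim (S \<inter> T) > 0" using dim_sums_Int[OF S(1) T] S(2) by linarith
  then obtain v where v: "v \<in> S" "v \<in> T" "v \<noteq> 0"
    by (metis Int_iff dim_eq_0 neq0_conv singletonI subsetI)
  have "\<mu> j * G v v \<le> b v v"
    unfolding diagonalizes_b_expand[OF G b D UNIV_I UNIV_I] diagonalizes_G_expand[OF G b D UNIV_I, of v v] sum_distrib_left
  proof (rule sum_mono)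
    fix i assume i: "i \<in> {..<DIM('e)}"
    show "\<mu> j * (G (w i) v * G (w i) v) \<le> \<mu> i * (G (w i) v * G (w i) v)"
    proof (cases "i < j")
      case True then show ?thesis using v(2) by (auto simp: T_def)
    next
      case False then show ?thesis
        using i by (auto intro!: mult_right_mono diagonalizes_mono[OF G b D])
    qed
  qed
  also have "\<dots> \<le> M * G v v" using S(3) v by blast
  finally show ?thesis using inner_form_pos[OF G v(3)] by simp
qed

text \<open>\<open>T\<close> carries the optimal test space of the second pair of forms to a test
  space for the first. \<open>K\<close> is paid twice, once for \<open>b\<close> and once for the
  inner product, hence the square.\<close>

lemma rayleigh_comparison:
  fixes G b :: "'e::euclidean_space \<Rightarrow> 'e \<Rightarrow> real"
  assumes G: "inner_form G" "inner_form G'" and b: "sym_form b" "sym_form b'"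
    and D: "diagonalizes UNIV G b DIM('e) w \<mu>" "diagonalizes UNIV G' b' DIM('e) w' \<mu>'"
    and j: "j < DIM('e)" and T: "linear T" "inj T" and K: "K \<ge> 0" and nn: "0 \<le> \<mu>' j"
    and c: "\<And>v. b (T v) (T v) \<le> K * b' v v" "\<And>v. G' v v \<le> K * G (T v) (T v)"
  shows "\<mu> j \<le> K\<^sup>2 * \<mu>' j"
proof (rule courant_fischer[OF G(1) b(1) D(1) j])
  let ?S = "T ` span (w' ` {..j})"
  show "subspace ?S" using T(1) by (intro linear_subspace_image subspace_span)
  show "j < dim ?S"
    using dim_image_eq[OF T(1) inj_on_subset[OF T(2) subset_UNIV], of "span (w' ` {..j})"]
      diagonalizes_independent(2)[OF G(2) b(2) D(2), of "{..j}"] j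
    by (simp add: subset_iff)
  fix v assume "v \<in> ?S"
  then obtain u where u: "u \<in> span (w' ` {..j})" "v = T u" by auto
  have "b v v \<le> K * b' u u" using c u by simp
  also have "\<dots> \<le> K * (\<mu>' j * G' u u)"
    using diagonalizes_span_le[OF G(2) b(2) D(2) _ j u(1)] K by (simp add: mult_left_mono)
  also have "\<dots> \<le> K * (\<mu>' j * (K * G v v))"
    using c(2)[of u] u K nn by (intro mult_left_mono) auto
  finally show "b v v \<le> K\<^sup>2 * \<mu>' j * G v v"
    by (simp add: power2_eq_square algebra_simps)
qed

section \<open>Gram determinants: squared volumes of tuples of vectors\<close>

definition gram :: "('e \<Rightarrow> 'e \<Rightarrow> real) \<Rightarrow> (nat \<Rightarrow> 'e) \<Rightarrow> nat \<Rightarrow> real mat" where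
  "gram b v k = mat k k (\<lambda>(i, j). b (v i) (v j))"

lemma det_diagonal:
  "Determinant.det (mat k k (\<lambda>(i, j). if i = j then d i else 0)) = (\<Prod>i<k. d i :: real)"
proof -
  have "diag_mat (mat k k (\<lambda>(i, j). if i = j then d i else 0)) = map d [0..<k]"
    by (auto simp: diag_mat_def)
  then show ?thesis
    by (subst det_upper_triangular[of _ k])
      (auto simp: upper_triangular_def prod.distinct_set_conv_list[symmetric] lessThan_atLeast0)
qed

text \<open>With \<open>C\<close> the matrix of \<open>v\<close> in the basis \<open>w\<close>, the
  two Gram matrices are \<open>C^T C\<close> and \<open>C^T E C\<close>. As \<open>S\<close> has
  dimension \<open>k\<close>, \<open>C\<close> is square, and all \<open>k\<close>-volumes in
  \<open>S\<close> are distorted by the same factor.\<close>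

lemma gram_det_diagonalizes:
  assumes G: "inner_form G" and b: "sym_form b" and D: "diagonalizes S G b k w \<mu>"
    and v: "\<And>i. i < k \<Longrightarrow> v i \<in> S"
  shows "Determinant.det (gram b v k) = (\<Prod>i<k. \<mu> i) * Determinant.det (gram G v k)"
    "Determinant.det (gram G v k) \<ge> 0"
proof -
  define C where "C = mat k k (\<lambda>(i, j). G (w i) (v j))"
  define E where "E = mat k k (\<lambda>(i, j). if i = j then \<mu> i else 0)"
  have C: "C \<in> carrier_mat k k" and E: "E \<in> carrier_mat k k" by (auto simp: C_def E_def)
  have Gv: "G (v i) (v j) = (\<Sum>l<k. G (w l) (v i) * G (w l) (v j))" if "i < k" "j < k" for i j
    using diagonalizes_G_expand[OF G b D v[OF that(2)]] .
  have "gram G v k = transpose_mat C * C"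
    by (rule eq_matI)
      (auto simp: gram_def C_def scalar_prod_def Gv lessThan_atLeast0)
  then have 1: "Determinant.det (gram G v k) = (Determinant.det C)\<^sup>2"
    using C by (simp add: det_mult[of _ k] det_transpose[of _ k] power2_eq_square)
  then show "Determinant.det (gram G v k) \<ge> 0" by simp
  have EC: "E * C = mat k k (\<lambda>(i, j). \<mu> i * G (w i) (v j))"
  proof (rule eq_matI)
    fix i j assume "i < dim_row (mat k k (\<lambda>(i, j). \<mu> i * G (w i) (v j)))"
      "j < dim_col (mat k k (\<lambda>(i, j). \<mu> i * G (w i) (v j)))"
    then have ij: "i < k" "j < k" by auto
    have "(E * C) $$ (i, j) = (\<Sum>l=0..<k. (if i = l then \<mu> i else 0) * G (w l) (v j))"
      using ij by (simp add: E_def C_def scalar_prod_def)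
    also have "\<dots> = (\<Sum>l=0..<k. if i = l then \<mu> i * G (w l) (v j) else 0)"
      by (intro sum.cong) auto
    finally show "(E * C) $$ (i, j) = mat k k (\<lambda>(i, j). \<mu> i * G (w i) (v j)) $$ (i, j)"
      using ij by simp
  qed (auto simp: E_def C_def)
  have "gram b v k = transpose_mat C * (E * C)"
    unfolding EC
    by (rule eq_matI)
      (auto simp: gram_def C_def scalar_prod_def diagonalizes_b_expand[OF G b D v v] lessThan_atLeast0
        intro!: sum.cong)
  then have "Determinant.det (gram b v k) = Determinant.det C * (Determinant.det E * Determinant.det C)"
    using C E by (simp add: det_mult[of _ k] det_transpose[of _ k])
  then show "Determinant.det (gram b v k) = (\<Prod>i<k. \<mu> i) * Determinant.det (gram G v k)"
    by (simp add: 1 power2_eq_square E_def det_diagonal)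
qed

text \<open>On the span of the \<open>v i\<close> the distortion is exactly the product of the
  eigenvalues of the restricted form, and by \<open>courant_fischer\<close> restriction only raises
  the ordered eigenvalues.\<close>

lemma gram_det_ge:
  fixes G b :: "'e::euclidean_space \<Rightarrow> 'e \<Rightarrow> real"
  assumes G: "inner_form G" and b: "sym_form b"
    and D: "diagonalizes UNIV G b DIM('e) w \<mu>" and nn: "\<And>i. i < DIM('e) \<Longrightarrow> 0 \<le> \<mu> i"
    and k: "k \<le> DIM('e)" and v: "dim (v ` {..<k}) = k"
  shows "(\<Prod>i<k. \<mu> i) * Determinant.det (gram G v k) \<le> Determinant.det (gram b v k)"
proof -
  let ?S = "span (v ` {..<k})"
  obtain w' \<mu>' where D': "diagonalizes ?S G b k w' \<mu>'"
    using diagonalizes_exists[OF G b subspace_span, of "v ` {..<k}"] v by auto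
  have vS: "v i \<in> ?S" if "i < k" for i using that by (auto intro: span_base)
  have "\<mu> j \<le> \<mu>' j" if j: "j < k" for j
  proof (rule courant_fischer[OF G b D])
    show "j < DIM('e)" using j k by simp
    show "subspace (span (w' ` {..j}))" by simp
    show "j < dim (span (w' ` {..j}))"
      using diagonalizes_independent(2)[OF G b D', of "{..j}"] j by (simp add: subset_iff)
    show "b v v \<le> \<mu>' j * G v v" if "v \<in> span (w' ` {..j})" for v
      using diagonalizes_span_le[OF G b D' _ j that] by simp
  qed
  then have "(\<Prod>i<k. \<mu> i) \<le> (\<Prod>i<k. \<mu>' i)" using nn k by (intro prod_mono) auto
  then show ?thesis
    using gram_det_diagonalizes[OF G b D' vS] by (simp add: mult_right_mono)
qed

lemma gram_pullback: "gram (pullback_form H L) v k = gram H (L \<circ> v) k"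
  by (auto simp: gram_def pullback_form_def)

text \<open>The product of the \<open>k\<close> smallest eigenvalues is the least distortion of squared
  \<open>k\<close>-volumes, and distortions multiply along a composition.\<close>

lemma prod_eigenvalues_comp:
  fixes G1 G2 G3 :: "'e::euclidean_space \<Rightarrow> 'e \<Rightarrow> real"
  assumes G: "inner_form G1" "inner_form G2" "inner_form G3"
    and L: "linear L1" "inj L1" "linear L2" "inj L2"
    and D1: "diagonalizes UNIV G1 (pullback_form G2 L1) DIM('e) w1 \<mu>1"
    and D2: "diagonalizes UNIV G2 (pullback_form G3 L2) DIM('e) w2 \<mu>2"
    and D3: "diagonalizes UNIV G1 (pullback_form G3 (L2 \<circ> L1)) DIM('e) w3 \<mu>3"
    and nn: "\<And>i. i < DIM('e) \<Longrightarrow> 0 \<le> \<mu>1 i" "\<And>i. i < DIM('e) \<Longrightarrow> 0 \<le> \<mu>2 i"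
    and k: "k \<le> DIM('e)"
  shows "(\<Prod>i<k. \<mu>1 i) * (\<Prod>i<k. \<mu>2 i) \<le> (\<Prod>i<k. \<mu>3 i)"
proof -
  note b1 = sym_form_pullback[OF inner_form_sym_form[OF G(2)] L(1)]
  note b2 = sym_form_pullback[OF inner_form_sym_form[OF G(3)] L(3)]
  note b3 = sym_form_pullback[OF inner_form_sym_form[OF G(3)] linear_compose[OF L(1,3)]]
  have kk: "{..<k} \<subseteq> {..<DIM('e)}" using k by auto
  \<comment> \<open>The test tuple consists of the first \<open>k\<close> eigenvectors of the
    composition. For the composition its distortion is exactly the product of the
    \<open>\<mu>3 i\<close>; for the two factors \<open>gram_det_ge\<close> bounds it from
    below.\<close>
  have d1: "dim (w3 ` {..<k}) = k"
    using diagonalizes_independent(2)[OF G(1) b3 D3 kk] by simp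
  have "dim (L1 ` w3 ` {..<k}) = k"
    using dim_image_eq[OF L(1) inj_on_subset[OF L(2) subset_UNIV], of "w3 ` {..<k}"] d1 by simp
  then have d2: "dim ((L1 \<circ> w3) ` {..<k}) = k" by (simp add: image_comp)
  have g1: "gram G1 w3 k = 1\<^sub>m k"
    using k by (intro eq_matI) (auto simp: gram_def diagonalizes_G[OF G(1) b3 D3])
  have "gram (pullback_form G3 (L2 \<circ> L1)) w3 k = mat k k (\<lambda>(i, j). if i = j then \<mu>3 i else 0)"
    using k by (intro eq_matI) (auto simp: gram_def diagonalizes_b[OF G(1) b3 D3])
  then have "(\<Prod>i<k. \<mu>3 i) = Determinant.det (gram (pullback_form G3 (L2 \<circ> L1)) w3 k)"
    by (simp add: det_diagonal)
  also have "\<dots> = Determinant.det (gram (pullback_form G3 L2) (L1 \<circ> w3) k)"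
    by (simp add: gram_pullback o_assoc)
  also have "\<dots> \<ge> (\<Prod>i<k. \<mu>2 i) * Determinant.det (gram G2 (L1 \<circ> w3) k)"
    by (rule gram_det_ge[OF G(2) b2 D2 nn(2) k d2])
  also have "gram G2 (L1 \<circ> w3) k = gram (pullback_form G2 L1) w3 k"
    by (simp add: gram_pullback)
  also have "(\<Prod>i<k. \<mu>2 i) * Determinant.det (gram (pullback_form G2 L1) w3 k) \<ge> (\<Prod>i<k. \<mu>2 i) * (\<Prod>i<k. \<mu>1 i)"
    using gram_det_ge[OF G(1) b1 D1 nn(1) k d1] nn(2) k
    by (intro mult_left_mono) (auto simp: g1 intro!: prod_nonneg)
  finally show ?thesis by (simp add: mult.commute)
qed

text \<open>\<open>singular_values\<close> counts each \<sigma> by the dimension of an eigenspace.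
  That eigenspace is spanned by the \<open>w i\<close> with eigenvalue
  \<open>\<sigma>\<^sup>2\<close>, so the counting function is that of the list of the square roots,
  which \<open>rev\<close> turns into descending order.\<close>

lemma singular_values_eq:
  fixes G H :: "'e::euclidean_space \<Rightarrow> 'e \<Rightarrow> real"
  assumes G: "inner_form G" and H: "inner_form H" and L: "linear L"
    and D: "diagonalizes UNIV G (pullback_form H L) DIM('e) w \<mu>"
  shows "singular_values G H L = rev (map (\<lambda>i. sqrt (\<mu> i)) [0..<DIM('e)])"
proof -
  let ?m = "DIM('e)"
  define b where "b = pullback_form H L"
  have b: "sym_form b" unfolding b_def by (rule sym_form_pullback[OF inner_form_sym_form[OF H] L])
  note D = D[folded b_def]
  have nn: "0 \<le> \<mu> i" if "i < ?m" for i
    using diagonalizes_b[OF G b D that that] inner_form_nonneg[OF H, of "L (w i)"]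
    by (simp add: b_def pullback_form_def)
  define xs where "xs = map (\<lambda>i. sqrt (\<mu> i)) [0..<?m]"
  have cnt: "count (mset xs) \<sigma> = card {i. i < ?m \<and> sqrt (\<mu> i) = \<sigma>}" for \<sigma>
  proof -
    have "count (mset xs) \<sigma> = length (filter ((=) \<sigma>) xs)" by (simp add: count_mset count_list_eq_length_filter)
    also have "\<dots> = card {i. i < ?m \<and> sqrt (\<mu> i) = \<sigma>}"
      unfolding length_filter_conv_card by (rule arg_cong[where f = card]) (auto simp: xs_def)
    finally show ?thesis .
  qed
  have "(if \<sigma> \<ge> 0 then dim {u. \<forall>v. H (L u) (L v) = \<sigma>\<^sup>2 * G u v} else 0) = count (mset xs) \<sigma>" for \<sigma>
  proof (cases "\<sigma> \<ge> 0")
    case False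
    then have "{i. i < ?m \<and> sqrt (\<mu> i) = \<sigma>} = {}" using nn by auto
    then show ?thesis unfolding cnt using False by (simp only: card.empty if_False)
  next
    case True
    define I where "I = {i. i < ?m \<and> sqrt (\<mu> i) = \<sigma>}"
    have I: "I = {i. i < ?m \<and> \<mu> i = \<sigma>\<^sup>2}" using True nn by (auto simp: I_def)
    have "{u. \<forall>v. b u v = \<sigma>\<^sup>2 * G u v} = span (w ` I)"
    proof
      show "{u. \<forall>v. b u v = \<sigma>\<^sup>2 * G u v} \<subseteq> span (w ` I)"
      proof
        fix u assume "u \<in> {u. \<forall>v. b u v = \<sigma>\<^sup>2 * G u v}"
        then have u: "b u v = \<sigma>\<^sup>2 * G u v" for v by auto
        have z: "G (w i) u = 0" if "i < ?m" "i \<notin> I" for i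
          using u[of "w i"] diagonalizes_b_basis[OF G b D UNIV_I that(1), of u] that
            sym_form_sym[OF inner_form_sym_form[OF G], of u "w i"] by (auto simp: I)
        have "u = (\<Sum>i<?m. G (w i) u *\<^sub>R w i)" by (rule diagonalizes_expand[OF G b D UNIV_I])
        also have "\<dots> \<in> span (w ` I)"
        proof (intro span_sum)
          fix i assume "i \<in> {..<?m}"
          then show "G (w i) u *\<^sub>R w i \<in> span (w ` I)"
            by (cases "i \<in> I") (auto intro: span_scale span_base simp: z span_0)
        qed
        finally show "u \<in> span (w ` I)" .
      qed
      show "span (w ` I) \<subseteq> {u. \<forall>v. b u v = \<sigma>\<^sup>2 * G u v}"
      proof (rule span_minimal)
        have "b (w i) v = \<sigma>\<^sup>2 * G (w i) v" if "i \<in> I" for i v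
          using that diagonalizes_b_basis[OF G b D UNIV_I, of i v] sym_form_sym[OF b, of v "w i"]
          by (auto simp: I)
        then show "w ` I \<subseteq> {u. \<forall>v. b u v = \<sigma>\<^sup>2 * G u v}" by auto
        show "subspace {u. \<forall>v. b u v = \<sigma>\<^sup>2 * G u v}"
          by (auto simp: subspace_def sym_form_simps[OF b] sym_form_simps[OF inner_form_sym_form[OF G]]
              algebra_simps)
      qed
    qed
    then have "dim {u. \<forall>v. b u v = \<sigma>\<^sup>2 * G u v} = card I"
      using diagonalizes_independent(2)[OF G b D, of I] by (auto simp: I_def)
    then show ?thesis using True unfolding cnt by (simp add: b_def pullback_form_def I_def)
  qed
  then have "Abs_multiset (\<lambda>\<sigma>. if \<sigma> \<ge> 0 then dim {u. \<forall>v. H (L u) (L v) = \<sigma>\<^sup>2 * G u v} else 0) = mset xs"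
    by (simp add: count_inverse)
  moreover have "sorted xs"
    unfolding xs_def sorted_iff_nth_mono
    by (auto intro!: diagonalizes_mono[OF G b D])
  ultimately show ?thesis
    unfolding singular_values_def xs_def[symmetric]
    by (simp add: sorted_list_of_multiset_mset sorted_sort_id)
qed

section \<open>Pressure of expansive maps\<close>

lemma iterate_continuous:
  assumes "continuous_on UNIV (f :: 'm::topological_space \<Rightarrow> 'm)"
  shows "continuous_on UNIV (f ^^ n)"
proof (induction n)
  case (Suc n)
  then show ?case
    using continuous_on_compose2[OF assms Suc] by (simp add: o_def)
qed (simp add: id_def)

lemma iterate_in: "f ` X \<subseteq> X \<Longrightarrow> x \<in> X \<Longrightarrow> (f ^^ n) x \<in> X"
  by (induction n) auto

lemma compact_decreasing_Inter:
  fixes F :: "nat \<Rightarrow> 'a::t2_space set"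
  assumes "\<And>n. compact (F n)" "\<And>n. F n \<noteq> {}" "\<And>m n. m \<le> n \<Longrightarrow> F n \<subseteq> F m"
  shows "(\<Inter>n. F n) \<noteq> {}"
proof -
  have "F 0 \<inter> (\<Inter>n. F n) \<noteq> {}"
  proof (rule compact_imp_fip_image[OF assms(1)])
    fix I :: "nat set" assume "finite I"
    then have "F (Max (insert 0 I)) \<subseteq> F 0 \<inter> (\<Inter>n\<in>I. F n)"
      using assms(3) by (intro Int_greatest INT_greatest) (auto intro!: Max_ge)
    then show "F 0 \<inter> (\<Inter>n\<in>I. F n) \<noteq> {}" using assms(2) by blast
  qed (use assms(1) compact_imp_closed in auto)
  then show ?thesis by blast
qed

lemma bowen_dist_gt_iff:
  "n \<ge> 1 \<Longrightarrow> \<epsilon> < bowen_dist f n x y \<longleftrightarrow> (\<exists>i<n. \<epsilon> < dist ((f ^^ i) x) ((f ^^ i) y))"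
  unfolding bowen_dist_def by (subst Max_gr_iff) (auto simp: lessThan_empty_iff)

lemma separated_iff:
  "n \<ge> 1 \<Longrightarrow> separated f n \<epsilon> E \<longleftrightarrow>
    (\<forall>x\<in>E. \<forall>y\<in>E. x \<noteq> y \<longrightarrow> (\<exists>i<n. \<epsilon> < dist ((f ^^ i) x) ((f ^^ i) y)))"
  by (simp add: separated_def bowen_dist_gt_iff)

text \<open>Finitely many open Bowen balls of radius \<open>\<epsilon>/2\<close> cover
  \<open>X\<close>, and each holds at most one point of a separated set.\<close>

lemma separated_card_bound:
  assumes X: "compact X" and f: "continuous_on UNIV (f :: 'm::metric_space \<Rightarrow> 'm)"
    and n: "n \<ge> 1" and \<epsilon>: "\<epsilon> > 0"
  obtains C where "\<And>E. E \<subseteq> X \<Longrightarrow> separated f n \<epsilon> E \<Longrightarrow> finite E \<and> card E \<le> C"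
proof -
  define U where "U x = (\<Inter>i<n. (f ^^ i) -` ball ((f ^^ i) x) (\<epsilon>/2))" for x
  have "open (U x)" for x
    unfolding U_def
    by (intro open_INT ballI open_vimage) (auto intro: iterate_continuous f)
  moreover have "X \<subseteq> (\<Union>x\<in>X. U x)" using \<epsilon> by (auto simp: U_def)
  ultimately obtain D where D: "D \<subseteq> X" "finite D" "X \<subseteq> (\<Union>x\<in>D. U x)"
    using compactE_image[OF X, of X U] by metis
  have "finite E \<and> card E \<le> card D" if E: "E \<subseteq> X" "separated f n \<epsilon> E" for E
  proof -
    have "\<forall>x\<in>E. \<exists>d\<in>D. x \<in> U d" using D E by blast
    then obtain q where q: "\<And>x. x \<in> E \<Longrightarrow> q x \<in> D \<and> x \<in> U (q x)" by metis
    have "inj_on q E"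
    proof (rule inj_onI, rule ccontr)
      fix x y assume xy: "x \<in> E" "y \<in> E" "q x = q y" "x \<noteq> y"
      then obtain i where i: "i < n" "\<epsilon> < dist ((f ^^ i) x) ((f ^^ i) y)"
        using E(2) unfolding separated_iff[OF n] by blast
      have "dist ((f ^^ i) (q x)) ((f ^^ i) x) < \<epsilon>/2" "dist ((f ^^ i) (q x)) ((f ^^ i) y) < \<epsilon>/2"
        using q[OF xy(1)] q[OF xy(2)] i xy(3) by (auto simp: U_def)
      with i(2) show False using dist_triangle3[of "(f ^^ i) x" "(f ^^ i) y" "(f ^^ i) (q x)"] by linarith
    qed
    moreover have "q ` E \<subseteq> D" using q by auto
    ultimately show ?thesis using D(2) by (meson card_inj_on_le inj_on_finite)
  qed
  then show ?thesis using that by blast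
qed

text \<open>The weak inequality makes "staying \<open>e\<close>-close" a closed condition, as the
  compactness argument in \<open>expansive_uniform\<close> requires.\<close>

definition expansive_on :: "'m::metric_space set \<Rightarrow> ('m \<Rightarrow> 'm) \<Rightarrow> real \<Rightarrow> bool" where
  "expansive_on X f e \<longleftrightarrow>
     (\<forall>x\<in>X. \<forall>y\<in>X. (\<forall>n. dist ((f ^^ n) x) ((f ^^ n) y) \<le> e) \<longrightarrow> x = y)"

text \<open>Pairs at distance at least \<epsilon> that stay \<open>e\<close>-close for
  \<open>m\<close> steps form a decreasing sequence of compact sets. A common point would contradict
  expansivity, so one of the sets is empty.\<close>

lemma expansive_uniform:
  assumes X: "compact X" and f: "continuous_on UNIV (f :: 'm::metric_space \<Rightarrow> 'm)"
    and e: "expansive_on X f e" and \<epsilon>: "\<epsilon> > 0"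
  obtains m where "\<And>x y. x \<in> X \<Longrightarrow> y \<in> X \<Longrightarrow> (\<And>i. i < m \<Longrightarrow> dist ((f ^^ i) x) ((f ^^ i) y) \<le> e) \<Longrightarrow> dist x y \<le> \<epsilon>"
proof -
  define K where "K m = (X \<times> X) \<inter> ({p. \<epsilon> \<le> dist (fst p) (snd p)} \<inter>
      (\<Inter>i<m. {p. dist ((f ^^ i) (fst p)) ((f ^^ i) (snd p)) \<le> e}))" for m
  have cl: "closed {p. dist ((f ^^ i) (fst p)) ((f ^^ i) (snd p)) \<le> e}" for i
    by (intro closed_Collect_le continuous_intros continuous_on_compose2[OF iterate_continuous[OF f]]) auto
  have "compact (K m)" for m
    unfolding K_def
    by (intro compact_Int_closed compact_Times X closed_Int closed_INT ballI cl closed_Collect_le continuous_intros)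
  moreover have "K n \<subseteq> K m" if "m \<le> n" for m n
    using that unfolding K_def by fastforce
  ultimately have ne: "\<Inter>(range K) \<noteq> {}" if "\<And>m. K m \<noteq> {}"
    using compact_decreasing_Inter[of K] that by blast
  have "\<exists>m. K m = {}"
  proof (rule ccontr)
    assume "\<not> ?thesis"
    with ne obtain p where p: "\<And>m. p \<in> K m" by blast
    have "fst p \<in> X" "snd p \<in> X" "\<epsilon> \<le> dist (fst p) (snd p)" using p[of 0] by (auto simp: K_def)
    moreover have "dist ((f ^^ i) (fst p)) ((f ^^ i) (snd p)) \<le> e" for i
      using p[of "Suc i"] by (auto simp: K_def)
    ultimately show False using e \<epsilon> unfolding expansive_on_def by fastforce
  qed
  then obtain m where m: "K m = {}" by blast
  have "dist x y \<le> \<epsilon>" if "x \<in> X" "y \<in> X" "\<And>i. i < m \<Longrightarrow> dist ((f ^^ i) x) ((f ^^ i) y) \<le> e" for x y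
  proof (rule ccontr)
    assume "\<not> dist x y \<le> \<epsilon>"
    then have "(x, y) \<in> K m" using that by (auto simp: K_def)
    with m show False by simp
  qed
  then show ?thesis using that by blast
qed

section \<open>Partition sums and growth rates\<close>

definition part_sum :: "'m::metric_space set \<Rightarrow> ('m \<Rightarrow> 'm) \<Rightarrow> (nat \<Rightarrow> 'm \<Rightarrow> real) \<Rightarrow> nat \<Rightarrow> real \<Rightarrow> real" where
  "part_sum X f \<phi> n \<epsilon> = (SUP E\<in>{E. E \<subseteq> X \<and> separated f n \<epsilon> E}. \<Sum>x\<in>E. exp (\<phi> n x))"

definition growth_rate :: "'m::metric_space set \<Rightarrow> ('m \<Rightarrow> 'm) \<Rightarrow> (nat \<Rightarrow> 'm \<Rightarrow> real) \<Rightarrow> real \<Rightarrow> ereal" where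
  "growth_rate X f \<phi> \<epsilon> = limsup (\<lambda>n. ereal (1 / real n * ln (part_sum X f \<phi> n \<epsilon>)))"

text \<open>Nonpositivity stands in for continuity of the potentials: it bounds every partition sum
  by the cardinality of a separated set, so the real suprema are suprema of bounded sets.\<close>

context
  fixes X :: "'m::metric_space set" and f :: "'m \<Rightarrow> 'm" and \<phi> :: "nat \<Rightarrow> 'm \<Rightarrow> real"
  assumes X: "compact X" "X \<noteq> {}" and f: "continuous_on UNIV f"
    and \<phi>: "\<forall>n. \<forall>x\<in>X. \<phi> n x \<le> 0"
begin

lemma part_sum_upper:
  assumes n: "n \<ge> 1" and \<epsilon>: "\<epsilon> > 0" and E: "E \<subseteq> X" "separated f n \<epsilon> E"
  shows "(\<Sum>x\<in>E. exp (\<phi> n x)) \<le> part_sum X f \<phi> n \<epsilon>"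
  unfolding part_sum_def
proof (rule cSUP_upper)
  show "E \<in> {E. E \<subseteq> X \<and> separated f n \<epsilon> E}" using E by simp
  obtain C where C: "\<And>E. E \<subseteq> X \<Longrightarrow> separated f n \<epsilon> E \<Longrightarrow> finite E \<and> card E \<le> C"
    using separated_card_bound[OF X(1) f n \<epsilon>] by blast
  show "bdd_above ((\<lambda>E. \<Sum>x\<in>E. exp (\<phi> n x)) ` {E. E \<subseteq> X \<and> separated f n \<epsilon> E})"
  proof (rule bdd_aboveI2)
    fix E assume E: "E \<in> {E. E \<subseteq> X \<and> separated f n \<epsilon> E}"
    have "(\<Sum>x\<in>E. exp (\<phi> n x)) \<le> (\<Sum>x\<in>E. 1)" using E \<phi> by (intro sum_mono) auto
    also have "\<dots> \<le> real C" using C E by simp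
    finally show "(\<Sum>x\<in>E. exp (\<phi> n x)) \<le> real C" .
  qed
qed

lemma part_sum_ge_point:
  assumes "n \<ge> 1" "\<epsilon> > 0" "x \<in> X"
  shows "exp (\<phi> n x) \<le> part_sum X f \<phi> n \<epsilon>"
  using part_sum_upper[OF assms(1,2), of "{x}"] assms(3) by (simp add: separated_def)

lemma part_sum_pos: "n \<ge> 1 \<Longrightarrow> \<epsilon> > 0 \<Longrightarrow> 0 < part_sum X f \<phi> n \<epsilon>"
  using part_sum_ge_point[of n \<epsilon>] X(2) by (metis exp_gt_zero ex_in_conv order_less_le_trans)

lemma part_sum_le:
  assumes "\<And>E. E \<subseteq> X \<Longrightarrow> separated f n \<epsilon> E \<Longrightarrow> (\<Sum>x\<in>E. exp (\<phi> n x)) \<le> M"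
  shows "part_sum X f \<phi> n \<epsilon> \<le> M"
  unfolding part_sum_def
proof (rule cSUP_least)
  have "{} \<in> {E. E \<subseteq> X \<and> separated f n \<epsilon> E}" by (simp add: separated_def)
  then show "{E. E \<subseteq> X \<and> separated f n \<epsilon> E} \<noteq> {}" by blast
qed (use assms in auto)

lemma part_sum_antimono:
  assumes "n \<ge> 1" "0 < \<epsilon>" "\<epsilon> \<le> \<epsilon>'"
  shows "part_sum X f \<phi> n \<epsilon>' \<le> part_sum X f \<phi> n \<epsilon>"
  using assms by (intro part_sum_le part_sum_upper) (force simp: separated_def)+

lemma growth_rate_antimono:
  assumes "0 < \<epsilon>" "\<epsilon> \<le> \<epsilon>'"
  shows "growth_rate X f \<phi> \<epsilon>' \<le> growth_rate X f \<phi> \<epsilon>"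
  unfolding growth_rate_def
proof (rule Limsup_mono)
  show "\<forall>\<^sub>F n in sequentially. ereal (1 / real n * ln (part_sum X f \<phi> n \<epsilon>')) \<le> ereal (1 / real n * ln (part_sum X f \<phi> n \<epsilon>))"
    using eventually_ge_at_top[of 1]
  proof eventually_elim
    case (elim n)
    then show ?case
      using part_sum_antimono[OF elim assms] part_sum_pos[OF elim assms(1)]
        part_sum_pos[OF elim, of \<epsilon>'] assms
      by (auto intro!: divide_right_mono)
  qed
qed

text \<open>A smaller \<epsilon> admits more separated sets, so the growth rate is antitone in
  \<epsilon> and its limit at 0 is a supremum.\<close>

lemma pressure_eq_SUP: "pressure X f \<phi> = (SUP \<epsilon>\<in>{0<..}. growth_rate X f \<phi> \<epsilon>)"
proof -
  let ?s = "SUP \<epsilon>\<in>{0<..}. growth_rate X f \<phi> \<epsilon>"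
  have "(growth_rate X f \<phi> \<longlongrightarrow> ?s) (at_right 0)"
  proof (rule order_tendstoI)
    fix a assume "a < ?s"
    then obtain \<epsilon> where \<epsilon>: "\<epsilon> > 0" "a < growth_rate X f \<phi> \<epsilon>" by (auto simp: less_SUP_iff)
    show "\<forall>\<^sub>F x in at_right 0. a < growth_rate X f \<phi> x"
      unfolding eventually_at_right_field
      using \<epsilon> growth_rate_antimono by (metis less_le_not_le order_less_le_trans)
  next
    fix a assume a: "?s < a"
    have "growth_rate X f \<phi> x < a" if "x > 0" for x
      using SUP_upper[of x "{0<..}" "growth_rate X f \<phi>"] that a by simp
    then show "\<forall>\<^sub>F x in at_right 0. growth_rate X f \<phi> x < a"
      unfolding eventually_at_right_field by (intro exI[of _ 1]) auto
  qed
  then have "Lim (at_right 0) (growth_rate X f \<phi>) = ?s"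
    by (intro tendsto_Lim) auto
  then show ?thesis
    by (simp add: pressure_def growth_rate_def[abs_def] part_sum_def)
qed

lemma growth_rate_le_pressure: "\<epsilon> > 0 \<Longrightarrow> growth_rate X f \<phi> \<epsilon> \<le> pressure X f \<phi>"
  unfolding pressure_eq_SUP by (rule SUP_upper) simp

lemma pressure_leI: "(\<And>\<epsilon>. \<epsilon> > 0 \<Longrightarrow> growth_rate X f \<phi> \<epsilon> \<le> b) \<Longrightarrow> pressure X f \<phi> \<le> b"
  unfolding pressure_eq_SUP by (rule SUP_least) simp

text \<open>A single point is a separated set, so a linear lower bound along one orbit suffices.
  This makes a pressure that is not \<infinity> a real number.\<close>

lemma pressure_not_MInfty:
  assumes x: "x \<in> X" and c: "\<And>n. - c * real n \<le> \<phi> n x"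
  shows "pressure X f \<phi> \<noteq> - \<infinity>"
proof -
  have "ereal (- c) \<le> growth_rate X f \<phi> 1"
    unfolding growth_rate_def
  proof (rule le_Limsup)
    show "\<forall>\<^sub>F n in sequentially. ereal (- c) \<le> ereal (1 / real n * ln (part_sum X f \<phi> n 1))"
      using eventually_ge_at_top[of 1]
    proof eventually_elim
      case (elim n)
      have "- c * real n \<le> ln (part_sum X f \<phi> n 1)"
        using part_sum_ge_point[OF elim _ x, of 1] part_sum_pos[OF elim, of 1] c[of n]
        by (simp add: ln_ge_iff) (meson exp_le_cancel_iff order_trans)
      then show ?case using elim by (simp add: field_simps)
    qed
  qed simp
  also have "\<dots> \<le> pressure X f \<phi>" by (rule growth_rate_le_pressure) simp
  finally show ?thesis by auto
qed

end

text \<open>Choose a vertex of largest weight and delete its neighbours: the deleted weight is at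
  most \<open>C\<close> times the weight that is kept.\<close>

lemma greedy_independent_set:
  fixes u :: "'a \<Rightarrow> real"
  assumes "finite E" "\<And>x. x \<in> E \<Longrightarrow> R x x" "\<And>x y. R x y \<Longrightarrow> R y x"
    "\<And>x. x \<in> E \<Longrightarrow> card {y\<in>E. R x y} \<le> C" "\<And>x. x \<in> E \<Longrightarrow> u x \<ge> 0"
  shows "\<exists>F\<subseteq>E. (\<forall>x\<in>F. \<forall>y\<in>F. x \<noteq> y \<longrightarrow> \<not> R x y) \<and> sum u E \<le> real C * sum u F"
  using assms(1,2,4,5)
proof (induction E rule: finite_psubset_induct)
  case (psubset E)
  show ?case
  proof (cases "E = {}")
    case False
    obtain x where x: "x \<in> E" "\<And>y. y \<in> E \<Longrightarrow> u y \<le> u x"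
    proof -
      have "Max (u ` E) \<in> u ` E" using psubset.hyps(1) False by (intro Max_in) auto
      moreover have "u y \<le> Max (u ` E)" if "y \<in> E" for y using that psubset.hyps(1) by simp
      ultimately show ?thesis using that by fastforce
    qed
    define N where "N = {y\<in>E. R x y}"
    have xN: "x \<in> N" using x psubset.prems(1) by (simp add: N_def)
    have "\<exists>F\<subseteq>E - N. (\<forall>x\<in>F. \<forall>y\<in>F. x \<noteq> y \<longrightarrow> \<not> R x y) \<and> sum u (E - N) \<le> real C * sum u F"
    proof (rule psubset.IH)
      show "E - N \<subset> E" using x xN by auto
      show "R y y" if "y \<in> E - N" for y using that psubset.prems(1) by auto
      show "0 \<le> u y" if "y \<in> E - N" for y using that psubset.prems(3) by auto
      show "card {z \<in> E - N. R y z} \<le> C" if "y \<in> E - N" for y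
      proof -
        have "card {z \<in> E - N. R y z} \<le> card {z \<in> E. R y z}"
          using psubset.hyps(1) by (intro card_mono) auto
        also have "\<dots> \<le> C" using that psubset.prems(2) by auto
        finally show ?thesis .
      qed
    qed
    then obtain F where F: "F \<subseteq> E - N" "\<forall>x\<in>F. \<forall>y\<in>F. x \<noteq> y \<longrightarrow> \<not> R x y"
      "sum u (E - N) \<le> real C * sum u F" by blast
    have fF: "finite F" "x \<notin> F" using F(1) xN psubset.hyps(1) by (auto intro: finite_subset)
    have "sum u N \<le> real (card N) * u x"
      using sum_bounded_above[of N u "u x"] x(2) by (auto simp: N_def)
    also have "\<dots> \<le> real C * u x"
      using psubset.prems(2)[OF x(1)] psubset.prems(3)[OF x(1)] by (auto simp: N_def intro!: mult_right_mono)
    finally have "sum u E \<le> real C * sum u (insert x F)"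
      using F(3) fF sum.subset_diff[of N E u] psubset.hyps(1) by (simp add: N_def distrib_left)
    moreover have "\<forall>a\<in>insert x F. \<forall>b\<in>insert x F. a \<noteq> b \<longrightarrow> \<not> R a b"
      using F(1,2) assms(3) by (auto simp: N_def)
    moreover have "insert x F \<subseteq> E" using F(1) x(1) by auto
    ultimately show ?thesis by blast
  qed auto
qed

text \<open>A separated set of greatest cardinality, which exists by the uniform bound, cannot be
  enlarged and hence spans.\<close>

lemma maximal_separated:
  assumes X: "compact X" "X \<noteq> {}" and f: "continuous_on UNIV (f :: 'm::metric_space \<Rightarrow> 'm)"
    and n: "n \<ge> 1" and \<rho>: "\<rho> > 0"
  obtains E where "finite E" "E \<subseteq> X" "E \<noteq> {}" "separated f n \<rho> E"
    "\<And>x. x \<in> X \<Longrightarrow> \<exists>y\<in>E. \<forall>i<n. dist ((f ^^ i) y) ((f ^^ i) x) \<le> \<rho>"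
proof -
  obtain C where C: "\<And>E. E \<subseteq> X \<Longrightarrow> separated f n \<rho> E \<Longrightarrow> finite E \<and> card E \<le> C"
    using separated_card_bound[OF X(1) f n \<rho>] by blast
  let ?P = "\<lambda>E. E \<subseteq> X \<and> separated f n \<rho> E"
  have "?P {}" by (simp add: separated_def)
  moreover have "\<forall>E. ?P E \<longrightarrow> card E < Suc C" using C by (auto simp: less_Suc_eq_le)
  ultimately obtain E where E: "?P E" "\<And>F. ?P F \<Longrightarrow> card F \<le> card E"
    using ex_has_greatest_nat[of ?P "{}" card "Suc C"] by (metis less_imp_le)
  have fE: "finite E" using C E by blast
  have span: "\<exists>y\<in>E. \<forall>i<n. dist ((f ^^ i) y) ((f ^^ i) x) \<le> \<rho>" if x: "x \<in> X" for x
  proof (rule ccontr)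
    assume *: "\<not> ?thesis"
    then have far: "\<exists>i<n. \<rho> < dist ((f ^^ i) y) ((f ^^ i) x)" if "y \<in> E" for y
      using that by force
    have "x \<notin> E" using * \<rho> by (metis dist_self less_imp_le)
    have "separated f n \<rho> (insert x E)"
      unfolding separated_iff[OF n]
      using far E(1)[unfolded separated_iff[OF n]] by (metis dist_commute insert_iff)
    then have "card (insert x E) \<le> card E" using E(1) x by (intro E(2)) auto
    then show False using \<open>x \<notin> E\<close> fE by simp
  qed
  moreover have "E \<noteq> {}" using span X(2) by blast
  ultimately show ?thesis using that fE E by blast
qed

text \<open>The near-maximizers \<open>z y\<close> of \<open>\<phi> N\<close> in the Bowen balls
  need not be separated, so their weights cannot be compared with a partition sum directly. The
  graph of too close pairs has degree at most \<open>C\<close>, uniformly in \<open>N\<close>; a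
  greedy independent subset is separated and keeps a fraction \<open>1/C\<close> of the weight. The
  constant \<open>2 * C\<close> disappears after division by a large \<open>N\<close>.\<close>

lemma pressure_block:
  assumes X: "compact X" "X \<noteq> {}" and f: "continuous_on UNIV (f :: 'm::metric_space \<Rightarrow> 'm)"
    and fX: "f ` X \<subseteq> X" and \<phi>: "\<forall>n. \<forall>x\<in>X. \<phi> n x \<le> 0"
    and e: "expansive_on X f e" "e > 0"
    and P: "pressure X f \<phi> = ereal p" and \<epsilon>: "\<epsilon> > 0"
  obtains N \<rho> E w where "N \<ge> 1" "2 * \<rho> \<le> e" "finite E" "E \<noteq> {}"
    "\<And>x. x \<in> X \<Longrightarrow> \<exists>y\<in>E. (\<forall>i<N. dist ((f ^^ i) y) ((f ^^ i) x) \<le> \<rho>) \<and> \<phi> N x \<le> w y"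
    "ln (\<Sum>y\<in>E. exp (w y)) \<le> real N * (p + \<epsilon>)"
proof -
  \<comment> \<open>Two centres are linked to \<open>y\<close> by chains of three steps of length
    \<rho>, hence to each other by six.\<close>
  define \<rho> where "\<rho> = e / 6"
  have \<rho>: "\<rho> > 0" using e by (simp add: \<rho>_def)
  obtain m where m: "\<And>x y. x \<in> X \<Longrightarrow> y \<in> X \<Longrightarrow> (\<And>i. i < m \<Longrightarrow> dist ((f ^^ i) x) ((f ^^ i) y) \<le> e) \<Longrightarrow> dist x y \<le> \<rho>"
    using expansive_uniform[OF X(1) f e(1) \<rho>] by blast
  \<comment> \<open>The successor ensures a positive length, without which \<open>bowen_dist\<close>
    is meaningless.\<close>
  define m1 where "m1 = Suc m"
  obtain C where C: "\<And>E. E \<subseteq> X \<Longrightarrow> separated f m1 \<rho> E \<Longrightarrow> finite E \<and> card E \<le> C"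
    using separated_card_bound[OF X(1) f _ \<rho>, of m1] by (auto simp: m1_def)
  have C1: "C \<ge> 1"
  proof -
    obtain x where "x \<in> X" using X by blast
    then show ?thesis using C[of "{x}"] by (simp add: separated_def)
  qed
  have "growth_rate X f \<phi> \<rho> < ereal (p + \<epsilon>/2)"
    using growth_rate_le_pressure[OF X f \<phi> \<rho>] P \<epsilon> by (simp add: order_le_less_trans)
  then have ev1: "\<forall>\<^sub>F n in sequentially. ereal (1 / real n * ln (part_sum X f \<phi> n \<rho>)) < ereal (p + \<epsilon>/2)"
    unfolding growth_rate_def by (rule Limsup_lessD)
  have "(\<lambda>n. ln (2 * real C) / real n) \<longlonglongrightarrow> 0" by (rule lim_const_over_n)
  then have ev2: "\<forall>\<^sub>F n in sequentially. ln (2 * real C) / real n < \<epsilon>/2"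
    by (rule order_tendstoD(2)) (use \<epsilon> in simp)
  obtain N where N: "1 / real N * ln (part_sum X f \<phi> N \<rho>) < p + \<epsilon>/2" "ln (2 * real C) / real N < \<epsilon>/2"
    "N \<ge> m1"
    using eventually_happens'[OF sequentially_bot eventually_conj[OF ev1 eventually_conj[OF ev2 eventually_ge_at_top[of m1]]]]
    by auto
  have N1: "N \<ge> 1" using N(3) by (simp add: m1_def)
  obtain E where E: "finite E" "E \<subseteq> X" "E \<noteq> {}" "separated f N \<rho> E"
    "\<And>x. x \<in> X \<Longrightarrow> \<exists>y\<in>E. \<forall>i<N. dist ((f ^^ i) y) ((f ^^ i) x) \<le> \<rho>"
    using maximal_separated[OF X f N1 \<rho>] by blast
  define B where "B y = {x\<in>X. \<forall>i<N. dist ((f ^^ i) y) ((f ^^ i) x) \<le> \<rho>}" for y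
  \<comment> \<open>The supremum over the Bowen ball need not be attained, as no continuity of
    \<open>\<phi> N\<close> is assumed; \<open>ln 2\<close> is an arbitrary positive slack.\<close>
  have "\<exists>z\<in>B y. \<forall>x\<in>B y. \<phi> N x \<le> \<phi> N z + ln 2" if y: "y \<in> E" for y
  proof -
    have "y \<in> B y" using y E(2) \<rho> by (auto simp: B_def)
    then have ne: "\<phi> N ` B y \<noteq> {}" by blast
    have bd: "bdd_above (\<phi> N ` B y)" using \<phi> by (intro bdd_aboveI2[of _ _ 0]) (auto simp: B_def)
    have "Sup (\<phi> N ` B y) - ln 2 < Sup (\<phi> N ` B y)" by simp
    then obtain z where z: "z \<in> B y" "Sup (\<phi> N ` B y) - ln 2 < \<phi> N z"
      using less_cSup_iff[OF ne bd] by blast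
    moreover have "\<phi> N x \<le> Sup (\<phi> N ` B y)" if "x \<in> B y" for x
      using that bd by (intro cSup_upper) auto
    ultimately show ?thesis by (intro bexI[of _ z]) force+
  qed
  then obtain z where z: "\<And>y. y \<in> E \<Longrightarrow> z y \<in> B y" "\<And>x y. y \<in> E \<Longrightarrow> x \<in> B y \<Longrightarrow> \<phi> N x \<le> \<phi> N (z y) + ln 2"
    by metis
  define R where "R y y' \<longleftrightarrow> (\<forall>i<N. dist ((f ^^ i) (z y)) ((f ^^ i) (z y')) \<le> \<rho>)" for y y'
  \<comment> \<open>Neighbours of \<open>y\<close> stay \<open>e\<close>-close to each other for all
    \<open>N\<close> steps. Expansivity then forces their \<rho>-separation to occur in the last
    \<open>m1\<close> steps, so their images under \<open>f ^^ (N - m1)\<close> form an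
    \<open>(m1, \<rho>)\<close>-separated set, whose size is bounded by \<open>C\<close>.\<close>
  have card: "card {y'\<in>E. R y y'} \<le> C" if y: "y \<in> E" for y
  proof -
    let ?S = "{y'\<in>E. R y y'}" and ?F = "f ^^ (N - m1)"
    have close: "dist ((f ^^ i) y') ((f ^^ i) y'') \<le> e" if "y' \<in> ?S" "y'' \<in> ?S" "i < N" for i y' y''
    proof -
      have 1: "dist ((f ^^ i) y) ((f ^^ i) u) \<le> 3 * \<rho>" if u: "u \<in> ?S" for u
      proof -
        have "dist ((f ^^ i) y) ((f ^^ i) (z y)) \<le> \<rho>" "dist ((f ^^ i) u) ((f ^^ i) (z u)) \<le> \<rho>"
          "dist ((f ^^ i) (z y)) ((f ^^ i) (z u)) \<le> \<rho>"
          using z(1)[OF y] z(1)[of u] u \<open>i < N\<close> by (auto simp: B_def R_def)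
        then show ?thesis
          using dist_triangle[of "(f ^^ i) y" "(f ^^ i) u" "(f ^^ i) (z y)"]
            dist_triangle2[of "(f ^^ i) (z y)" "(f ^^ i) u" "(f ^^ i) (z u)"] by linarith
      qed
      show ?thesis
        using 1[OF that(1)] 1[OF that(2)] dist_triangle3[of "(f ^^ i) y'" "(f ^^ i) y''" "(f ^^ i) y"]
        by (simp add: \<rho>_def)
    qed
    have sep: "\<exists>j<m1. \<rho> < dist ((f ^^ j) (?F y')) ((f ^^ j) (?F y''))"
      if S: "y' \<in> ?S" "y'' \<in> ?S" "y' \<noteq> y''" for y' y''
    proof -
      obtain i where i: "i < N" "\<rho> < dist ((f ^^ i) y') ((f ^^ i) y'')"
        using S E(4) unfolding separated_iff[OF N1] by blast
      \<comment> \<open>At an earlier time \<open>i\<close> at least \<open>m\<close> further steps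
        of \<open>e\<close>-closeness remain, so the two points would be \<rho>-close at time
        \<open>i\<close>.\<close>
      have "N - m1 \<le> i"
      proof (rule ccontr)
        assume "\<not> N - m1 \<le> i"
        then have *: "j + i < N" if "j < m" for j using that by (simp add: m1_def)
        have "dist ((f ^^ i) y') ((f ^^ i) y'') \<le> \<rho>"
        proof (rule m)
          show "(f ^^ i) y' \<in> X" "(f ^^ i) y'' \<in> X" using S E(2) iterate_in[OF fX] by auto
          show "dist ((f ^^ j) ((f ^^ i) y')) ((f ^^ j) ((f ^^ i) y'')) \<le> e" if "j < m" for j
            using close[OF S(1,2) *[OF that]] by (simp add: funpow_add)
        qed
        with i show False by simp
      qed
      then have "i - (N - m1) < m1" "(f ^^ i) = (f ^^ (i - (N - m1))) \<circ> ?F"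
        using i N(3) by (auto simp: funpow_add[symmetric])
      then show ?thesis using i(2) by (intro exI[of _ "i - (N - m1)"]) auto
    qed
    have inj: "inj_on ?F ?S"
    proof (rule inj_onI, rule ccontr)
      fix a b assume "a \<in> ?S" "b \<in> ?S" "?F a = ?F b" "a \<noteq> b"
      with sep[of a b] \<rho> show False by auto
    qed
    have "separated f m1 \<rho> (?F ` ?S)"
    proof -
      have "m1 \<ge> 1" by (simp add: m1_def)
      then show ?thesis
        unfolding separated_iff[OF \<open>m1 \<ge> 1\<close>]
      proof (intro ballI impI)
        fix a b assume "a \<in> ?F ` ?S" "b \<in> ?F ` ?S" "a \<noteq> b"
        then obtain y' y'' where "y' \<in> ?S" "y'' \<in> ?S" "a = ?F y'" "b = ?F y''" "y' \<noteq> y''" by blast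
        then show "\<exists>i<m1. \<rho> < dist ((f ^^ i) a) ((f ^^ i) b)" using sep by blast
      qed
    qed
    then have "card (?F ` ?S) \<le> C" using C[of "?F ` ?S"] iterate_in[OF fX] E(2) by blast
    then show ?thesis using card_image[OF inj] by simp
  qed
  have "\<exists>F\<subseteq>E. (\<forall>x\<in>F. \<forall>y\<in>F. x \<noteq> y \<longrightarrow> \<not> R x y) \<and>
      (\<Sum>y\<in>E. exp (\<phi> N (z y))) \<le> real C * (\<Sum>y\<in>F. exp (\<phi> N (z y)))"
    using \<rho> by (intro greedy_independent_set E(1) card) (auto simp: R_def dist_commute)
  then obtain F where F: "F \<subseteq> E" "\<And>x y. x \<in> F \<Longrightarrow> y \<in> F \<Longrightarrow> x \<noteq> y \<Longrightarrow> \<not> R x y"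
    "(\<Sum>y\<in>E. exp (\<phi> N (z y))) \<le> real C * (\<Sum>y\<in>F. exp (\<phi> N (z y)))" by blast
  have "inj_on z F"
    using F(2) \<rho> by (auto simp: inj_on_def R_def) (metis dist_self less_imp_le)
  then have "(\<Sum>y\<in>F. exp (\<phi> N (z y))) = (\<Sum>x\<in>z ` F. exp (\<phi> N x))" by (simp add: sum.reindex)
  also have "\<dots> \<le> part_sum X f \<phi> N \<rho>"
  proof (rule part_sum_upper[OF X f \<phi> N1 \<rho>])
    show "z ` F \<subseteq> X" using z(1) F(1) by (auto simp: B_def)
    show "separated f N \<rho> (z ` F)"
      unfolding separated_iff[OF N1] using F(2) by (force simp: R_def not_le)
  qed
  finally have le: "(\<Sum>y\<in>E. exp (\<phi> N (z y))) \<le> real C * part_sum X f \<phi> N \<rho>"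
    using F(3) by (meson mult_left_mono of_nat_0_le_iff order_trans)
  define w where "w y = \<phi> N (z y) + ln 2" for y
  have "(\<Sum>y\<in>E. exp (w y)) = 2 * (\<Sum>y\<in>E. exp (\<phi> N (z y)))"
    by (simp add: w_def exp_add sum_distrib_left mult.commute)
  then have "(\<Sum>y\<in>E. exp (w y)) \<le> (2 * real C) * part_sum X f \<phi> N \<rho>" using le by simp
  moreover have "0 < (\<Sum>y\<in>E. exp (w y))" using E by (intro sum_pos) auto
  moreover have pp: "0 < part_sum X f \<phi> N \<rho>" by (rule part_sum_pos[OF X f \<phi> N1 \<rho>])
  ultimately have "ln (\<Sum>y\<in>E. exp (w y)) \<le> ln ((2 * real C) * part_sum X f \<phi> N \<rho>)"
    by simp
  also have "\<dots> = ln (2 * real C) + ln (part_sum X f \<phi> N \<rho>)"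
    using C1 pp by (simp add: ln_mult)
  also have "\<dots> \<le> real N * (p + \<epsilon>)"
    using N(1,2) N1 by (simp add: field_simps)
  finally have "ln (\<Sum>y\<in>E. exp (w y)) \<le> real N * (p + \<epsilon>)" .
  moreover have "\<exists>y\<in>E. (\<forall>i<N. dist ((f ^^ i) y) ((f ^^ i) x) \<le> \<rho>) \<and> \<phi> N x \<le> w y" if x: "x \<in> X" for x
  proof -
    obtain y where y: "y \<in> E" "\<forall>i<N. dist ((f ^^ i) y) ((f ^^ i) x) \<le> \<rho>" using E(5)[OF x] by blast
    then have "\<phi> N x \<le> w y" unfolding w_def using x by (intro z(2)) (auto simp: B_def)
    then show ?thesis using y by blast
  qed
  ultimately show ?thesis using that[of N \<rho> E w] N1 E e(2) by (simp add: \<rho>_def)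
qed

text \<open>The incomplete last block, of length \<open>r\<close>, is dropped because its potential
  is at most 0.\<close>

lemma subadditive_blocks:
  assumes hY: "h ` Y \<subseteq> Y" and \<psi>: "\<forall>n. \<forall>y\<in>Y. \<psi> n y \<le> (0::real)"
    and sub: "\<forall>n m. \<forall>y\<in>Y. \<psi> (n + m) y \<le> \<psi> n y + \<psi> m ((h ^^ n) y)"
    and y: "y \<in> Y"
  shows "\<psi> (k * N + r) y \<le> (\<Sum>j<k. \<psi> N ((h ^^ (j * N)) y))"
  using y
proof (induction k arbitrary: y)
  case 0 then show ?case using \<psi> by simp
next
  case (Suc k)
  have "\<psi> (Suc k * N + r) y \<le> \<psi> N y + \<psi> (k * N + r) ((h ^^ N) y)"
    using sub Suc.prems by (simp add: add.assoc)
  also have "\<psi> (k * N + r) ((h ^^ N) y) \<le> (\<Sum>j<k. \<psi> N ((h ^^ (j * N)) ((h ^^ N) y)))"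
    using Suc.prems iterate_in[OF hY] by (intro Suc.IH) auto
  also have "\<dots> = (\<Sum>j<k. \<psi> N ((h ^^ (Suc j * N)) y))"
    by (intro sum.cong refl) (simp add: funpow_add[symmetric, THEN fun_cong, unfolded o_def] add.commute)
  finally show ?case unfolding sum.lessThan_Suc_shift by simp
qed

text \<open>Points of \<open>X\<close> are coded by the elements of \<open>E\<close> that shadow their successive
  \<open>N\<close>-blocks.  By expansivity a separated set of the conjugate system is coded injectively once
  the code is prolonged by a number of blocks that does not depend on \<open>n\<close>.\<close>

lemma pressure_le_block:
  assumes X: "compact X" "X \<noteq> {}" and f: "continuous_on UNIV (f :: 'm::metric_space \<Rightarrow> 'm)"
    and fX: "f ` X \<subseteq> X" and e: "expansive_on X f e"
    and N: "N \<ge> 1" "2 * \<rho> \<le> e" and E: "finite E" "E \<noteq> {}"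
    and span: "\<And>x. x \<in> X \<Longrightarrow> \<exists>y\<in>E. (\<forall>i<N. dist ((f ^^ i) y) ((f ^^ i) x) \<le> \<rho>) \<and> \<phi>N x \<le> w y"
    and h: "continuous_on UNIV h" and \<pi>: "continuous_on X \<pi>" "\<pi> ` X = Y"
    and conj: "\<And>x. x \<in> X \<Longrightarrow> \<pi> (f x) = h (\<pi> x)"
    and \<psi>: "\<forall>n. \<forall>y\<in>Y. \<psi> n y \<le> 0"
    and sub: "\<forall>n m. \<forall>y\<in>Y. \<psi> (n + m) y \<le> \<psi> n y + \<psi> m ((h ^^ n) y)"
    and \<psi>\<phi>: "\<And>x. x \<in> X \<Longrightarrow> \<psi> N (\<pi> x) \<le> \<phi>N x + \<delta>"
  shows "pressure Y h \<psi> \<le> ereal ((ln (\<Sum>y\<in>E. exp (w y)) + \<delta>) / real N)"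
proof -
  have Y: "compact Y" "Y \<noteq> {}" using compact_continuous_image[OF \<pi>(1) X(1)] \<pi>(2) X(2) by auto
  have cj: "\<pi> ((f ^^ n) x) = (h ^^ n) (\<pi> x)" if "x \<in> X" for n x
    by (induction n) (use that conj iterate_in[OF fX] in auto)
  have hY: "h ` Y \<subseteq> Y" using \<pi>(2) conj fX by (metis (no_types, lifting) image_subset_iff image_eqI imageE)
  define W where "W = (\<Sum>y\<in>E. exp (w y))"
  have W: "W > 0" unfolding W_def using E by (intro sum_pos) auto
  define \<beta> where "\<beta> = ln W + \<delta>"
  obtain s where s: "\<And>x. x \<in> X \<Longrightarrow> s x \<in> E" "\<And>x i. x \<in> X \<Longrightarrow> i < N \<Longrightarrow> dist ((f ^^ i) (s x)) ((f ^^ i) x) \<le> \<rho>"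
    "\<And>x. x \<in> X \<Longrightarrow> \<phi>N x \<le> w (s x)"
    using span by metis
  \<comment> \<open>A choice of preimages under \<open>\<pi>\<close>: separation in \<open>Y\<close>
    is pulled back to \<open>X\<close> by uniform continuity of \<open>\<pi>\<close>.\<close>
  define \<sigma> where "\<sigma> = inv_into X \<pi>"
  have \<sigma>: "\<sigma> y \<in> X" "\<pi> (\<sigma> y) = y" if "y \<in> Y" for y
    using that \<pi>(2) by (auto simp: \<sigma>_def inv_into_into f_inv_into_f)
  show ?thesis
    unfolding W_def[symmetric] \<beta>_def[symmetric]
  proof (rule pressure_leI[OF Y h \<psi>])
    fix \<epsilon> :: real assume \<epsilon>: "\<epsilon> > 0"
    obtain \<epsilon>' where \<epsilon>': "\<epsilon>' > 0" "\<And>x y. x \<in> X \<Longrightarrow> y \<in> X \<Longrightarrow> dist x y < \<epsilon>' \<Longrightarrow> dist (\<pi> x) (\<pi> y) < \<epsilon>"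
      using compact_uniformly_continuous[OF \<pi>(1) X(1)] \<epsilon> unfolding uniformly_continuous_on_def by metis
    have "\<epsilon>'/2 > 0" using \<epsilon>' by simp
    then obtain m where m: "\<And>x y. x \<in> X \<Longrightarrow> y \<in> X \<Longrightarrow> (\<And>i. i < m \<Longrightarrow> dist ((f ^^ i) x) ((f ^^ i) y) \<le> e) \<Longrightarrow> dist x y \<le> \<epsilon>'/2"
      using expansive_uniform[OF X(1) f e] by metis
    define c where "c = real (Suc m) * ln (real (card E))"
    have cE: "real (card E) \<ge> 1" using E by (simp add: card_gt_0_iff Suc_leI)
    have bound: "ln (part_sum Y h \<psi> n \<epsilon>) \<le> real (n div N) * \<beta> + c" if n: "n \<ge> 1" for n
    proof -
      define k where "k = n div N"
      \<comment> \<open>One extra block covers the remainder of \<open>n\<close> modulo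
        \<open>N\<close>; another \<open>m\<close> blocks, each of length at least 1, give
        expansivity its \<open>m\<close> steps after every time below \<open>n\<close>.\<close>
      define K where "K = k + Suc m"
      have K: "n + m \<le> K * N"
      proof -
        have "n < (k + 1) * N" unfolding k_def using N(1) dividend_less_div_times[of N n] by simp
        moreover have "m * 1 \<le> m * N" by (rule mult_le_mono2) (rule N(1))
        moreover have "K * N = (k + 1) * N + m * N" by (simp add: K_def algebra_simps)
        ultimately show ?thesis by linarith
      qed
      define code where "code y = (\<lambda>j\<in>{..<K}. s ((f ^^ (j * N)) (\<sigma> y)))" for y
      \<comment> \<open>Only the first \<open>k\<close> symbols carry weight. Each prolonging symbol
        contributes a factor \<open>card E\<close>, which does not depend on
        \<open>n\<close>.\<close>
      define F where "F j a = (if j < k then exp (w a) else 1)" for j a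
      have "part_sum Y h \<psi> n \<epsilon> \<le> exp (real k * \<delta>) * (W ^ k * real (card E) ^ Suc m)"
      proof (rule part_sum_le[OF Y h \<psi>])
        fix D assume D: "D \<subseteq> Y" "separated h n \<epsilon> D"
        have inj: "inj_on code D"
        proof (rule inj_onI, rule ccontr)
          fix y y' assume yy: "y \<in> D" "y' \<in> D" "code y = code y'" "y \<noteq> y'"
          then have yX: "\<sigma> y \<in> X" "\<sigma> y' \<in> X" using \<sigma> D(1) by auto
          have near: "dist ((f ^^ i) (\<sigma> y)) ((f ^^ i) (\<sigma> y')) \<le> e" if i: "i < K * N" for i
          proof -
            define j where "j = i div N"
            define l where "l = i mod N"
            have ij: "i = l + j * N" "l < N" "j < K"
              using N(1) i by (auto simp: j_def l_def less_mult_imp_div_less)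
            let ?a = "(f ^^ (j * N)) (\<sigma> y)" and ?b = "(f ^^ (j * N)) (\<sigma> y')"
            have ab: "?a \<in> X" "?b \<in> X" using yX iterate_in[OF fX] by auto
            have "s ?a = s ?b" using fun_cong[OF yy(3), of j] ij(3) by (simp add: code_def)
            then have "dist ((f ^^ l) ?a) ((f ^^ l) ?b) \<le> 2 * \<rho>"
              using s(2)[OF ab(1) ij(2)] s(2)[OF ab(2) ij(2)]
                dist_triangle3[of "(f ^^ l) ?a" "(f ^^ l) ?b" "(f ^^ l) (s ?a)"] by simp
            then show ?thesis using N(2) ij(1) by (simp add: funpow_add)
          qed
          have "dist ((h ^^ i) y) ((h ^^ i) y') < \<epsilon>" if i: "i < n" for i
          proof -
            have "dist ((f ^^ i) (\<sigma> y)) ((f ^^ i) (\<sigma> y')) \<le> \<epsilon>'/2"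
            proof (rule m)
              show "(f ^^ i) (\<sigma> y) \<in> X" "(f ^^ i) (\<sigma> y') \<in> X" using yX iterate_in[OF fX] by auto
              show "dist ((f ^^ j) ((f ^^ i) (\<sigma> y))) ((f ^^ j) ((f ^^ i) (\<sigma> y'))) \<le> e" if "j < m" for j
                using near[of "j + i"] that i K by (simp add: funpow_add)
            qed
            then have "dist (\<pi> ((f ^^ i) (\<sigma> y))) (\<pi> ((f ^^ i) (\<sigma> y'))) < \<epsilon>"
              using yX iterate_in[OF fX] \<epsilon>'(1) by (intro \<epsilon>'(2)) auto
            then show ?thesis using cj[OF yX(1)] cj[OF yX(2)] \<sigma>(2) yy(1,2) D(1) by (simp add: subset_iff)
          qed
          then show False using D(2) yy(1,2,4) unfolding separated_iff[OF n] by (meson less_asym)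
        qed
        have point: "exp (\<psi> n y) \<le> exp (real k * \<delta>) * (\<Prod>j<K. F j (code y j))" if y: "y \<in> D" for y
        proof -
          have yY: "y \<in> Y" "\<sigma> y \<in> X" "\<pi> (\<sigma> y) = y" using y D(1) \<sigma> by auto
          have "\<psi> n y = \<psi> (k * N + n mod N) y" by (simp add: k_def)
          also have "\<dots> \<le> (\<Sum>j<k. \<psi> N ((h ^^ (j * N)) y))"
            by (rule subadditive_blocks[OF hY \<psi> sub yY(1)])
          also have "\<dots> \<le> (\<Sum>j<k. w (code y j) + \<delta>)"
          proof (rule sum_mono)
            fix j assume j: "j \<in> {..<k}"
            have in_X: "(f ^^ (j * N)) (\<sigma> y) \<in> X" using yY(2) by (rule iterate_in[OF fX])
            have "(h ^^ (j * N)) y = \<pi> ((f ^^ (j * N)) (\<sigma> y))" using cj[OF yY(2)] yY(3) by simp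
            then have "\<psi> N ((h ^^ (j * N)) y) \<le> \<phi>N ((f ^^ (j * N)) (\<sigma> y)) + \<delta>" using \<psi>\<phi>[OF in_X] by simp
            also have "\<dots> \<le> w (code y j) + \<delta>" using s(3)[OF in_X] j by (simp add: code_def K_def)
            finally show "\<psi> N ((h ^^ (j * N)) y) \<le> w (code y j) + \<delta>" .
          qed
          also have "\<dots> = real k * \<delta> + (\<Sum>j<k. w (code y j))" by (simp add: sum.distrib)
          finally have "exp (\<psi> n y) \<le> exp (real k * \<delta>) * (\<Prod>j<k. exp (w (code y j)))"
            by (simp flip: exp_add exp_sum)
          also have "(\<Prod>j<k. exp (w (code y j))) = (\<Prod>j<K. F j (code y j))"
            by (rule prod.mono_neutral_cong_left) (auto simp: F_def K_def)
          finally show ?thesis .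
        qed
        have "(\<Sum>y\<in>D. exp (\<psi> n y)) \<le> (\<Sum>y\<in>D. exp (real k * \<delta>) * (\<Prod>j<K. F j (code y j)))"
          by (rule sum_mono) (rule point)
        also have "\<dots> = exp (real k * \<delta>) * (\<Sum>g\<in>code ` D. \<Prod>j<K. F j (g j))"
          by (simp add: sum_distrib_left sum.reindex[OF inj])
        also have "(\<Sum>g\<in>code ` D. \<Prod>j<K. F j (g j)) \<le> (\<Sum>g\<in>Pi\<^sub>E {..<K} (\<lambda>_. E). \<Prod>j<K. F j (g j))"
        proof (rule sum_mono2)
          show "finite (Pi\<^sub>E {..<K} (\<lambda>_. E))" using E by (intro finite_PiE) auto
          show "code ` D \<subseteq> Pi\<^sub>E {..<K} (\<lambda>_. E)"
            using D(1) \<sigma> s(1) iterate_in[OF fX]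
            by (simp add: code_def restrict_PiE_iff image_subset_iff subsetD[OF D(1)])
        qed (auto simp: F_def intro!: prod_nonneg)
        also have "\<dots> = (\<Prod>j<K. \<Sum>a\<in>E. F j a)" using E by (intro prod_sum_PiE[symmetric]) auto
        also have "\<dots> = (\<Prod>j<k. \<Sum>a\<in>E. F j a) * (\<Prod>j\<in>{k..<K}. \<Sum>a\<in>E. F j a)"
        proof -
          have "{..<K} = {..<k} \<union> {k..<K}" by (auto simp: K_def)
          then have "(\<Prod>j<K. \<Sum>a\<in>E. F j a) = (\<Prod>j\<in>{..<k} \<union> {k..<K}. \<Sum>a\<in>E. F j a)"
            by (rule arg_cong)
          also have "\<dots> = (\<Prod>j<k. \<Sum>a\<in>E. F j a) * (\<Prod>j\<in>{k..<K}. \<Sum>a\<in>E. F j a)"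
            by (rule prod.union_disjoint) auto
          finally show ?thesis .
        qed
        also have "\<dots> = W ^ k * real (card E) ^ Suc m"
          by (simp add: F_def W_def K_def)
        finally show "(\<Sum>y\<in>D. exp (\<psi> n y)) \<le> exp (real k * \<delta>) * (W ^ k * real (card E) ^ Suc m)"
          by simp
      qed
      then have "ln (part_sum Y h \<psi> n \<epsilon>) \<le> ln (exp (real k * \<delta>) * (W ^ k * real (card E) ^ Suc m))"
        using part_sum_pos[OF Y h \<psi> n \<epsilon>] W cE by simp
      also have "\<dots> = real k * \<delta> + (real k * ln W + real (Suc m) * ln (real (card E)))"
        using W cE by (subst ln_mult, simp, simp, subst ln_mult, simp, simp) (simp add: ln_realpow ln_mult algebra_simps)
      finally show ?thesis by (simp add: k_def \<beta>_def c_def algebra_simps)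
    qed
    \<comment> \<open>The absolute value covers both signs of \<beta>: replacing
      \<open>n div N\<close> by \<open>n / N\<close> changes the bound by at most
      \<open>\<bar>\<beta>\<bar>\<close>.\<close>
    have "growth_rate Y h \<psi> \<epsilon> \<le> limsup (\<lambda>n. ereal (\<beta> / real N + (\<bar>\<beta>\<bar> + c) / real n))"
      unfolding growth_rate_def
    proof (rule Limsup_mono)
      show "\<forall>\<^sub>F n in sequentially. ereal (1 / real n * ln (part_sum Y h \<psi> n \<epsilon>)) \<le> ereal (\<beta> / real N + (\<bar>\<beta>\<bar> + c) / real n)"
        using eventually_ge_at_top[of 1]
      proof eventually_elim
        case (elim n)
        have "\<bar>real (n div N) - real n / real N\<bar> \<le> 1"
        proof -
          have "real n = real (n div N) * real N + real (n mod N)"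
            by (metis div_mult_mod_eq of_nat_add of_nat_mult)
          then have "real n / real N = real (n div N) + real (n mod N) / real N"
            using N(1) by (simp add: field_simps)
          moreover have "real (n mod N) / real N \<le> 1" using N(1) by (simp add: order_less_imp_le)
          ultimately show ?thesis by simp
        qed
        then have "\<bar>(real (n div N) - real n / real N) * \<beta>\<bar> \<le> \<bar>\<beta>\<bar>"
          by (simp add: abs_mult mult_left_le_one_le)
        then have "real (n div N) * \<beta> \<le> real n * (\<beta> / real N) + \<bar>\<beta>\<bar>"
          by (simp add: left_diff_distrib)
        then have "ln (part_sum Y h \<psi> n \<epsilon>) \<le> real n * (\<beta> / real N) + (\<bar>\<beta>\<bar> + c)"
          using bound[OF elim] by linarith
        then have "ln (part_sum Y h \<psi> n \<epsilon>) / real n \<le> (real n * (\<beta> / real N) + (\<bar>\<beta>\<bar> + c)) / real n"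
          by (rule divide_right_mono) simp
        also have "\<dots> = \<beta> / real N + (\<bar>\<beta>\<bar> + c) / real n" using elim by (simp add: add_divide_distrib)
        finally show ?case by simp
      qed
    qed
    also have "\<dots> = ereal (\<beta> / real N)"
    proof (rule lim_imp_Limsup)
      have "(\<lambda>n. \<beta> / real N + (\<bar>\<beta>\<bar> + c) / real n) \<longlonglongrightarrow> \<beta> / real N + 0"
        by (intro tendsto_intros lim_const_over_n)
      then show "(\<lambda>n. ereal (\<beta> / real N + (\<bar>\<beta>\<bar> + c) / real n)) \<longlonglongrightarrow> ereal (\<beta> / real N)" by simp
    qed simp
    finally show "growth_rate Y h \<psi> \<epsilon> \<le> ereal (\<beta> / real N)" .
  qed
qed

section \<open>Calculus in the preferred charts\<close>

lemma inner_form_inner: "inner_form (inner :: 'e::euclidean_space \<Rightarrow> 'e \<Rightarrow> real)"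
  by (auto simp: inner_form_def sym_form_def bilinear_def inner_commute bounded_linear_inner_left
      bounded_linear_inner_right bounded_linear.linear)

text \<open>The lower bound comes from the least eigenvalue of \<open>G\<close> relative to the
  Euclidean inner product, the upper one from boundedness of bilinear maps.\<close>

lemma inner_form_bounds:
  assumes G: "inner_form (G :: 'e::euclidean_space \<Rightarrow> 'e \<Rightarrow> real)"
  obtains \<beta> B where "\<beta> > 0" "B > 0" "\<And>w. \<beta> * norm w \<le> sqrt (G w w)" "\<And>w. sqrt (G w w) \<le> B * norm w"
proof -
  note Gs = inner_form_sym_form[OF G]
  have "(UNIV :: 'e set) \<noteq> {0}" using nonempty_Basis nonzero_Basis by blast
  then obtain e :: 'e where e: "e \<bullet> e = 1" "\<And>v. G e e * (v \<bullet> v) \<le> G v v"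
    using rayleigh_minimizer[OF inner_form_inner Gs subspace_UNIV] by auto
  obtain C where C: "C > 0" "\<And>u v. norm (G u v) \<le> C * norm u * norm v"
    using bilinear_bounded_pos[of G] Gs by (auto simp: sym_form_def)
  show ?thesis
  proof (rule that)
    have "e \<noteq> 0" using e(1) by auto
    then show "sqrt (G e e) > 0" using inner_form_pos[OF G] by simp
    show "sqrt C > 0" using C by simp
    fix w :: 'e
    have "sqrt (G e e) * norm w = sqrt (G e e * (w \<bullet> w))"
      by (simp add: real_sqrt_mult norm_eq_sqrt_inner)
    then show "sqrt (G e e) * norm w \<le> sqrt (G w w)" using e(2)[of w] by simp
    have "G w w \<le> C * (norm w)\<^sup>2" using C(2)[of w w] by (simp add: power2_eq_square mult.assoc)
    then have "sqrt (G w w) \<le> sqrt (C * (norm w)\<^sup>2)" by simp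
    then show "sqrt (G w w) \<le> sqrt C * norm w" by (simp add: real_sqrt_mult)
  qed
qed

lemma inner_form_triangle:
  assumes G: "inner_form (G :: 'e::euclidean_space \<Rightarrow> 'e \<Rightarrow> real)"
  shows "sqrt (G (u + v) (u + v)) \<le> sqrt (G u u) + sqrt (G v v)"
proof -
  note Gs = inner_form_sym_form[OF G]
  obtain w \<mu> where D: "diagonalizes UNIV G G DIM('e) w \<mu>"
    using diagonalizes_exists[OF G Gs subspace_UNIV] by auto
  have *: "sqrt (G v v) = L2_set (\<lambda>i. G (w i) v) {..<DIM('e)}" for v
    using diagonalizes_G_expand[OF G Gs D UNIV_I, of v v] by (simp add: L2_set_def power2_eq_square)
  show ?thesis
    unfolding * using L2_set_triangle_ineq[of "\<lambda>i. G (w i) u" "\<lambda>i. G (w i) v" "{..<DIM('e)}"]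
    by (simp add: sym_form_simps[OF Gs])
qed

lemma Ck_on_1:
  assumes "Ck_on 1 F S" "p \<in> S"
  shows "(F has_derivative frechet_derivative F (at p)) (at p)"
  using assms frechet_derivative_works unfolding One_nat_def Ck_on.simps differentiable_def by blast

lemma Ck_on_1_continuous:
  assumes "Ck_on 1 F S"
  shows "continuous_on S (\<lambda>p. frechet_derivative F (at p) v)"
proof -
  obtain F' where F': "\<And>p. p \<in> S \<Longrightarrow> (F has_derivative F' p) (at p)" "\<And>v. continuous_on S (\<lambda>p. F' p v)"
    using assms by auto
  have "F' p = frechet_derivative F (at p)" if "p \<in> S" for p
    using frechet_derivative_at[OF F'(1)[OF that]] .
  then show ?thesis using F'(2)[of v] by (simp cong: continuous_on_cong)
qed

text \<open>\<open>Ck_on\<close> gives continuity of the derivative one vector at a time; estimates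
  on the basis are turned here into an operator bound.\<close>

lemma linear_norm_le_Basis:
  assumes "linear (f :: 'a::euclidean_space \<Rightarrow> 'b::real_normed_vector)" "\<And>i. i \<in> Basis \<Longrightarrow> norm (f i) \<le> c"
  shows "norm (f w) \<le> real DIM('a) * c * norm w"
proof -
  have "f w = (\<Sum>i\<in>Basis. (w \<bullet> i) *\<^sub>R f i)"
  proof -
    have "f w = f (\<Sum>i\<in>Basis. (w \<bullet> i) *\<^sub>R i)" by (simp add: euclidean_representation)
    then show ?thesis by (simp only: linear_sum[OF assms(1)] linear_cmul[OF assms(1)])
  qed
  also have "norm \<dots> \<le> (\<Sum>i\<in>(Basis::'a set). c * norm w)"
  proof (rule sum_norm_le)
    fix i :: 'a assume i: "i \<in> Basis"
    have "norm ((w \<bullet> i) *\<^sub>R f i) = \<bar>w \<bullet> i\<bar> * norm (f i)" by simp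
    also have "\<dots> \<le> norm w * c"
      using Basis_le_norm[OF i, of w] assms(2)[OF i] by (intro mult_mono) auto
    finally show "norm ((w \<bullet> i) *\<^sub>R f i) \<le> c * norm w" by (simp add: mult.commute)
  qed
  finally show ?thesis by (simp add: mult.assoc)
qed

text \<open>A continuous derivative is a strict one: the mean value inequality is applied on a ball
  where the derivative differs from the one at \<open>p\<close> by at most \<epsilon>. Both points
  vary, as perturbation arguments require.\<close>

lemma Ck_on_1_strict:
  fixes F :: "'a::euclidean_space \<Rightarrow> 'b::euclidean_space"
  assumes F: "Ck_on 1 F S" and S: "open S" "p \<in> S" and \<epsilon>: "\<epsilon> > 0"
  obtains r where "r > 0" "ball p r \<subseteq> S"
    "\<And>u v. u \<in> ball p r \<Longrightarrow> v \<in> ball p r \<Longrightarrow>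
      norm (F v - F u - frechet_derivative F (at p) (v - u)) \<le> \<epsilon> * norm (v - u)"
proof -
  let ?D = "\<lambda>q. frechet_derivative F (at q)"
  define \<epsilon>' where "\<epsilon>' = \<epsilon> / real DIM('a)"
  have \<epsilon>': "\<epsilon>' > 0" using \<epsilon> by (simp add: \<epsilon>'_def)
  have "\<forall>\<^sub>F q in nhds p. dist (?D q i) (?D p i) < \<epsilon>'" for i
  proof -
    have "isCont (\<lambda>q. ?D q i) p"
      using Ck_on_1_continuous[OF F, of i] S continuous_on_eq_continuous_at by blast
    then have "((\<lambda>q. ?D q i) \<longlongrightarrow> ?D p i) (at p)" by (simp add: continuous_at)
    from tendstoD[OF this \<epsilon>'] show ?thesis using \<epsilon>' by (simp add: eventually_nhds_conv_at)
  qed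
  then have "\<forall>\<^sub>F q in nhds p. \<forall>i\<in>Basis. dist (?D q i) (?D p i) < \<epsilon>'"
    by (intro eventually_ball_finite) auto
  moreover have "\<forall>\<^sub>F q in nhds p. q \<in> S" using S by (rule eventually_nhds_in_open)
  ultimately have "\<forall>\<^sub>F q in nhds p. q \<in> S \<and> (\<forall>i\<in>Basis. dist (?D q i) (?D p i) < \<epsilon>')"
    by eventually_elim auto
  then obtain r where r: "r > 0" "\<And>q. dist q p < r \<Longrightarrow> q \<in> S" "\<And>q i. dist q p < r \<Longrightarrow> i \<in> Basis \<Longrightarrow> dist (?D q i) (?D p i) < \<epsilon>'"
    unfolding eventually_nhds_metric by blast
  have sub: "ball p r \<subseteq> S" using r by (auto simp: dist_commute)
  have der: "(F has_derivative ?D q) (at q)" if "q \<in> S" for q using Ck_on_1[OF F that] .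
  have lin: "linear (?D q)" if "q \<in> S" for q using der[OF that] by (rule has_derivative_linear)
  have on: "onorm (?D q - ?D p) \<le> \<epsilon>" if q: "q \<in> ball p r" for q
    unfolding fun_diff_def
  proof (rule onorm_le)
    fix v
    have "norm (?D q v - ?D p v) \<le> real DIM('a) * \<epsilon>' * norm v"
    proof (intro linear_norm_le_Basis linear_compose_sub lin S(2))
      have "dist q p < r" using q by (simp add: dist_commute)
      then show "q \<in> S" "\<And>i. i \<in> Basis \<Longrightarrow> norm (?D q i - ?D p i) \<le> \<epsilon>'"
        using r by (auto simp: dist_norm intro!: less_imp_le)
    qed
    then show "norm (?D q v - ?D p v) \<le> \<epsilon> * norm v" by (simp add: \<epsilon>'_def)
  qed
  show ?thesis
  proof (rule that[OF r(1) sub])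
    fix u v assume uv: "u \<in> ball p r" "v \<in> ball p r"
    have "norm (F v - F u - ?D p (v - u)) \<le> norm (v - u) * \<epsilon>"
    proof (rule differentiable_bound_linearization[where S = "ball p r"])
      show "u + t *\<^sub>R (v - u) \<in> ball p r" if "t \<in> {0..1}" for t
        using convexD_alt[OF convex_ball uv, of t] that by (simp add: algebra_simps)
      show "(F has_derivative ?D q) (at q within ball p r)" if "q \<in> ball p r" for q
        using der sub that by (blast intro: has_derivative_at_withinI)
      show "onorm (?D q - ?D p) \<le> \<epsilon>" if "q \<in> ball p r" for q by (rule on[OF that])
      show "p \<in> ball p r" using r by simp
    qed
    then show "norm (F v - F u - ?D p (v - u)) \<le> \<epsilon> * norm (v - u)" by (simp add: mult.commute)
  qed
qed

text \<open>Increments \<open>t w\<close> with small \<open>t\<close> give the bound up to an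
  additive error \<open>e\<close>, which is arbitrary.\<close>

lemma has_derivative_norm_le:
  fixes F :: "'a::real_normed_vector \<Rightarrow> 'b::real_normed_vector"
  assumes D: "(F has_derivative D) (at p)" and S: "open S" "p \<in> S"
    and lip: "\<And>v. v \<in> S \<Longrightarrow> norm (F v - F p) \<le> K * norm (v - p)"
  shows "norm (D w) \<le> K * norm w"
proof -
  have "norm (D w) \<le> K * norm w + e" if e: "e > 0" for e
  proof (cases "w = 0")
    case True
    then show ?thesis using has_derivative_linear[OF D] e by (simp add: linear_0)
  next
    case False
    define \<epsilon> where "\<epsilon> = e / norm w"
    have \<epsilon>: "\<epsilon> > 0" using e False by (simp add: \<epsilon>_def)
    obtain r where r: "r > 0" "ball p r \<subseteq> S" using S open_contains_ball by blast
    obtain d where d: "d > 0" "\<And>y. norm (y - p) < d \<Longrightarrow> norm (F y - F p - D (y - p)) \<le> \<epsilon> * norm (y - p)"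
      using D \<epsilon> unfolding has_derivative_at_alt by blast
    define t where "t = min r d / (2 * norm w)"
    have t: "t > 0" "t * norm w < r" "t * norm w < d" using r d False by (auto simp: t_def min_def)
    let ?y = "p + t *\<^sub>R w"
    have "?y \<in> S" using t r by (intro subsetD[OF r(2)]) (simp add: dist_norm)
    then have "norm (F ?y - F p) \<le> K * (t * norm w)" using lip[of ?y] t by simp
    moreover have "norm (F ?y - F p - D (t *\<^sub>R w)) \<le> \<epsilon> * (t * norm w)" using d(2)[of ?y] t by simp
    ultimately have "norm (D (t *\<^sub>R w)) \<le> (K + \<epsilon>) * (t * norm w)"
      using norm_triangle_ineq4[of "F ?y - F p" "F ?y - F p - D (t *\<^sub>R w)"] by (simp add: algebra_simps)
    then have "t * norm (D w) \<le> t * ((K + \<epsilon>) * norm w)"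
      using linear_cmul[OF has_derivative_linear[OF D]] t by (simp add: algebra_simps)
    then have "norm (D w) \<le> (K + \<epsilon>) * norm w" using t by simp
    then show ?thesis using False by (simp add: \<epsilon>_def algebra_simps)
  qed
  then show ?thesis by (rule field_le_epsilon)
qed


section \<open>Preferred charts, transport between them and the metric\<close>

locale riemannian_manifold =
  fixes A :: "('m::metric_space, 'e::euclidean_space) chart set" and g :: "'m \<Rightarrow> 'e \<Rightarrow> 'e \<Rightarrow> real"
  assumes manifold: "compact_riemannian_manifold A g"
begin

abbreviation dom :: "'m \<Rightarrow> 'm set" where "dom x \<equiv> fst (chart_at A x)"
abbreviation coord :: "'m \<Rightarrow> 'm \<Rightarrow> 'e" where "coord x \<equiv> snd (chart_at A x)"
abbreviation par :: "'m \<Rightarrow> 'e \<Rightarrow> 'm" where "par x \<equiv> chart_inv (chart_at A x)"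
abbreviation img :: "'m \<Rightarrow> 'e set" where "img x \<equiv> chart_image (chart_at A x)"
abbreviation disp :: "'m \<Rightarrow> 'm \<Rightarrow> 'm \<Rightarrow> 'e" where "disp x y z \<equiv> coord x z - coord x y"

lemma compact_manifold: "compact (UNIV :: 'm set)"
  and atlas: "smooth_atlas A" and metric: "riemannian_metric A g"
  using manifold by (auto simp: compact_riemannian_manifold_def)

lemma metric_inner_form: "inner_form (g x)"
  using metric by (auto simp: riemannian_metric_def inner_form_def sym_form_def)

lemma chart_at: "chart_at A x \<in> A" "x \<in> dom x"
proof -
  have "x \<in> (\<Union>c\<in>A. fst c)" using atlas by (simp add: smooth_atlas_def)
  then have "\<exists>c. c \<in> A \<and> x \<in> fst c" by blast
  then have "chart_at A x \<in> A \<and> x \<in> dom x" unfolding chart_at_def by (rule someI_ex)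
  then show "chart_at A x \<in> A" "x \<in> dom x" by auto
qed

lemma is_chart_at: "is_chart (chart_at A x)"
  using atlas chart_at by (auto simp: smooth_atlas_def)

lemma open_dom: "open (dom x)" and open_img: "open (img x)"
  and continuous_coord: "continuous_on (dom x) (coord x)"
  and continuous_par: "continuous_on (img x) (par x)"
  and par_coord: "y \<in> dom x \<Longrightarrow> par x (coord x y) = y"
  and coord_par: "u \<in> img x \<Longrightarrow> coord x (par x u) = u"
  and coord_in_img: "y \<in> dom x \<Longrightarrow> coord x y \<in> img x"
  and par_in_dom: "u \<in> img x \<Longrightarrow> par x u \<in> dom x"
  using is_chart_at[of x] by (auto simp: is_chart_def homeomorphism_def)

lemma open_par_vimage: "open W \<Longrightarrow> open (img x \<inter> par x -` W)"
  by (rule continuous_open_preimage[OF continuous_par open_img])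

lemma coord_image: "coord x ` (dom x \<inter> W) = img x \<inter> par x -` W"
proof
  show "coord x ` (dom x \<inter> W) \<subseteq> img x \<inter> par x -` W" by (auto simp: coord_in_img par_coord)
  show "img x \<inter> par x -` W \<subseteq> coord x ` (dom x \<inter> W)"
  proof
    fix u assume "u \<in> img x \<inter> par x -` W"
    then show "u \<in> coord x ` (dom x \<inter> W)"
      using coord_par[of u x] par_in_dom[of u x] by (intro image_eqI[of _ _ "par x u"]) auto
  qed
qed

lemma transition_Ck1: "Ck_on 1 (coord y \<circ> par x) (img x \<inter> par x -` dom y)"
  using atlas chart_at(1) unfolding smooth_atlas_def smooth_on_def coord_image[symmetric] by blast

lemma ball_in_chart:
  assumes "open S" "coord x x \<in> S"
  obtains d where "d > 0" "ball x d \<subseteq> dom x" "coord x ` ball x d \<subseteq> S"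
proof -
  have "open (dom x \<inter> coord x -` S)"
    by (rule continuous_open_preimage[OF continuous_coord open_dom assms(1)])
  moreover have "x \<in> dom x \<inter> coord x -` S" using assms chart_at by auto
  ultimately obtain d where "d > 0" "ball x d \<subseteq> dom x \<inter> coord x -` S"
    using open_contains_ball by metis
  then show ?thesis using that by blast
qed

text \<open>Preferred charts are chosen independently at each point, so the coordinates of vectors
  at \<open>y\<close> have no relation to those at \<open>x\<close>. This derivative of the chart
  change takes a vector at \<open>y\<close> from the coordinates of the chart at \<open>x\<close> to
  those of the chart at \<open>y\<close>; only after it do \<open>g\<close> and derivatives vary
  continuously with \<open>y\<close>.\<close>

definition frame :: "'m \<Rightarrow> 'm \<Rightarrow> 'e \<Rightarrow> 'e" where
  "frame x y = frechet_derivative (coord y \<circ> par x) (at (coord x y))"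

lemma frame_derivative:
  assumes "y \<in> dom x"
  shows "(coord y \<circ> par x has_derivative frame x y) (at (coord x y))"
  unfolding frame_def using assms
  by (intro Ck_on_1[OF transition_Ck1]) (auto simp: coord_in_img par_coord chart_at)

lemma frame_linear: "y \<in> dom x \<Longrightarrow> linear (frame x y)"
  using frame_derivative has_derivative_linear by blast

lemma chart_change_eq_frame: "y \<in> dom x \<Longrightarrow> chart_change A (chart_at A x) (coord x y) = frame x y"
  by (simp add: chart_change_def frame_def par_coord)

text \<open>The two chart changes are inverse to each other near the point; the chain rule makes
  their derivatives inverse.\<close>

lemma coframe_derivative:
  assumes "y \<in> dom x"
  obtains S where "(coord x \<circ> par y has_derivative S) (at (coord y y))" "S \<circ> frame x y = id" "frame x y \<circ> S = id"
proof -
  define S where "S = frechet_derivative (coord x \<circ> par y) (at (coord y y))"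
  have S: "(coord x \<circ> par y has_derivative S) (at (coord y y))"
    unfolding S_def using assms
    by (intro Ck_on_1[OF transition_Ck1]) (auto simp: coord_in_img par_coord chart_at)
  have e: "(coord y \<circ> par x) (coord x y) = coord y y" "(coord x \<circ> par y) (coord y y) = coord x y"
    using assms chart_at by (simp_all add: par_coord)
  have 1: "((coord x \<circ> par y) \<circ> (coord y \<circ> par x) has_derivative S \<circ> frame x y) (at (coord x y))"
    by (rule diff_chain_at[OF frame_derivative[OF assms]]) (simp only: e S)
  have "(id has_derivative S \<circ> frame x y) (at (coord x y))"
    by (rule has_derivative_transform_within_open[OF 1 open_par_vimage[OF open_dom[of y], of x]])
      (use assms chart_at in \<open>auto simp: coord_in_img par_coord coord_par\<close>)
  then have "S \<circ> frame x y = id"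
    using has_derivative_unique has_derivative_id unfolding id_def by blast
  have 2: "((coord y \<circ> par x) \<circ> (coord x \<circ> par y) has_derivative frame x y \<circ> S) (at (coord y y))"
    by (rule diff_chain_at[OF S]) (simp only: e frame_derivative[OF assms])
  have "(id has_derivative frame x y \<circ> S) (at (coord y y))"
    by (rule has_derivative_transform_within_open[OF 2 open_par_vimage[OF open_dom[of x], of y]])
      (use assms chart_at in \<open>auto simp: coord_in_img par_coord coord_par\<close>)
  then have "frame x y \<circ> S = id"
    using has_derivative_unique has_derivative_id unfolding id_def by blast
  with S \<open>S \<circ> frame x y = id\<close> show ?thesis using that by blast
qed

lemma frame_bij: "y \<in> dom x \<Longrightarrow> bij (frame x y)"
  by (metis coframe_derivative o_bij)

lemma frame_self: "frame x x = id"
proof -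
  have "((\<lambda>u. u) has_derivative frame x x) (at (coord x x))"
    by (rule has_derivative_transform_within_open[OF frame_derivative[OF chart_at(2)] open_img[of x]])
      (use chart_at in \<open>auto simp: coord_in_img coord_par\<close>)
  then show ?thesis using has_derivative_unique has_derivative_ident unfolding id_def by blast
qed

lemma derivative_change_chart:
  assumes u: "(u \<circ> par y has_derivative U) (at (coord y y))" and y: "y \<in> dom x"
  shows "(u \<circ> par x has_derivative U \<circ> frame x y) (at (coord x y))"
proof -
  have "(coord y \<circ> par x) (coord x y) = coord y y" using y by (simp add: par_coord)
  then have "((u \<circ> par y) \<circ> (coord y \<circ> par x) has_derivative U \<circ> frame x y) (at (coord x y))"
    using u by (intro diff_chain_at[OF frame_derivative[OF y]]) simp
  then show ?thesis
    by (rule has_derivative_transform_within_open[OF _ open_par_vimage[OF open_dom[of y], of x]])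
      (use y chart_at in \<open>auto simp: coord_in_img par_coord\<close>)
qed

lemma tnorm_bounds:
  obtains \<beta> B where "\<beta> > 0" "B > 0" "\<And>w. \<beta> * norm w \<le> tnorm g x w" "\<And>w. tnorm g x w \<le> B * norm w"
  using inner_form_bounds[OF metric_inner_form[of x]] unfolding tnorm_def by metis

lemma tnorm_triangle: "tnorm g x (u + v) \<le> tnorm g x u + tnorm g x v"
  unfolding tnorm_def by (rule inner_form_triangle[OF metric_inner_form])

lemma tnorm_scale: "tnorm g x (c *\<^sub>R u) = \<bar>c\<bar> * tnorm g x u"
  unfolding tnorm_def by (simp add: sym_form_simps[OF inner_form_sym_form[OF metric_inner_form]] real_sqrt_mult)

lemma tnorm_0 [simp]: "tnorm g x 0 = 0"
  using tnorm_scale[of x 0 0] by simp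

lemma tnorm_minus: "tnorm g x (u - v) = tnorm g x (v - u)"
  using tnorm_scale[of x "-1" "u - v"] by simp

lemma tnorm_nonneg: "0 \<le> tnorm g x u"
  by (simp add: tnorm_def inner_form_nonneg[OF metric_inner_form])

lemma tnorm_pos: "u \<noteq> 0 \<Longrightarrow> 0 < tnorm g x u"
  by (simp add: tnorm_def inner_form_pos[OF metric_inner_form])

lemma tnorm_sq: "(tnorm g x u)\<^sup>2 = g x u u"
  by (simp add: tnorm_def inner_form_nonneg[OF metric_inner_form])

text \<open>Continuity of the metric at \<open>x\<close> in multiplicative form, which is what
  estimates of expansion rates can absorb.\<close>

lemma tnorm_frame:
  assumes a: "a > 1"
  obtains d where "d > 0" "ball x d \<subseteq> dom x"
    "\<And>y w. y \<in> ball x d \<Longrightarrow> tnorm g x w \<le> a * tnorm g y (frame x y w)"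
    "\<And>y w. y \<in> ball x d \<Longrightarrow> tnorm g y (frame x y w) \<le> a * tnorm g x w"
proof -
  obtain \<beta> B where \<beta>: "\<beta> > 0" "\<And>w. \<beta> * norm w \<le> tnorm g x w" using tnorm_bounds[of x] by metis
  \<comment> \<open>Chosen so that \<open>1 - \<theta>\<close> is the inverse of
    \<open>a\<^sup>2\<close>; then also \<open>1 + \<theta> \<le> a\<^sup>2\<close>.\<close>
  define \<theta> where "\<theta> = 1 - 1 / a\<^sup>2"
  have a2: "a\<^sup>2 > 1" using a by (simp add: power_strict_mono one_less_power)
  have \<theta>: "\<theta> > 0" using a2 by (simp add: \<theta>_def divide_less_eq)
  \<comment> \<open>The quadratic form has \<open>DIM('e)\<close> squared matrix entries, each
    allowed an error \<eta>; \<beta> converts the Euclidean norm into \<open>tnorm\<close>.\<close>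
  define \<eta> where "\<eta> = \<theta> * \<beta>\<^sup>2 / (real DIM('e))\<^sup>2"
  have \<eta>: "\<eta> > 0" using \<theta> \<beta> by (simp add: \<eta>_def)
  define q where "q u i j = g (par x u) (chart_change A (chart_at A x) u i) (chart_change A (chart_at A x) u j)" for u i j
  have "continuous_on (img x) (\<lambda>u. q u i j)" for i j
  proof -
    have "Ck_on 0 (\<lambda>u. q u i j) (img x)"
      using metric chart_at(1)[of x] unfolding riemannian_metric_def smooth_on_def q_def by blast
    then show ?thesis by simp
  qed
  then have "isCont (\<lambda>u. q u i j) (coord x x)" for i j
    using open_img coord_in_img[OF chart_at(2)] continuous_on_eq_continuous_at by blast
  then have "\<forall>\<^sub>F u in nhds (coord x x). dist (q u i j) (q (coord x x) i j) < \<eta>" for i j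
    using tendstoD[of "\<lambda>u. q u i j" "q (coord x x) i j" "at (coord x x)" \<eta>] \<eta>
    by (simp add: eventually_nhds_conv_at continuous_at)
  then have "\<forall>\<^sub>F u in nhds (coord x x). \<forall>i\<in>Basis. \<forall>j\<in>Basis. dist (q u i j) (q (coord x x) i j) < \<eta>"
    by (intro eventually_ball_finite ballI) auto
  then obtain S where S: "open S" "coord x x \<in> S"
    "\<And>u i j. u \<in> S \<Longrightarrow> i \<in> Basis \<Longrightarrow> j \<in> Basis \<Longrightarrow> dist (q u i j) (q (coord x x) i j) < \<eta>"
    unfolding eventually_nhds by metis
  obtain d where d: "d > 0" "ball x d \<subseteq> dom x" "coord x ` ball x d \<subseteq> S"
    using ball_in_chart[OF S(1,2)] by blast
  have q: "q (coord x y) i j = g y (frame x y i) (frame x y j)" if "y \<in> dom x" for y i j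
    using that by (simp add: q_def par_coord chart_change_eq_frame)
  have main: "\<bar>(tnorm g y (frame x y w))\<^sup>2 - (tnorm g x w)\<^sup>2\<bar> \<le> \<theta> * (tnorm g x w)\<^sup>2" if y: "y \<in> ball x d" for y w
  proof -
    have yd: "y \<in> dom x" using d y by blast
    note Gy = inner_form_sym_form[OF metric_inner_form[of y]] and Gx = inner_form_sym_form[OF metric_inner_form[of x]]
    have w: "w = (\<Sum>i\<in>Basis. (w \<bullet> i) *\<^sub>R i)" by (simp add: euclidean_representation)
    have 1: "g y (frame x y w) (frame x y w) = (\<Sum>i\<in>Basis. \<Sum>j\<in>Basis. (w \<bullet> i) * ((w \<bullet> j) * q (coord x y) i j))"
      by (subst (1 2) w) (simp add: linear_sum[OF frame_linear[OF yd]] linear_cmul[OF frame_linear[OF yd]]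
          sym_form_simps[OF Gy] q[OF yd] sum_distrib_left, intro sum.cong refl, metis sym_form_sym[OF Gy])
    have 2: "g x w w = (\<Sum>i\<in>Basis. \<Sum>j\<in>Basis. (w \<bullet> i) * ((w \<bullet> j) * q (coord x x) i j))"
      by (subst (1 2) w) (simp add: sym_form_simps[OF Gx] q[OF chart_at(2)] frame_self sum_distrib_left,
          intro sum.cong refl, metis sym_form_sym[OF Gx])
    have "\<bar>g y (frame x y w) (frame x y w) - g x w w\<bar> =
        \<bar>\<Sum>i\<in>Basis. \<Sum>j\<in>Basis. (w \<bullet> i) * ((w \<bullet> j) * (q (coord x y) i j - q (coord x x) i j))\<bar>"
      unfolding 1 2 by (simp add: sum_subtractf right_diff_distrib)
    also have "\<dots> \<le> (\<Sum>i\<in>(Basis::'e set). \<Sum>j\<in>(Basis::'e set). norm w * (norm w * \<eta>))"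
    proof (intro order_trans[OF sum_abs] sum_mono)
      fix i j :: 'e assume ij: "i \<in> Basis" "j \<in> Basis"
      have "\<bar>q (coord x y) i j - q (coord x x) i j\<bar> \<le> \<eta>"
        using S(3)[OF _ ij, of "coord x y"] d(3) y by (force simp: dist_real_def)
      then show "\<bar>(w \<bullet> i) * ((w \<bullet> j) * (q (coord x y) i j - q (coord x x) i j))\<bar> \<le> norm w * (norm w * \<eta>)"
        unfolding abs_mult using Basis_le_norm ij \<eta> by (intro mult_mono) auto
    qed
    also have "\<dots> = \<theta> * (\<beta> * norm w)\<^sup>2" by (simp add: \<eta>_def power2_eq_square)
    also have "\<dots> \<le> \<theta> * (tnorm g x w)\<^sup>2"
      using \<beta> \<theta> by (intro mult_left_mono power_mono) auto
    finally show ?thesis by (simp add: tnorm_sq)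
  qed
  show ?thesis
  proof (rule that[OF d(1,2)])
    fix y w assume y: "y \<in> ball x d"
    have "1 + \<theta> \<le> a\<^sup>2"
    proof -
      have "2 \<le> a\<^sup>2 + 1 / a\<^sup>2"
        using zero_le_power2[of "a - 1/a"] a by (simp add: power2_diff field_simps power2_eq_square)
      then show ?thesis by (simp add: \<theta>_def)
    qed
    then have "(tnorm g y (frame x y w))\<^sup>2 \<le> a\<^sup>2 * (tnorm g x w)\<^sup>2"
      using main[OF y, of w] mult_right_mono[of "1 + \<theta>" "a\<^sup>2" "(tnorm g x w)\<^sup>2"] by (simp add: algebra_simps)
    then have "(tnorm g y (frame x y w))\<^sup>2 \<le> (a * tnorm g x w)\<^sup>2" by (simp add: power_mult_distrib)
    then show "tnorm g y (frame x y w) \<le> a * tnorm g x w"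
      using a tnorm_nonneg by (auto intro: power2_le_imp_le)
    have "(1 / a\<^sup>2) * (tnorm g x w)\<^sup>2 \<le> (tnorm g y (frame x y w))\<^sup>2"
      using main[OF y, of w] by (simp add: \<theta>_def algebra_simps)
    then have "(tnorm g x w)\<^sup>2 \<le> (a * tnorm g y (frame x y w))\<^sup>2"
      using a by (simp add: field_simps)
    then show "tnorm g x w \<le> a * tnorm g y (frame x y w)"
      using a tnorm_nonneg by (auto intro: power2_le_imp_le)
  qed
qed

text \<open>Strict differentiability at \<open>x\<close>, with both points free and displacements
  read in the chart at \<open>x\<close>. In this form the remainder is a map of small Lipschitz
  constant, which controls derivatives at all nearby points.\<close>

definition strict_deriv :: "'m \<Rightarrow> ('m \<Rightarrow> 'v::real_normed_vector) \<Rightarrow> ('e \<Rightarrow> 'v) \<Rightarrow> bool" where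
  "strict_deriv x F D \<longleftrightarrow> linear D \<and>
     (\<forall>\<epsilon>>0. \<exists>d>0. \<forall>y\<in>ball x d. \<forall>z\<in>ball x d. norm (F z - F y - D (disp x y z)) \<le> \<epsilon> * norm (disp x y z))"

lemma strict_derivD:
  assumes "strict_deriv x F D" "\<epsilon> > 0"
  obtains d where "d > 0" "\<And>y z. y \<in> ball x d \<Longrightarrow> z \<in> ball x d \<Longrightarrow> norm (F z - F y - D (disp x y z)) \<le> \<epsilon> * norm (disp x y z)"
  using assms unfolding strict_deriv_def by meson

lemma strict_deriv_Ck1:
  fixes F :: "'m \<Rightarrow> 'v::euclidean_space"
  assumes F: "Ck_on 1 (F \<circ> par x) S" and S: "open S" "coord x x \<in> S"
  shows "strict_deriv x F (frechet_derivative (F \<circ> par x) (at (coord x x)))"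
  unfolding strict_deriv_def
proof (intro conjI allI impI)
  show "linear (frechet_derivative (F \<circ> par x) (at (coord x x)))"
    using Ck_on_1[OF F S(2)] by (rule has_derivative_linear)
  fix \<epsilon> :: real assume \<epsilon>: "\<epsilon> > 0"
  obtain r where r: "r > 0" "ball (coord x x) r \<subseteq> S"
    "\<And>u v. u \<in> ball (coord x x) r \<Longrightarrow> v \<in> ball (coord x x) r \<Longrightarrow>
      norm ((F \<circ> par x) v - (F \<circ> par x) u - frechet_derivative (F \<circ> par x) (at (coord x x)) (v - u)) \<le> \<epsilon> * norm (v - u)"
    using Ck_on_1_strict[OF F S \<epsilon>] by blast
  obtain d where d: "d > 0" "ball x d \<subseteq> dom x" "coord x ` ball x d \<subseteq> ball (coord x x) r"
    using ball_in_chart[of "ball (coord x x) r" x] r(1) by auto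
  have "norm (F z - F y - frechet_derivative (F \<circ> par x) (at (coord x x)) (disp x y z)) \<le> \<epsilon> * norm (disp x y z)"
    if "y \<in> ball x d" "z \<in> ball x d" for y z
    using r(3)[of "coord x y" "coord x z"] d that by (force simp: par_coord subset_iff)
  then show "\<exists>d>0. \<forall>y\<in>ball x d. \<forall>z\<in>ball x d.
      norm (F z - F y - frechet_derivative (F \<circ> par x) (at (coord x x)) (disp x y z)) \<le> \<epsilon> * norm (disp x y z)"
    using d(1) by blast
qed

text \<open>The difference of \<open>F\<close> and \<open>D\<close> composed with the chart
  satisfies an \<epsilon>-Lipschitz estimate at \<open>y\<close>, so its derivative there has norm
  at most \<epsilon>; \<open>frame\<close> expresses this in the chart of \<open>y\<close>.\<close>

lemma lipschitz_deriv:
  fixes F :: "'m \<Rightarrow> 'v::real_normed_vector"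
  assumes d: "ball x d \<subseteq> dom x" and y: "y \<in> ball x d" and D: "linear D"
    and F: "\<And>z. z \<in> ball x d \<Longrightarrow> norm (F z - F y - D (disp x y z)) \<le> \<epsilon> * norm (disp x y z)"
    and U: "(F \<circ> par y has_derivative U) (at (coord y y))"
  shows "norm (U (frame x y w) - D w) \<le> \<epsilon> * norm w"
proof -
  have yd: "y \<in> dom x" using d y by blast
  have bl: "bounded_linear D" using D by (simp add: linear_conv_bounded_linear)
  have "((\<lambda>u. (F \<circ> par x) u - D u) has_derivative (\<lambda>w. (U \<circ> frame x y) w - D w)) (at (coord x y))"
    by (intro has_derivative_diff derivative_change_chart[OF U yd] bounded_linear_imp_has_derivative bl)
  then have "norm ((U \<circ> frame x y) w - D w) \<le> \<epsilon> * norm w"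
  proof (rule has_derivative_norm_le[OF _ open_par_vimage[OF open_ball[of x d], of x]])
    show "coord x y \<in> img x \<inter> par x -` ball x d" using yd y by (simp add: coord_in_img par_coord)
    fix v assume v: "v \<in> img x \<inter> par x -` ball x d"
    then show "norm ((F \<circ> par x) v - D v - ((F \<circ> par x) (coord x y) - D (coord x y))) \<le> \<epsilon> * norm (v - coord x y)"
      using F[of "par x v"] yd by (simp add: coord_par par_coord linear_diff[OF D] algebra_simps)
  qed
  then show ?thesis by simp
qed

text \<open>Adds existence to \<open>manifold_deriv\<close>, which as a total function has a value
  even where no derivative exists.\<close>

definition has_mderiv :: "('m \<Rightarrow> 'm) \<Rightarrow> 'm \<Rightarrow> ('e \<Rightarrow> 'e) \<Rightarrow> bool" where
  "has_mderiv k x K \<longleftrightarrow> (coord (k x) \<circ> k \<circ> par x has_derivative K) (at (coord x x))"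

lemma has_mderiv_eq: "has_mderiv k x K \<Longrightarrow> manifold_deriv A k x = K"
  unfolding has_mderiv_def manifold_deriv_def by (rule frechet_derivative_at[symmetric])

lemma has_mderiv_linear: "has_mderiv k x K \<Longrightarrow> linear K"
  unfolding has_mderiv_def by (rule has_derivative_linear)

text \<open>A chain rule in which the outer map is read in an arbitrary preferred chart
  \<open>q\<close> around \<open>k x\<close>; \<open>S\<close> converts from the chart preferred at
  \<open>k x\<close> to that one.\<close>

lemma has_mderiv_post:
  assumes k: "has_mderiv k x K" "continuous_on UNIV k" and q: "k x \<in> dom q"
    and F: "(F \<circ> par q has_derivative D) (at (coord q (k x)))"
  obtains S where "(coord q \<circ> par (k x) has_derivative S) (at (coord (k x) (k x)))"
    "S \<circ> frame q (k x) = id" "frame q (k x) \<circ> S = id"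
    "(F \<circ> k \<circ> par x has_derivative D \<circ> (S \<circ> K)) (at (coord x x))"
proof -
  obtain S where S: "(coord q \<circ> par (k x) has_derivative S) (at (coord (k x) (k x)))"
    "S \<circ> frame q (k x) = id" "frame q (k x) \<circ> S = id"
    using coframe_derivative[OF q] by blast
  have x: "par x (coord x x) = x" using chart_at par_coord by blast
  have kx: "par (k x) (coord (k x) (k x)) = k x" using chart_at par_coord by blast
  have 1: "((coord q \<circ> par (k x)) \<circ> (coord (k x) \<circ> k \<circ> par x) has_derivative S \<circ> K) (at (coord x x))"
    using k(1) S(1) unfolding has_mderiv_def by (intro diff_chain_at) (simp_all add: x)
  have 2: "((F \<circ> par q) \<circ> ((coord q \<circ> par (k x)) \<circ> (coord (k x) \<circ> k \<circ> par x)) has_derivative D \<circ> (S \<circ> K)) (at (coord x x))"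
    using F by (intro diff_chain_at[OF 1]) (simp add: x kx)
  have W: "open (img x \<inter> par x -` (k -` (dom (k x) \<inter> dom q)))"
    using k(2) open_dom by (intro open_par_vimage open_vimage) auto
  have "(F \<circ> k \<circ> par x has_derivative D \<circ> (S \<circ> K)) (at (coord x x))"
    by (rule has_derivative_transform_within_open[OF 2 W])
      (use q chart_at in \<open>auto simp: coord_in_img par_coord\<close>)
  with S show ?thesis using that by blast
qed

lemma has_mderiv_comp:
  assumes k: "has_mderiv k x K" "continuous_on UNIV k" and f: "has_mderiv f (k x) F"
  shows "has_mderiv (f \<circ> k) x (F \<circ> K)"
proof -
  have "(coord (f (k x)) \<circ> f \<circ> par (k x) has_derivative F) (at (coord (k x) (k x)))"
    using f by (simp add: has_mderiv_def)
  then obtain S where S: "S \<circ> frame (k x) (k x) = id"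
    "(coord (f (k x)) \<circ> f \<circ> k \<circ> par x has_derivative F \<circ> (S \<circ> K)) (at (coord x x))"
    using has_mderiv_post[OF k chart_at(2)] by metis
  then show ?thesis unfolding has_mderiv_def frame_self by (simp add: o_assoc)
qed

lemma has_mderiv_id: "has_mderiv id x id"
proof -
  have "(id has_derivative id) (at (coord x x))" by (rule has_derivative_id)
  then show ?thesis
    unfolding has_mderiv_def
    by (rule has_derivative_transform_within_open[OF _ open_img[of x]])
      (use chart_at in \<open>auto simp: coord_in_img coord_par\<close>)
qed

lemma C1_map_continuous: "C1_map A f \<Longrightarrow> continuous_on UNIV f"
  by (simp add: C1_map_def)

lemma C1_map_Ck1:
  assumes f: "C1_map A f"
  shows "Ck_on 1 (coord y \<circ> f \<circ> par x) (img x \<inter> par x -` (f -` dom y))"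
  using f chart_at(1) unfolding C1_map_def coord_image[symmetric] by blast

lemma open_C1_vimage: "C1_map A f \<Longrightarrow> open (img x \<inter> par x -` (f -` dom y))"
  using open_dom by (intro open_par_vimage open_vimage C1_map_continuous) auto

lemma C1_map_mderiv:
  assumes f: "C1_map A f"
  shows "has_mderiv f x (manifold_deriv A f x)"
  unfolding has_mderiv_def manifold_deriv_def
  by (rule Ck_on_1[OF C1_map_Ck1[OF f]]) (simp add: coord_in_img par_coord chart_at)

lemma C1_map_strict_deriv:
  assumes f: "C1_map A f"
  shows "strict_deriv x (coord (f x) \<circ> f) (manifold_deriv A f x)"
  unfolding manifold_deriv_def
  by (rule strict_deriv_Ck1[OF C1_map_Ck1[OF f] open_C1_vimage[OF f]])
    (simp add: coord_in_img par_coord chart_at)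

lemma iterate_mderiv:
  assumes f: "C1_map A f"
  shows "has_mderiv (f ^^ n) x (manifold_deriv A (f ^^ n) x)"
    and "manifold_deriv A (f ^^ 0) x = id"
    and "manifold_deriv A (f ^^ Suc n) x = manifold_deriv A f ((f ^^ n) x) \<circ> manifold_deriv A (f ^^ n) x"
proof -
  have start: "has_mderiv (f ^^ 0) x id" for x using has_mderiv_id by (simp add: id_def)
  then show "manifold_deriv A (f ^^ 0) x = id" by (rule has_mderiv_eq)
  note cont = iterate_continuous[OF C1_map_continuous[OF f]]
  have 1: "has_mderiv (f ^^ n) x (manifold_deriv A (f ^^ n) x)" for n
  proof (induction n)
    case 0 show ?case unfolding has_mderiv_eq[OF start] by (rule start)
  next
    case (Suc n)
    have "has_mderiv (f ^^ Suc n) x (manifold_deriv A f ((f ^^ n) x) \<circ> manifold_deriv A (f ^^ n) x)"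
      unfolding funpow.simps by (intro has_mderiv_comp Suc cont C1_map_mderiv f)
    then show ?case using has_mderiv_eq by metis
  qed
  then show "has_mderiv (f ^^ n) x (manifold_deriv A (f ^^ n) x)" .
  have "has_mderiv (f ^^ Suc n) x (manifold_deriv A f ((f ^^ n) x) \<circ> manifold_deriv A (f ^^ n) x)"
    unfolding funpow.simps by (intro has_mderiv_comp 1 cont C1_map_mderiv f)
  then show "manifold_deriv A (f ^^ Suc n) x = manifold_deriv A f ((f ^^ n) x) \<circ> manifold_deriv A (f ^^ n) x"
    by (rule has_mderiv_eq)
qed

lemma iterate_mderiv_add:
  assumes f: "C1_map A f"
  shows "manifold_deriv A (f ^^ (n + m)) x = manifold_deriv A (f ^^ m) ((f ^^ n) x) \<circ> manifold_deriv A (f ^^ n) x"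
proof (induction m)
  case 0
  show ?case using iterate_mderiv(2)[OF f] by (simp add: id_def)
next
  case (Suc m)
  have "(f ^^ (n + m)) x = (f ^^ m) ((f ^^ n) x)" by (simp add: add.commute[of n] funpow_add)
  then show ?case using iterate_mderiv(3)[OF f] Suc by (simp add: o_assoc del: funpow.simps)
qed

end

section \<open>Embedded manifolds\<close>

text \<open>A Lebesgue number argument. The relation carries the radius as a parameter, so one
  number can also be the size of a perturbation or, as \<open>1/d\<close>, a constant; monotonicity
  allows passing to the minimum over a finite cover.\<close>

lemma compact_local_uniform:
  fixes K :: "'m::metric_space set"
  assumes K: "compact K" and loc: "\<forall>x\<in>K. \<exists>d>0. \<forall>y\<in>ball x d. \<forall>z\<in>ball x d. R d y z"
    and mono: "\<forall>d d' y z. R d y z \<longrightarrow> 0 < d' \<longrightarrow> d' \<le> d \<longrightarrow> R d' y z"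
  shows "\<exists>d>0. \<forall>x\<in>K. \<forall>y\<in>ball x d. \<forall>z\<in>ball x d. R (d::real) y z"
proof -
  obtain \<delta> where \<delta>: "\<And>x. x \<in> K \<Longrightarrow> \<delta> x > 0"
    "\<And>x y z. x \<in> K \<Longrightarrow> y \<in> ball x (\<delta> x) \<Longrightarrow> z \<in> ball x (\<delta> x) \<Longrightarrow> R (\<delta> x) y z"
    using loc by metis
  have "K \<subseteq> (\<Union>x\<in>K. ball x (\<delta> x / 2))" using \<delta>(1) by force
  then obtain D where D: "D \<subseteq> K" "finite D" "K \<subseteq> (\<Union>x\<in>D. ball x (\<delta> x / 2))"
    using compactE_image[OF K, of K "\<lambda>x. ball x (\<delta> x / 2)"] by blast
  \<comment> \<open>Half the least radius: a ball of radius \<open>d\<close> whose centre lies in a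
    half ball of the cover stays inside the full ball.\<close>
  define d where "d = Min (insert 1 (\<delta> ` D)) / 2"
  have d0: "d > 0" using D \<delta>(1) by (auto simp: d_def)
  have d: "d \<le> \<delta> x / 2" if "x \<in> D" for x
  proof -
    have "Min (insert 1 (\<delta> ` D)) \<le> \<delta> x" using that D(2) by (intro Min_le) auto
    then show ?thesis by (simp add: d_def)
  qed
  show ?thesis
  proof (intro exI[of _ d] conjI d0 ballI)
    fix x y z assume x: "x \<in> K" and yz: "y \<in> ball x d" "z \<in> ball x d"
    obtain c where c: "c \<in> D" "x \<in> ball c (\<delta> c / 2)" using D(3) x by blast
    have "ball x d \<subseteq> ball c (\<delta> c)"
    proof
      fix p assume "p \<in> ball x d"
      then show "p \<in> ball c (\<delta> c)"
        using c(2) d[OF c(1)] dist_triangle[of c p x] by (simp add: dist_commute)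
    qed
    then have "R (\<delta> c) y z" using yz c D(1) by (intro \<delta>(2)) auto
    moreover have "d \<le> \<delta> c" using d[OF c(1)] \<delta>(1)[of c] c(1) D(1) by (auto simp: subset_iff)
    ultimately show "R d y z" using mono d0 by blast
  qed
qed

lemma linear_bound_pos:
  assumes "linear (f :: 'a::euclidean_space \<Rightarrow> 'b::real_normed_vector)"
  obtains B where "B > 0" "\<And>w. norm (f w) \<le> B * norm w"
  using linear_bounded_pos[OF assms] by blast

context riemannian_manifold
begin

lemma strict_deriv_linear: "strict_deriv x F D \<Longrightarrow> linear D"
  by (simp add: strict_deriv_def)

lemma strict_deriv_compose:
  fixes F :: "'m \<Rightarrow> 'v::real_normed_vector"
  assumes f: "strict_deriv x (coord (f x) \<circ> f) L" "continuous_on UNIV f" and F: "strict_deriv (f x) F D"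
  shows "strict_deriv x (F \<circ> f) (D \<circ> L)"
  unfolding strict_deriv_def
proof (intro conjI allI impI)
  note L = strict_deriv_linear[OF f(1)] and D = strict_deriv_linear[OF F]
  show "linear (D \<circ> L)" by (rule linear_compose[OF L D])
  fix \<epsilon> :: real assume \<epsilon>: "\<epsilon> > 0"
  obtain C where C: "C > 0" "\<And>w. norm (D w) \<le> C * norm w" using linear_bound_pos[OF D] by blast
  obtain \<Lambda> where \<Lambda>: "\<Lambda> > 0" "\<And>w. norm (L w) \<le> \<Lambda> * norm w" using linear_bound_pos[OF L] by blast
  \<comment> \<open>The total error is halved: \<epsilon>1 is the error of \<open>f\<close>,
    amplified by the norm bound \<open>C\<close> of \<open>D\<close>, and \<epsilon>2 the error of
    \<open>F\<close>, amplified by a Lipschitz constant of \<open>f\<close>. The cap at 1 makes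
    \<open>\<Lambda> + 1\<close> such a constant.\<close>
  define \<epsilon>1 where "\<epsilon>1 = min 1 (\<epsilon> / (2 * C))"
  define \<epsilon>2 where "\<epsilon>2 = \<epsilon> / (2 * (\<Lambda> + 1))"
  have e: "\<epsilon>1 > 0" "\<epsilon>2 > 0" "\<epsilon>1 \<le> 1" "C * \<epsilon>1 \<le> \<epsilon> / 2" "\<epsilon>2 * (\<Lambda> + 1) = \<epsilon> / 2"
    using \<epsilon> C \<Lambda> by (auto simp: \<epsilon>1_def \<epsilon>2_def min_def field_simps add_pos_pos)
  obtain d1 where d1: "d1 > 0" "\<And>y z. y \<in> ball x d1 \<Longrightarrow> z \<in> ball x d1 \<Longrightarrow>
      norm ((coord (f x) \<circ> f) z - (coord (f x) \<circ> f) y - L (disp x y z)) \<le> \<epsilon>1 * norm (disp x y z)"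
    using strict_derivD[OF f(1) e(1)] by blast
  obtain d2 where d2: "d2 > 0" "\<And>y z. y \<in> ball (f x) d2 \<Longrightarrow> z \<in> ball (f x) d2 \<Longrightarrow>
      norm (F z - F y - D (disp (f x) y z)) \<le> \<epsilon>2 * norm (disp (f x) y z)"
    using strict_derivD[OF F e(2)] by blast
  have "open (f -` ball (f x) d2)" using f(2) by (intro open_vimage) auto
  then obtain d3 where d3: "d3 > 0" "ball x d3 \<subseteq> f -` ball (f x) d2"
    using d2(1) by (metis centre_in_ball open_contains_ball vimageI)
  have "norm ((F \<circ> f) z - (F \<circ> f) y - (D \<circ> L) (disp x y z)) \<le> \<epsilon> * norm (disp x y z)"
    if "y \<in> ball x (min d1 d3)" "z \<in> ball x (min d1 d3)" for y z
  proof -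
    let ?w = "disp x y z" and ?w' = "disp (f x) (f y) (f z)"
    have 1: "norm (?w' - L ?w) \<le> \<epsilon>1 * norm ?w" using d1(2)[of y z] that by simp
    have "f y \<in> ball (f x) d2" "f z \<in> ball (f x) d2" using d3(2) that by auto
    then have 2: "norm (F (f z) - F (f y) - D ?w') \<le> \<epsilon>2 * norm ?w'" by (rule d2(2))
    have "norm ?w' \<le> norm (?w' - L ?w) + norm (L ?w)" by (metis add.commute diff_add_cancel norm_triangle_ineq)
    also have "\<dots> \<le> (\<Lambda> + 1) * norm ?w"
      using 1 \<Lambda>(2)[of ?w] mult_right_mono[OF e(3), of "norm ?w"] by (simp add: distrib_right)
    finally have 3: "\<epsilon>2 * norm ?w' \<le> \<epsilon>2 * ((\<Lambda> + 1) * norm ?w)" using e(2) by simp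
    have "norm (D (?w' - L ?w)) \<le> C * norm (?w' - L ?w)" by (rule C(2))
    also have "\<dots> \<le> C * (\<epsilon>1 * norm ?w)" using 1 C(1) by simp
    also have "\<dots> \<le> \<epsilon> / 2 * norm ?w" using mult_right_mono[OF e(4), of "norm ?w"] by (simp add: mult.assoc)
    finally have 4: "norm (D (?w' - L ?w)) \<le> \<epsilon> / 2 * norm ?w" .
    have 5: "\<epsilon>2 * ((\<Lambda> + 1) * norm ?w) = \<epsilon> / 2 * norm ?w" using e(5) by (metis mult.assoc)
    have "F (f z) - F (f y) - D (L ?w) = (F (f z) - F (f y) - D ?w') + D (?w' - L ?w)"
      by (simp add: linear_diff[OF D])
    then have "norm (F (f z) - F (f y) - D (L ?w)) \<le> norm (F (f z) - F (f y) - D ?w') + norm (D (?w' - L ?w))"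
      by (metis norm_triangle_ineq)
    then show ?thesis using 2 3 4 5 by (simp add: algebra_simps)
  qed
  then show "\<exists>d>0. \<forall>y\<in>ball x d. \<forall>z\<in>ball x d. norm ((F \<circ> f) z - (F \<circ> f) y - (D \<circ> L) (disp x y z)) \<le> \<epsilon> * norm (disp x y z)"
    using d1(1) d3(1) by (intro exI[of _ "min d1 d3"]) auto
qed

lemma strict_deriv_diff:
  fixes F G :: "'m \<Rightarrow> 'v::real_normed_vector"
  assumes F: "strict_deriv x F D" and G: "strict_deriv x G E"
  shows "strict_deriv x (\<lambda>y. F y - G y) (\<lambda>w. D w - E w)"
  unfolding strict_deriv_def
proof (intro conjI allI impI)
  show "linear (\<lambda>w. D w - E w)"
    by (intro linear_compose_sub strict_deriv_linear[OF F] strict_deriv_linear[OF G])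
  fix \<epsilon> :: real assume "\<epsilon> > 0"
  then have e: "\<epsilon> / 2 > 0" by simp
  obtain d1 where d1: "d1 > 0" "\<And>y z. y \<in> ball x d1 \<Longrightarrow> z \<in> ball x d1 \<Longrightarrow> norm (F z - F y - D (disp x y z)) \<le> \<epsilon>/2 * norm (disp x y z)"
    using strict_derivD[OF F e] by blast
  obtain d2 where d2: "d2 > 0" "\<And>y z. y \<in> ball x d2 \<Longrightarrow> z \<in> ball x d2 \<Longrightarrow> norm (G z - G y - E (disp x y z)) \<le> \<epsilon>/2 * norm (disp x y z)"
    using strict_derivD[OF G e] by blast
  have "norm (F z - G z - (F y - G y) - (D (disp x y z) - E (disp x y z))) \<le> \<epsilon> * norm (disp x y z)"
    if "y \<in> ball x (min d1 d2)" "z \<in> ball x (min d1 d2)" for y z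
  proof -
    have "F z - G z - (F y - G y) - (D (disp x y z) - E (disp x y z)) =
        (F z - F y - D (disp x y z)) - (G z - G y - E (disp x y z))" by simp
    then have "norm (F z - G z - (F y - G y) - (D (disp x y z) - E (disp x y z))) \<le>
        norm (F z - F y - D (disp x y z)) + norm (G z - G y - E (disp x y z))"
      by (metis norm_triangle_ineq4)
    then show ?thesis using d1(2)[of y z] d2(2)[of y z] that by simp
  qed
  then show "\<exists>d>0. \<forall>y\<in>ball x d. \<forall>z\<in>ball x d. norm (F z - G z - (F y - G y) - (D (disp x y z) - E (disp x y z))) \<le> \<epsilon> * norm (disp x y z)"
    using d1(1) d2(1) by (intro exI[of _ "min d1 d2"]) auto
qed

end

locale embedded_manifold = riemannian_manifold A g
  for A :: "('m::metric_space, 'e::euclidean_space) chart set" and g +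
  fixes \<iota> :: "'m \<Rightarrow> 'b::euclidean_space"
  assumes embedding: "smooth_embedding A \<iota>"
begin

abbreviation Demb :: "'m \<Rightarrow> 'e \<Rightarrow> 'b" where "Demb \<equiv> vector_deriv A \<iota>"

lemma embedding_inj: "\<iota> y = \<iota> z \<longleftrightarrow> y = z"
  using embedding by (auto simp: smooth_embedding_def inj_eq)

lemma embedding_smooth: "smooth_on (\<iota> \<circ> par x) (img x)"
  using embedding chart_at(1) by (auto simp: smooth_embedding_def)

lemma embedding_derivative: "(\<iota> \<circ> par x has_derivative Demb x) (at (coord x x))"
  unfolding vector_deriv_def using embedding_smooth[of x] coord_in_img[OF chart_at(2)]
  by (intro Ck_on_1[of _ "img x"]) (auto simp: smooth_on_def)

lemma embedding_strict_deriv: "strict_deriv x \<iota> (Demb x)"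
  unfolding vector_deriv_def using embedding_smooth[of x] coord_in_img[OF chart_at(2)] open_img
  by (intro strict_deriv_Ck1[of _ _ "img x"]) (auto simp: smooth_on_def)

lemma embedding_deriv_linear: "linear (Demb x)"
  by (rule strict_deriv_linear[OF embedding_strict_deriv])

lemma embedding_continuous: "continuous_on UNIV \<iota>"
proof -
  have "isCont \<iota> x" for x
  proof -
    have "Ck_on 0 (\<iota> \<circ> par x) (img x)" using embedding_smooth unfolding smooth_on_def by blast
    then have "continuous_on (img x) (\<iota> \<circ> par x)" by simp
    then have "continuous_on (dom x) (\<lambda>y. (\<iota> \<circ> par x) (coord x y))"
      by (rule continuous_on_compose2[OF _ continuous_coord]) (auto simp: coord_in_img)
    then have "continuous_on (dom x) \<iota>" by (rule continuous_on_eq) (simp add: par_coord)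
    then show ?thesis using open_dom chart_at(2) continuous_on_eq_continuous_at by blast
  qed
  then show ?thesis by (simp add: continuous_at_imp_continuous_on)
qed

lemma embedding_dist:
  assumes "\<eta> > 0"
  obtains \<delta> where "\<delta> > 0" "\<And>y z. norm (\<iota> y - \<iota> z) < \<delta> \<Longrightarrow> dist y z < \<eta>"
proof -
  have c: "compact (range \<iota>)" using compact_continuous_image[OF embedding_continuous compact_manifold] .
  have "continuous_on (range \<iota>) (inv_into UNIV \<iota>)"
    by (rule continuous_on_inv[OF embedding_continuous compact_manifold]) (auto simp: inj_def embedding_inj)
  then have "uniformly_continuous_on (range \<iota>) (inv_into UNIV \<iota>)" using c by (rule compact_uniformly_continuous)
  then obtain \<delta> where "\<delta> > 0" "\<And>u v. u \<in> range \<iota> \<Longrightarrow> v \<in> range \<iota> \<Longrightarrow> dist u v < \<delta> \<Longrightarrow> dist (inv_into UNIV \<iota> u) (inv_into UNIV \<iota> v) < \<eta>"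
    using assms unfolding uniformly_continuous_on_def by metis
  moreover have "inv_into UNIV \<iota> (\<iota> y) = y" for y by (simp add: inv_f_f inj_def embedding_inj)
  ultimately show ?thesis using that[of \<delta>] by (metis dist_norm rangeI)
qed

text \<open>Near each point injectivity of the derivative there gives both bounds, transported by
  \<open>frame\<close>. Compactness makes them uniform, with \<open>1/d\<close> in the place of the
  constant.\<close>

lemma embedding_deriv_bounds_ex:
  "\<exists>B\<ge>1. \<forall>x v. tnorm g x v \<le> B * norm (Demb x v) \<and> norm (Demb x v) \<le> B * tnorm g x v"
proof -
  define R where "R d y z \<longleftrightarrow> (\<forall>v. tnorm g y v \<le> (1/d) * norm (Demb y v) \<and> norm (Demb y v) \<le> (1/d) * tnorm g y v)"
    for d :: real and y z :: 'm
  have loc: "\<forall>x\<in>UNIV. \<exists>d>0. \<forall>y\<in>ball x d. \<forall>z\<in>ball x d. R d y z"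
  proof
    fix x
    obtain d1 where d1: "d1 > 0" "ball x d1 \<subseteq> dom x"
      "\<And>y w. y \<in> ball x d1 \<Longrightarrow> tnorm g x w \<le> 2 * tnorm g y (frame x y w)"
      "\<And>y w. y \<in> ball x d1 \<Longrightarrow> tnorm g y (frame x y w) \<le> 2 * tnorm g x w"
      using tnorm_frame[of 2 x] by auto
    obtain \<beta> B where B: "\<beta> > 0" "B > 0" "\<And>w. \<beta> * norm w \<le> tnorm g x w" "\<And>w. tnorm g x w \<le> B * norm w"
      using tnorm_bounds[of x] by metis
    have "inj (Demb x)" using embedding by (auto simp: smooth_embedding_def)
    then obtain c where c: "c > 0" "\<And>w. c * norm w \<le> norm (Demb x w)"
      using linear_inj_bounded_below_pos[OF embedding_deriv_linear] by metis
    obtain C where C: "C > 0" "\<And>w. norm (Demb x w) \<le> C * norm w"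
      using linear_bound_pos[OF embedding_deriv_linear] by blast
    obtain d2 where d2: "d2 > 0" "\<And>y z. y \<in> ball x d2 \<Longrightarrow> z \<in> ball x d2 \<Longrightarrow>
        norm (\<iota> z - \<iota> y - Demb x (disp x y z)) \<le> c/2 * norm (disp x y z)"
      using strict_derivD[OF embedding_strict_deriv, of "c/2" x] c(1) by auto
    \<comment> \<open>The last two entries make \<open>1/d\<close> exceed the two comparison
      constants.\<close>
    define d where "d = Min {d1, d2, c / (4 * B), \<beta> / (2 * (C + c/2))}"
    have d: "d > 0" "d \<le> d1" "d \<le> d2" "d \<le> c / (4 * B)" "d \<le> \<beta> / (2 * (C + c/2))"
      using d1 d2 c B C by (auto simp: d_def)
    have "R d y z" if y: "y \<in> ball x d" for y z
      unfolding R_def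
    proof
      fix v
      have y12: "y \<in> ball x d1" "y \<in> ball x d2" using y d by auto
      have sub: "ball x d \<subseteq> dom x" using d d1(2) by auto
      obtain w where w: "v = frame x y w" using frame_bij[of y x] y12 d1(2) by (metis bij_pointE subsetD)
      have *: "norm (Demb y v - Demb x w) \<le> c/2 * norm w"
        unfolding w
        by (rule lipschitz_deriv[OF sub y embedding_deriv_linear _ embedding_derivative])
          (use d2(2) y12 d in auto)
      have lo: "c/2 * norm w \<le> norm (Demb y v)"
        using * c(2)[of w] norm_triangle_ineq3[of "Demb y v" "Demb x w"] by (simp add: field_simps)
      have hi: "norm (Demb y v) \<le> (C + c/2) * norm w"
        using * C(2)[of w] norm_triangle_ineq3[of "Demb y v" "Demb x w"] by (simp add: algebra_simps)
      have "tnorm g y v \<le> 2 * (B * norm w)" using d1(4)[OF y12(1), of w] B(4)[of w] unfolding w by linarith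
      then have "d * tnorm g y v \<le> c / (4 * B) * (2 * (B * norm w))"
        using d c B(1,2) tnorm_nonneg by (intro mult_mono) auto
      also have "\<dots> \<le> norm (Demb y v)" using lo B by simp
      finally have 1: "tnorm g y v \<le> (1/d) * norm (Demb y v)" using d(1) by (simp add: field_simps)
      have "d * norm (Demb y v) \<le> \<beta> / (2 * (C + c/2)) * ((C + c/2) * norm w)"
        using d hi c B C by (intro mult_mono) auto
      also have "\<dots> = \<beta> * norm w / 2" using C c by (simp add: field_simps)
      also have "\<dots> \<le> tnorm g y v" using B(3)[of w] d1(3)[OF y12(1), of w] w by simp
      finally have 2: "norm (Demb y v) \<le> (1/d) * tnorm g y v" using d(1) by (simp add: field_simps)
      show "tnorm g y v \<le> (1/d) * norm (Demb y v) \<and> norm (Demb y v) \<le> (1/d) * tnorm g y v" using 1 2 by simp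
    qed
    then show "\<exists>d>0. \<forall>y\<in>ball x d. \<forall>z\<in>ball x d. R d y z" using d(1) by blast
  qed
  have mono: "\<forall>d d' y z. R d y z \<longrightarrow> 0 < d' \<longrightarrow> d' \<le> d \<longrightarrow> R d' y z"
  proof (intro allI impI)
    fix d d' y z assume R: "R d y z" "0 < d'" "d' \<le> d"
    have "1/d \<le> 1/d'" using R by (simp add: frac_le)
    then show "R d' y z"
      using R(1) tnorm_nonneg unfolding R_def by (meson mult_right_mono norm_ge_zero order_trans)
  qed
  obtain d where d: "d > 0" "\<forall>x\<in>UNIV. \<forall>y\<in>ball x d. \<forall>z\<in>ball x d. R d y z"
    using compact_local_uniform[OF compact_manifold loc mono] by blast
  have "tnorm g x v \<le> (max 1 (1/d)) * norm (Demb x v) \<and> norm (Demb x v) \<le> (max 1 (1/d)) * tnorm g x v" for x v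
    using d tnorm_nonneg[of x v] mult_right_mono[of "1/d" "max 1 (1/d)" "norm (Demb x v)"]
      mult_right_mono[of "1/d" "max 1 (1/d)" "tnorm g x v"]
    unfolding R_def by (meson UNIV_I centre_in_ball max.cobounded2 norm_ge_zero order_trans)
  then show ?thesis by (intro exI[of _ "max 1 (1/d)"]) auto
qed

definition Cemb :: real where
  "Cemb = (SOME B. B \<ge> 1 \<and> (\<forall>x v. tnorm g x v \<le> B * norm (Demb x v) \<and> norm (Demb x v) \<le> B * tnorm g x v))"

lemma Cemb: "Cemb \<ge> 1" "tnorm g x v \<le> Cemb * norm (Demb x v)" "norm (Demb x v) \<le> Cemb * tnorm g x v"
  using someI_ex[OF embedding_deriv_bounds_ex[unfolded Bex_def]] unfolding Cemb_def by auto

text \<open>A substitute for the Riemannian distance: near every point it agrees, up to a factor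
  arbitrarily close to 1, with the norm of displacements in the preferred chart
  (\<open>Q_local\<close>), and globally it is equivalent to the distance in the ambient space.\<close>

definition Q :: "'m \<Rightarrow> 'm \<Rightarrow> real" where
  "Q y z = (INF v. tnorm g y v + Cemb * norm (\<iota> z - \<iota> y - Demb y v))"

lemma Q_lower: "Q y z \<le> tnorm g y v + Cemb * norm (\<iota> z - \<iota> y - Demb y v)"
  unfolding Q_def using Cemb(1) tnorm_nonneg
  by (intro cINF_lower bdd_belowI2[of _ 0] add_nonneg_nonneg mult_nonneg_nonneg) auto

lemma Q_greatest: "(\<And>v. c \<le> tnorm g y v + Cemb * norm (\<iota> z - \<iota> y - Demb y v)) \<Longrightarrow> c \<le> Q y z"
  unfolding Q_def by (intro cINF_greatest) auto

lemma Q_le: "Q y z \<le> Cemb * norm (\<iota> z - \<iota> y)"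
  using Q_lower[of y z 0] linear_0[OF embedding_deriv_linear] by simp

lemma Q_ge: "norm (\<iota> z - \<iota> y) \<le> Cemb * Q y z"
proof -
  have "norm (\<iota> z - \<iota> y) / Cemb \<le> Q y z"
  proof (rule Q_greatest)
    fix v
    have "norm (\<iota> z - \<iota> y) \<le> norm (Demb y v) + norm (\<iota> z - \<iota> y - Demb y v)"
      by (metis add.commute diff_add_cancel norm_triangle_ineq)
    also have "\<dots> \<le> Cemb * tnorm g y v + Cemb * (Cemb * norm (\<iota> z - \<iota> y - Demb y v))"
    proof (intro add_mono Cemb)
      have "1 * norm (\<iota> z - \<iota> y - Demb y v) \<le> (Cemb * Cemb) * norm (\<iota> z - \<iota> y - Demb y v)"
        using Cemb(1) mult_mono[of 1 Cemb 1 Cemb] by (intro mult_right_mono) auto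
      then show "norm (\<iota> z - \<iota> y - Demb y v) \<le> Cemb * (Cemb * norm (\<iota> z - \<iota> y - Demb y v))" by (simp add: mult.assoc)
    qed
    finally show "norm (\<iota> z - \<iota> y) / Cemb \<le> tnorm g y v + Cemb * norm (\<iota> z - \<iota> y - Demb y v)"
      using Cemb(1) by (simp add: field_simps)
  qed
  then show ?thesis using Cemb(1) by (simp add: field_simps)
qed

lemma Q_nonneg: "0 \<le> Q y z"
  using Cemb(1) tnorm_nonneg by (intro Q_greatest) auto

lemma Q_self: "Q y y = 0"
  using Q_le[of y y] Q_nonneg[of y y] by simp

lemma Q_eq_0: "Q y z = 0 \<Longrightarrow> y = z"
  using Q_ge[of z y] by (simp add: embedding_inj)

lemma Q_dist:
  assumes "\<eta> > 0"
  obtains r where "r > 0" "\<And>y z. Q y z \<le> r \<Longrightarrow> dist y z < \<eta>"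
proof -
  obtain \<delta> where \<delta>: "\<delta> > 0" "\<And>y z. norm (\<iota> y - \<iota> z) < \<delta> \<Longrightarrow> dist y z < \<eta>"
    using embedding_dist[OF assms] by blast
  show ?thesis
  proof (rule that)
    show "\<delta> / (2 * Cemb) > 0" using \<delta> Cemb(1) by simp
    fix y z assume Q: "Q y z \<le> \<delta> / (2 * Cemb)"
    have "norm (\<iota> z - \<iota> y) \<le> Cemb * Q y z" by (rule Q_ge)
    also have "\<dots> \<le> Cemb * (\<delta> / (2 * Cemb))" using Cemb(1) by (intro mult_left_mono Q) auto
    also have "\<dots> < \<delta>" using \<delta> Cemb(1) by simp
    finally show "dist y z < \<eta>" using \<delta>(2)[of y z] by (simp add: norm_minus_commute)
  qed
qed

text \<open>Each term of the infimum is Lipschitz in \<open>\<iota> z\<close> with constant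
  \<open>Cemb\<close>, hence so is \<open>Q y\<close>. The second argument is the one that varies in
  the shadowing argument.\<close>

lemma Q_continuous: "continuous_on UNIV (Q y)"
proof -
  have 1: "Q y z \<le> Q y z' + Cemb * norm (\<iota> z - \<iota> z')" for z z'
  proof -
    have "Q y z - Cemb * norm (\<iota> z - \<iota> z') \<le> Q y z'"
    proof (rule Q_greatest)
      fix v
      have "norm (\<iota> z - \<iota> y - Demb y v) \<le> norm (\<iota> z' - \<iota> y - Demb y v) + norm (\<iota> z - \<iota> z')"
      proof -
        have "\<iota> z - \<iota> y - Demb y v = (\<iota> z' - \<iota> y - Demb y v) + (\<iota> z - \<iota> z')" by simp
        then show ?thesis by (metis norm_triangle_ineq)
      qed
      then have "Cemb * norm (\<iota> z - \<iota> y - Demb y v) \<le> Cemb * (norm (\<iota> z' - \<iota> y - Demb y v) + norm (\<iota> z - \<iota> z'))"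
        using Cemb(1) by (intro mult_left_mono) auto
      then show "Q y z - Cemb * norm (\<iota> z - \<iota> z') \<le> tnorm g y v + Cemb * norm (\<iota> z' - \<iota> y - Demb y v)"
        using Q_lower[of y z v] by (simp add: distrib_left)
    qed
    then show ?thesis by simp
  qed
  have "isCont (Q y) z" for z
    unfolding continuous_at
  proof (rule tendsto_sandwich)
    have c: "(\<iota> \<longlongrightarrow> \<iota> z) (at z)"
      using embedding_continuous by (simp add: continuous_on_def)
    have "((\<lambda>z'. Q y z - Cemb * norm (\<iota> z - \<iota> z')) \<longlongrightarrow> Q y z - Cemb * norm (\<iota> z - \<iota> z)) (at z)"
      by (intro tendsto_intros c)
    then show "((\<lambda>z'. Q y z - Cemb * norm (\<iota> z - \<iota> z')) \<longlongrightarrow> Q y z) (at z)" by simp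
    have "((\<lambda>z'. Q y z + Cemb * norm (\<iota> z' - \<iota> z)) \<longlongrightarrow> Q y z + Cemb * norm (\<iota> z - \<iota> z)) (at z)"
      by (intro tendsto_intros c)
    then show "((\<lambda>z'. Q y z + Cemb * norm (\<iota> z' - \<iota> z)) \<longlongrightarrow> Q y z) (at z)" by simp
  qed (use 1 in \<open>auto intro!: always_eventually simp: diff_le_eq\<close>)
  then show ?thesis by (simp add: continuous_at_imp_continuous_on)
qed

text \<open>For the upper bound the infimum is tested at the transported displacement. For the lower
  bound, shortening \<open>v\<close> does not pay: the factor \<open>Cemb\<close> in
  \<open>Q\<close> makes the penalty at least the \<open>tnorm\<close> of the missing part, up to
  linearization errors.\<close>

lemma Q_local:
  assumes a: "a > 1"
  obtains d where "d > 0"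
    "\<And>y z. y \<in> ball x d \<Longrightarrow> z \<in> ball x d \<Longrightarrow> tnorm g x (disp x y z) \<le> a * Q y z"
    "\<And>y z. y \<in> ball x d \<Longrightarrow> z \<in> ball x d \<Longrightarrow> Q y z \<le> a * tnorm g x (disp x y z)"
proof -
  \<comment> \<open>One factor \<open>a1\<close> is spent on comparing the metrics at
    \<open>x\<close> and \<open>y\<close>; what is left between \<open>a1\<close> and
    \<open>a\<close> absorbs two linearization errors of size \<theta>.\<close>
  define a1 where "a1 = sqrt a"
  have a1: "1 < a1" "a1 * a1 = a" using a by (auto simp: a1_def)
  have a1a: "a1 < a" using a1 mult_strict_left_mono[of 1 a1 a1] by simp
  have inv: "1/a < 1/a1" "1/a1 \<le> 1" "1/a > 0" using a a1 a1a by (auto simp: frac_less2)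
  define \<theta> where "\<theta> = min (a - a1) (1/a1 - 1/a) / 2"
  have th: "\<theta> > 0" "2 * \<theta> \<le> a - a1" "2 * \<theta> \<le> 1/a1 - 1/a" "\<theta> \<le> 1 / a1" "1/a1 \<le> 1"
  proof -
    show "\<theta> > 0" using inv a1a by (simp add: \<theta>_def)
    have 1: "\<theta> \<le> (a - a1) / 2" "\<theta> \<le> (1/a1 - 1/a) / 2" by (simp_all add: \<theta>_def)
    then show "2 * \<theta> \<le> a - a1" "2 * \<theta> \<le> 1/a1 - 1/a" by auto
    have "2 * \<theta> \<le> 1/a1 - 1/a" using 1(2) by simp
    also have "1/a1 - 1/a \<le> 1/a1" by (simp only: diff_le_eq le_add_same_cancel1 less_imp_le[OF inv(3)])
    finally have "2 * \<theta> \<le> 1/a1" .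
    then show "\<theta> \<le> 1/a1" using \<open>\<theta> > 0\<close> by linarith
    show "1/a1 \<le> 1" by (rule inv(2))
  qed
  obtain \<beta> B where \<beta>: "\<beta> > 0" "\<And>w. \<beta> * norm w \<le> tnorm g x w" using tnorm_bounds[of x] by metis
  define \<epsilon> where "\<epsilon> = \<theta> * \<beta> / Cemb"
  have \<epsilon>: "\<epsilon> > 0" using th \<beta> Cemb(1) by (simp add: \<epsilon>_def)
  obtain d1 where d1: "d1 > 0" "ball x d1 \<subseteq> dom x"
    "\<And>y w. y \<in> ball x d1 \<Longrightarrow> tnorm g x w \<le> a1 * tnorm g y (frame x y w)"
    "\<And>y w. y \<in> ball x d1 \<Longrightarrow> tnorm g y (frame x y w) \<le> a1 * tnorm g x w"
    using tnorm_frame[OF a1(1), of x] by auto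
  obtain d2 where d2: "d2 > 0" "\<And>y z. y \<in> ball x d2 \<Longrightarrow> z \<in> ball x d2 \<Longrightarrow>
      norm (\<iota> z - \<iota> y - Demb x (disp x y z)) \<le> \<epsilon> * norm (disp x y z)"
    using strict_derivD[OF embedding_strict_deriv \<epsilon>, of x] by auto
  define d where "d = min d1 d2"
  have d: "ball x d \<subseteq> dom x" using d1 by (auto simp: d_def)
  have eps: "Cemb * (\<epsilon> * norm w) \<le> \<theta> * tnorm g x w" for w
    using \<beta> th Cemb(1) mult_left_mono[OF \<beta>(2)[of w], of \<theta>] by (simp add: \<epsilon>_def algebra_simps)
  have 1: "Cemb * norm (\<iota> z - \<iota> y - Demb x (disp x y z)) \<le> \<theta> * tnorm g x (disp x y z)"
    if "y \<in> ball x d" "z \<in> ball x d" for y z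
  proof -
    have "norm (\<iota> z - \<iota> y - Demb x (disp x y z)) \<le> \<epsilon> * norm (disp x y z)"
      using that by (intro d2(2)) (auto simp: d_def)
    from mult_left_mono[OF this, of Cemb] show ?thesis using Cemb(1) eps[of "disp x y z"] by linarith
  qed
  have 2: "Cemb * norm (Demb y (frame x y w) - Demb x w) \<le> \<theta> * tnorm g x w" if "y \<in> ball x d" for y w
  proof -
    have "norm (Demb y (frame x y w) - Demb x w) \<le> \<epsilon> * norm w"
      by (rule lipschitz_deriv[OF d that embedding_deriv_linear _ embedding_derivative])
        (use d2(2) that in \<open>auto simp: d_def\<close>)
    from mult_left_mono[OF this, of Cemb] show ?thesis using Cemb(1) eps[of w] by linarith
  qed
  show ?thesis
  proof (rule that)
    show "d > 0" using d1 d2 by (simp add: d_def)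
    fix y z assume yz: "y \<in> ball x d" "z \<in> ball x d"
    then have y1: "y \<in> ball x d1" by (simp add: d_def)
    let ?w = "disp x y z" and ?N = "tnorm g x"
    have "norm (\<iota> z - \<iota> y - Demb y (frame x y ?w)) \<le> norm (\<iota> z - \<iota> y - Demb x ?w) + norm (Demb y (frame x y ?w) - Demb x ?w)"
      using norm_triangle_ineq4[of "\<iota> z - \<iota> y - Demb x ?w" "Demb y (frame x y ?w) - Demb x ?w"] by simp
    then have "Cemb * norm (\<iota> z - \<iota> y - Demb y (frame x y ?w)) \<le>
        Cemb * (norm (\<iota> z - \<iota> y - Demb x ?w) + norm (Demb y (frame x y ?w) - Demb x ?w))"
      using Cemb(1) by (intro mult_left_mono) auto
    then have "Q y z \<le> a1 * ?N ?w + 2 * \<theta> * ?N ?w"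
      using Q_lower[of y z "frame x y ?w"] d1(4)[OF y1, of ?w] 1[OF yz] 2[OF yz(1), of ?w]
      by (simp add: distrib_left)
    also have "\<dots> \<le> a * ?N ?w"
      using mult_right_mono[OF th(2) tnorm_nonneg, of x ?w] by (simp add: left_diff_distrib)
    finally show "Q y z \<le> a * ?N ?w" .
    \<comment> \<open>An arbitrary test vector is the transport of some \<open>w\<close>. The
      displacement is split into \<open>w\<close>, measured by the first term of \<open>Q\<close>,
      and the rest, measured by the penalty.\<close>
    have "?N ?w / a \<le> Q y z"
    proof (rule Q_greatest)
      fix v
      have "y \<in> dom x" using d1 y1 by blast
      then obtain w where w: "v = frame x y w" using frame_bij[of y x] by (metis bij_pointE)
      have eq: "Demb x (?w - w) = (\<iota> z - \<iota> y - Demb y v) + (Demb y (frame x y w) - Demb x w) - (\<iota> z - \<iota> y - Demb x ?w)"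
        by (simp add: linear_diff[OF embedding_deriv_linear] w)
      have "norm (Demb x (?w - w)) \<le> norm (\<iota> z - \<iota> y - Demb y v) + norm (Demb y (frame x y w) - Demb x w) + norm (\<iota> z - \<iota> y - Demb x ?w)"
        unfolding eq using norm_triangle_ineq4[of "(\<iota> z - \<iota> y - Demb y v) + (Demb y (frame x y w) - Demb x w)" "\<iota> z - \<iota> y - Demb x ?w"]
          norm_triangle_ineq[of "\<iota> z - \<iota> y - Demb y v" "Demb y (frame x y w) - Demb x w"] by linarith
      then have "Cemb * norm (Demb x (?w - w)) \<le> Cemb * (norm (\<iota> z - \<iota> y - Demb y v) + norm (Demb y (frame x y w) - Demb x w) + norm (\<iota> z - \<iota> y - Demb x ?w))"
        using Cemb(1) by (intro mult_left_mono) auto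
      then have 3: "?N (?w - w) \<le> Cemb * norm (\<iota> z - \<iota> y - Demb y v) + \<theta> * ?N w + \<theta> * ?N ?w"
        using Cemb(2)[of x "?w - w"] 1[OF yz] 2[OF yz(1), of w] by (simp add: distrib_left)
      have 4: "?N w / a1 \<le> tnorm g y v" using d1(3)[OF y1, of w] a1 w by (simp add: field_simps)
      have "?N ?w / a \<le> (1/a1 - 2 * \<theta>) * ?N ?w"
        using mult_right_mono[OF th(3) tnorm_nonneg, of x ?w] by (simp add: left_diff_distrib)
      also have "\<dots> \<le> (1/a1 - \<theta>) * (?N w + ?N (?w - w)) - \<theta> * ?N ?w"
        using tnorm_triangle[of x w "?w - w"] th(4) mult_left_mono[of "?N ?w" "?N w + ?N (?w - w)" "1/a1 - \<theta>"]
        by (simp add: left_diff_distrib)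
      also have "\<dots> \<le> (1/a1 - \<theta>) * ?N w + ?N (?w - w) - \<theta> * ?N ?w"
        using mult_right_mono[of "1/a1 - \<theta>" 1 "?N (?w - w)"] th tnorm_nonneg by (simp add: distrib_left)
      also have "\<dots> \<le> tnorm g y v + Cemb * norm (\<iota> z - \<iota> y - Demb y v)"
        using 3 4 by (simp add: left_diff_distrib)
      finally show "?N ?w / a \<le> tnorm g y v + Cemb * norm (\<iota> z - \<iota> y - Demb y v)" .
    qed
    then show "?N ?w \<le> a * Q y z" using a by (simp add: field_simps)
  qed
qed

end

section \<open>Maps that are close in the \<open>C\<^sup>1\<close> distance\<close>

context embedded_manifold
begin

lemma C1_difference_derivative:
  assumes f: "C1_map A f" and h: "C1_map A h"
  shows "((\<lambda>x. \<iota> (f x) - \<iota> (h x)) \<circ> par y has_derivative vector_deriv A (\<lambda>x. \<iota> (f x) - \<iota> (h x)) y) (at (coord y y))"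
proof -
  have "\<exists>D. (\<iota> \<circ> k \<circ> par y has_derivative D) (at (coord y y))" if k: "C1_map A k" for k
    using has_mderiv_post[OF C1_map_mderiv[OF k] C1_map_continuous[OF k] chart_at(2) embedding_derivative]
    by metis
  then obtain D E where "(\<iota> \<circ> f \<circ> par y has_derivative D) (at (coord y y))"
    "(\<iota> \<circ> h \<circ> par y has_derivative E) (at (coord y y))" using f h by metis
  then have "((\<lambda>u. (\<iota> \<circ> f \<circ> par y) u - (\<iota> \<circ> h \<circ> par y) u) has_derivative (\<lambda>w. D w - E w)) (at (coord y y))"
    by (rule has_derivative_diff)
  then have D: "((\<lambda>x. \<iota> (f x) - \<iota> (h x)) \<circ> par y has_derivative (\<lambda>w. D w - E w)) (at (coord y y))"
    by (simp add: o_def)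
  show ?thesis unfolding vector_deriv_def frechet_derivative_at[OF D, symmetric] by (rule D)
qed

text \<open>Ensures that the supremum in \<open>C1_norm\<close> is taken over a bounded set;
  otherwise a small \<open>C1_dist\<close> would carry no information.\<close>

lemma C1_difference_deriv_bounded:
  assumes f: "C1_map A f" and h: "C1_map A h"
  shows "\<exists>K. \<forall>y v. norm (vector_deriv A (\<lambda>x. \<iota> (f x) - \<iota> (h x)) y v) \<le> K * tnorm g y v"
proof -
  let ?u = "\<lambda>x. \<iota> (f x) - \<iota> (h x)"
  define R where "R d y z \<longleftrightarrow> (\<forall>v. norm (vector_deriv A ?u y v) \<le> (1/d) * tnorm g y v)" for d :: real and y z :: 'm
  have loc: "\<forall>x\<in>UNIV. \<exists>d>0. \<forall>y\<in>ball x d. \<forall>z\<in>ball x d. R d y z"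
  proof
    fix x
    obtain d1 where d1: "d1 > 0" "ball x d1 \<subseteq> dom x"
      "\<And>y w. y \<in> ball x d1 \<Longrightarrow> tnorm g x w \<le> 2 * tnorm g y (frame x y w)"
      using tnorm_frame[of 2 x] by (metis one_less_numeral_iff semiring_norm(76))
    obtain \<beta> B where \<beta>: "\<beta> > 0" "\<And>w. \<beta> * norm w \<le> tnorm g x w"
      using tnorm_bounds[of x] by metis
    define D where "D w = Demb (f x) (manifold_deriv A f x w) - Demb (h x) (manifold_deriv A h x w)" for w
    have sd: "strict_deriv x ?u D"
      using strict_deriv_diff[OF
          strict_deriv_compose[OF C1_map_strict_deriv[OF f] C1_map_continuous[OF f] embedding_strict_deriv]
          strict_deriv_compose[OF C1_map_strict_deriv[OF h] C1_map_continuous[OF h] embedding_strict_deriv], of x]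
      by (simp add: o_def D_def[abs_def])
    obtain C where C: "C > 0" "\<And>w. norm (D w) \<le> C * norm w"
      using linear_bound_pos[OF strict_deriv_linear[OF sd]] by blast
    obtain d2 where d2: "d2 > 0" "\<And>y z. y \<in> ball x d2 \<Longrightarrow> z \<in> ball x d2 \<Longrightarrow>
        norm (?u z - ?u y - D (disp x y z)) \<le> 1 * norm (disp x y z)"
      using strict_derivD[OF sd, of 1] by auto
    define d where "d = Min {d1, d2, \<beta> / (2 * (C + 1))}"
    have d: "d > 0" "d \<le> d1" "d \<le> d2" "d \<le> \<beta> / (2 * (C + 1))"
      using d1 d2 C \<beta> by (auto simp: d_def)
    have "R d y z" if y: "y \<in> ball x d" for y z
      unfolding R_def
    proof
      fix v
      have y12: "y \<in> ball x d1" using y d by auto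
      have sub: "ball x d \<subseteq> dom x" using d d1(2) by auto
      obtain w where w: "v = frame x y w" using frame_bij[of y x] y12 d1(2) by (metis bij_pointE subsetD)
      have "norm (vector_deriv A ?u y v - D w) \<le> 1 * norm w"
        unfolding w
        by (rule lipschitz_deriv[OF sub y strict_deriv_linear[OF sd] _ C1_difference_derivative[OF f h]])
          (rule d2(2), use y d in auto)
      then have hi: "norm (vector_deriv A ?u y v) \<le> (C + 1) * norm w"
        using C(2)[of w] norm_triangle_ineq3[of "vector_deriv A ?u y v" "D w"] by (simp add: algebra_simps)
      have "d * norm (vector_deriv A ?u y v) \<le> \<beta> / (2 * (C + 1)) * ((C + 1) * norm w)"
        using d hi C \<beta>(1) by (intro mult_mono) auto
      also have "\<dots> = \<beta> * norm w / 2" using C by (simp add: field_simps)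
      also have "\<dots> \<le> tnorm g y v" using \<beta>(2)[of w] d1(3)[OF y12, of w] unfolding w by simp
      finally show "norm (vector_deriv A ?u y v) \<le> (1/d) * tnorm g y v" using d(1) by (simp add: field_simps)
    qed
    then show "\<exists>d>0. \<forall>y\<in>ball x d. \<forall>z\<in>ball x d. R d y z" using d(1) by blast
  qed
  have mono: "\<forall>d d' y z. R d y z \<longrightarrow> 0 < d' \<longrightarrow> d' \<le> d \<longrightarrow> R d' y z"
  proof (intro allI impI)
    fix d d' y z assume R: "R d y z" "0 < d'" "d' \<le> d"
    have "1/d \<le> 1/d'" using R by (simp add: frac_le)
    then show "R d' y z"
      using R(1) tnorm_nonneg unfolding R_def by (meson mult_right_mono order_trans)
  qed
  obtain d where "d > 0" "\<forall>x\<in>UNIV. \<forall>y\<in>ball x d. \<forall>z\<in>ball x d. R d y z"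
    using compact_local_uniform[OF compact_manifold loc mono] by blast
  then have "R d y y" for y by (metis UNIV_I centre_in_ball)
  then show ?thesis unfolding R_def by blast
qed

lemma C1_dist_bounds:
  assumes f: "C1_map A f" and h: "C1_map A h"
  shows "norm (\<iota> (f x) - \<iota> (h x)) \<le> C1_dist A g \<iota> f h"
    and "norm (vector_deriv A (\<lambda>x. \<iota> (f x) - \<iota> (h x)) y v) \<le> C1_dist A g \<iota> f h * tnorm g y v"
    and "0 \<le> C1_dist A g \<iota> f h"
proof -
  let ?u = "\<lambda>x. \<iota> (f x) - \<iota> (h x)"
  let ?S = "{(x, v). tnorm g x v = 1}"
  define s1 where "s1 = (SUP x. norm (?u x))"
  define s2 where "s2 = (SUP (x, v)\<in>?S. norm (vector_deriv A ?u x v))"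
  have dist: "C1_dist A g \<iota> f h = s1 + s2" by (simp add: C1_dist_def C1_norm_def s1_def s2_def)
  have "continuous_on UNIV (\<lambda>x. norm (?u x))"
    by (intro continuous_intros continuous_on_compose2[OF embedding_continuous] C1_map_continuous f h) auto
  from compact_imp_bounded[OF compact_continuous_image[OF this compact_manifold]]
  have "bdd_above (range (\<lambda>x. norm (?u x)))" by (rule bounded_imp_bdd_above)
  then have s1: "norm (?u x) \<le> s1" for x unfolding s1_def by (intro cSUP_upper) auto
  obtain K where K: "\<And>y v. norm (vector_deriv A ?u y v) \<le> K * tnorm g y v"
    using C1_difference_deriv_bounded[OF f h] by blast
  have bdd: "bdd_above ((\<lambda>(x, v). norm (vector_deriv A ?u x v)) ` ?S)"
  proof (rule bdd_aboveI2[of _ _ K])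
    fix p assume "p \<in> ?S"
    then show "(case p of (x, v) \<Rightarrow> norm (vector_deriv A ?u x v)) \<le> K"
      using K[of "fst p" "snd p"] by (simp add: case_prod_unfold)
  qed
  have s2: "norm (vector_deriv A ?u y v) \<le> s2" if "tnorm g y v = 1" for y v
    using cSUP_upper[OF _ bdd, of "(y, v)"] that by (simp add: s2_def)
  have ex: "tnorm g y (v /\<^sub>R tnorm g y v) = 1" if "v \<noteq> 0" for y v
    using tnorm_pos[OF that, of y] by (simp add: tnorm_scale)
  obtain b :: 'e where "b \<in> Basis" using nonempty_Basis by blast
  then have "b \<noteq> 0" by auto
  from s2[OF ex[OF this]] have s2_0: "0 \<le> s2" by (meson norm_ge_zero order_trans)
  have s1_0: "0 \<le> s1" using s1 by (meson norm_ge_zero order_trans)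
  show "norm (?u x) \<le> C1_dist A g \<iota> f h" using s1[of x] s2_0 dist by simp
  show "0 \<le> C1_dist A g \<iota> f h" using s1_0 s2_0 dist by simp
  have lin: "linear (vector_deriv A ?u y)" using C1_difference_derivative[OF f h] by (rule has_derivative_linear)
  show "norm (vector_deriv A ?u y v) \<le> C1_dist A g \<iota> f h * tnorm g y v"
  proof (cases "v = 0")
    case True
    then show ?thesis using linear_0[OF lin] by simp
  next
    case False
    let ?t = "tnorm g y v"
    have t: "?t > 0" by (rule tnorm_pos[OF False])
    have "vector_deriv A ?u y v = ?t *\<^sub>R vector_deriv A ?u y (v /\<^sub>R ?t)"
      using t by (simp add: linear_cmul[OF lin])
    then have "norm (vector_deriv A ?u y v) = ?t * norm (vector_deriv A ?u y (v /\<^sub>R ?t))"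
      using t by (metis abs_of_pos norm_scaleR)
    also have "\<dots> \<le> ?t * s2" using s2[OF ex[OF False]] t by (intro mult_left_mono) auto
    also have "\<dots> \<le> C1_dist A g \<iota> f h * ?t" using s1_0 t dist by (simp add: algebra_simps)
    finally show ?thesis .
  qed
qed

text \<open>Lets \<open>f\<close> count as a perturbation of itself. Unit tangent vectors exist at
  every point, so the supremum is not over the empty set, where its value would be
  unspecified.\<close>

lemma C1_dist_self: "C1_dist A g \<iota> f f = 0"
proof -
  have z: "vector_deriv A (\<lambda>x. \<iota> (f x) - \<iota> (f x)) x v = 0" for x v
  proof -
    have D: "((\<lambda>x. \<iota> (f x) - \<iota> (f x)) \<circ> par x has_derivative (\<lambda>_. 0)) (at (coord x x))"
      by (simp add: o_def)
    show ?thesis unfolding vector_deriv_def frechet_derivative_at[OF D, symmetric] by (rule refl)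
  qed
  obtain b :: 'e where "b \<in> Basis" using nonempty_Basis by blast
  then have b: "b \<noteq> 0" by auto
  have "tnorm g x (b /\<^sub>R tnorm g x b) = 1" for x
    using tnorm_pos[OF b, of x] by (simp add: tnorm_scale)
  then have "{(x, v). tnorm g x v = 1} \<noteq> {}" by blast
  then have "(SUP (x, v)\<in>{(x, v). tnorm g x v = 1}. norm (vector_deriv A (\<lambda>x. \<iota> (f x) - \<iota> (f x)) x v)) = 0"
    unfolding z by (simp add: case_prod_unfold)
  then show ?thesis unfolding C1_dist_def C1_norm_def by simp
qed

text \<open>The mean value inequality on a convex coordinate ball. The radius and the constant
  depend on \<open>x\<close> alone, not on the two maps.\<close>

lemma C1_difference_lipschitz:
  obtains d K where "d > 0" "K > 0" "ball x d \<subseteq> dom x"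
    "\<And>f h y z. C1_map A f \<Longrightarrow> C1_map A h \<Longrightarrow> y \<in> ball x d \<Longrightarrow> z \<in> ball x d \<Longrightarrow>
      norm ((\<iota> (f z) - \<iota> (h z)) - (\<iota> (f y) - \<iota> (h y))) \<le> C1_dist A g \<iota> f h * (K * norm (disp x y z))"
proof -
  obtain d1 where d1: "d1 > 0" "ball x d1 \<subseteq> dom x"
    "\<And>y w. y \<in> ball x d1 \<Longrightarrow> tnorm g y (frame x y w) \<le> 2 * tnorm g x w"
    using tnorm_frame[of 2 x] by (metis one_less_numeral_iff semiring_norm(76))
  obtain \<beta> B where B: "B > 0" "\<And>w. tnorm g x w \<le> B * norm w"
    using tnorm_bounds[of x] by metis
  have o: "open (img x \<inter> par x -` ball x d1)" by (rule open_par_vimage) simp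
  have "coord x x \<in> img x \<inter> par x -` ball x d1"
    using coord_in_img[OF chart_at(2)] par_coord[OF chart_at(2)] d1(1) by auto
  then obtain r where r: "r > 0" "ball (coord x x) r \<subseteq> img x \<inter> par x -` ball x d1"
    using o open_contains_ball by metis
  obtain d where d: "d > 0" "ball x d \<subseteq> dom x" "coord x ` ball x d \<subseteq> ball (coord x x) r"
    using ball_in_chart[of "ball (coord x x) r" x] r(1) by auto
  show ?thesis
  proof (rule that[of d "2 * B"])
    fix f h y z assume f: "C1_map A f" and h: "C1_map A h" and yz: "y \<in> ball x d" "z \<in> ball x d"
    let ?u = "\<lambda>x. \<iota> (f x) - \<iota> (h x)" and ?c = "C1_dist A g \<iota> f h"
    let ?b = "ball (coord x x) r"
    define U where "U q = vector_deriv A ?u (par x q) \<circ> frame x (par x q)" for q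
    have q: "par x q \<in> ball x d1" "q \<in> img x" "par x q \<in> dom x" if "q \<in> ?b" for q
      using that r(2) by (auto intro: par_in_dom)
    have "norm ((?u \<circ> par x) (coord x z) - (?u \<circ> par x) (coord x y)) \<le> (?c * (2 * B)) * norm (coord x z - coord x y)"
    proof (rule differentiable_bound[OF convex_ball])
      show "coord x z \<in> ?b" "coord x y \<in> ?b" using d(3) yz by blast+
      fix q assume "q \<in> ?b"
      note q = q[OF this]
      have "(?u \<circ> par x has_derivative U q) (at q)"
        using derivative_change_chart[OF C1_difference_derivative[OF f h] q(3)] q(2) by (simp add: U_def coord_par)
      then show "(?u \<circ> par x has_derivative U q) (at q within ?b)" by (rule has_derivative_at_withinI)
      show "onorm (U q) \<le> ?c * (2 * B)"
      proof (rule onorm_le)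
        fix w
        have "norm (U q w) \<le> ?c * tnorm g (par x q) (frame x (par x q) w)"
          unfolding U_def o_apply by (rule C1_dist_bounds(2)[OF f h])
        also have "\<dots> \<le> ?c * (2 * (B * norm w))"
          using d1(3)[OF q(1), of w] B(2)[of w] C1_dist_bounds(3)[OF f h] by (intro mult_left_mono) linarith+
        finally show "norm (U q w) \<le> ?c * (2 * B) * norm w" by (simp add: mult.assoc)
      qed
    qed
    then show "norm (?u z - ?u y) \<le> ?c * (2 * B * norm (disp x y z))"
      using yz d(2) by (simp add: par_coord subset_iff mult.assoc)
  qed (use d B in auto)
qed

definition C1_near :: "('m \<Rightarrow> 'm) \<Rightarrow> real \<Rightarrow> ('m \<Rightarrow> 'm) \<Rightarrow> bool" where
  "C1_near f \<delta> h \<longleftrightarrow> C1_map A h \<and> C1_dist A g \<iota> f h < \<delta>"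

lemma C1_near_mono: "C1_near f \<delta> h \<Longrightarrow> \<delta> \<le> \<delta>' \<Longrightarrow> C1_near f \<delta>' h"
  by (auto simp: C1_near_def)

lemma C1_near_self: "C1_map A f \<Longrightarrow> \<delta> > 0 \<Longrightarrow> C1_near f \<delta> f"
  by (simp add: C1_near_def C1_dist_self)

text \<open>In the ambient space \<open>h\<close> differs from \<open>f\<close> by a map of small
  Lipschitz constant, and \<open>f\<close> is strictly differentiable there. The injective
  derivative of \<open>\<iota>\<close> at \<open>f x\<close> brings the estimate back to the
  chart.\<close>

lemma C1_near_local:
  assumes f: "C1_map A f" and \<epsilon>: "\<epsilon> > 0"
  obtains d where "d > 0" "ball x d \<subseteq> dom x"
    "\<And>h y. C1_near f d h \<Longrightarrow> y \<in> ball x d \<Longrightarrow> h y \<in> ball (f x) \<epsilon> \<inter> dom (f x)"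
    "\<And>h y z. C1_near f d h \<Longrightarrow> y \<in> ball x d \<Longrightarrow> z \<in> ball x d \<Longrightarrow>
      norm (disp (f x) (h y) (h z) - manifold_deriv A f x (disp x y z)) \<le> \<epsilon> * norm (disp x y z)"
proof -
  let ?L = "manifold_deriv A f x" and ?D = "Demb (f x)"
  have L: "linear ?L" using has_mderiv_linear[OF C1_map_mderiv[OF f]] .
  have "inj ?D" using embedding by (auto simp: smooth_embedding_def)
  then obtain \<beta> where \<beta>: "\<beta> > 0" "\<And>w. \<beta> * norm w \<le> norm (?D w)"
    using linear_inj_bounded_below_pos[OF embedding_deriv_linear] by metis
  obtain \<Lambda> where \<Lambda>: "\<Lambda> > 0" "\<And>w. norm (?L w) \<le> \<Lambda> * norm w" using linear_bound_pos[OF L] by blast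
  obtain d3 K where d3: "d3 > 0" "K > 0" "ball x d3 \<subseteq> dom x"
    "\<And>f h y z. C1_map A f \<Longrightarrow> C1_map A h \<Longrightarrow> y \<in> ball x d3 \<Longrightarrow> z \<in> ball x d3 \<Longrightarrow>
      norm ((\<iota> (f z) - \<iota> (h z)) - (\<iota> (f y) - \<iota> (h y))) \<le> C1_dist A g \<iota> f h * (K * norm (disp x y z))"
    using C1_difference_lipschitz[of x] by blast
  \<comment> \<open>With \<open>n\<close> the displacement and \<open>n'\<close> the error sought,
    the estimates add up to \<open>\<beta> * n' \<le> 3 * \<eta> * n + \<beta>/2 * n'\<close>; this
    choice yields \<open>n' \<le> \<epsilon> * n\<close>.\<close>
  define \<eta> where "\<eta> = \<beta> * \<epsilon> / 6"
  have \<eta>: "\<eta> > 0" using \<beta> \<epsilon> by (simp add: \<eta>_def)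
  \<comment> \<open>The remainder of \<open>\<iota>\<close> at \<open>f x\<close> involves the
    unknown \<open>n'\<close> itself; the cap \<open>\<beta>/2\<close> lets that part be absorbed on
    the left.\<close>
  define \<epsilon>1 where "\<epsilon>1 = min (\<beta>/2) (\<eta> / \<Lambda>)"
  have e1: "\<epsilon>1 > 0" "\<epsilon>1 \<le> \<beta>/2" "\<epsilon>1 * \<Lambda> \<le> \<eta>"
    using \<beta> \<eta> \<Lambda> by (auto simp: \<epsilon>1_def min_def field_simps)
  obtain d1 where d1: "d1 > 0" "\<And>y z. y \<in> ball (f x) d1 \<Longrightarrow> z \<in> ball (f x) d1 \<Longrightarrow>
      norm (\<iota> z - \<iota> y - ?D (disp (f x) y z)) \<le> \<epsilon>1 * norm (disp (f x) y z)"
    using strict_derivD[OF embedding_strict_deriv e1(1)] by blast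
  have "strict_deriv x (\<iota> \<circ> f) (?D \<circ> ?L)"
    by (intro strict_deriv_compose C1_map_strict_deriv C1_map_continuous f embedding_strict_deriv)
  then obtain d2 where d2: "d2 > 0" "\<And>y z. y \<in> ball x d2 \<Longrightarrow> z \<in> ball x d2 \<Longrightarrow>
      norm ((\<iota> \<circ> f) z - (\<iota> \<circ> f) y - (?D \<circ> ?L) (disp x y z)) \<le> \<eta> * norm (disp x y z)"
    using strict_derivD[OF _ \<eta>] by blast
  obtain r0 where r0: "r0 > 0" "ball (f x) r0 \<subseteq> dom (f x)"
    using open_dom chart_at(2) open_contains_ball by metis
  define r where "r = Min {\<epsilon>, d1, r0}"
  have r: "r > 0" "r \<le> \<epsilon>" "r \<le> d1" "r \<le> r0" using \<epsilon> d1 r0 by (auto simp: r_def)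
  have r2: "r / 2 > 0" using r by simp
  obtain \<delta> where \<delta>: "\<delta> > 0" "\<And>y z. norm (\<iota> y - \<iota> z) < \<delta> \<Longrightarrow> dist y z < r / 2"
    using embedding_dist[OF r2] by blast
  have "open (f -` ball (f x) (r/2))" using C1_map_continuous[OF f] by (intro open_vimage) auto
  then obtain d4 where d4: "d4 > 0" "ball x d4 \<subseteq> f -` ball (f x) (r/2)"
    using r2 by (metis centre_in_ball open_contains_ball vimageI)
  define d where "d = Min {d2, d3, d4, \<delta>, \<eta> / K}"
  have d: "d > 0" "d \<le> d2" "d \<le> d3" "d \<le> d4" "d \<le> \<delta>" "d \<le> \<eta> / K"
    using d2 d3 d4 \<delta> \<eta> by (auto simp: d_def)
  have near: "h y \<in> ball (f x) r" if h: "C1_near f d h" and y: "y \<in> ball x d" for h y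
  proof -
    have "norm (\<iota> (f y) - \<iota> (h y)) < \<delta>"
      using C1_dist_bounds(1)[OF f, of h y] h d(5) by (auto simp: C1_near_def)
    then have "dist (f y) (h y) < r/2" by (rule \<delta>(2))
    moreover have "y \<in> f -` ball (f x) (r/2)" using d(4) y by (intro subsetD[OF d4(2)]) simp
    then have "dist (f x) (f y) < r/2" by simp
    ultimately show ?thesis using dist_triangle[of "f x" "h y" "f y"] by simp
  qed
  show ?thesis
  proof (rule that[OF d(1)])
    show "ball x d \<subseteq> dom x" using d3(3) d(3) by auto
    show "h y \<in> ball (f x) \<epsilon> \<inter> dom (f x)" if "C1_near f d h" "y \<in> ball x d" for h y
      using near[OF that] r r0(2) by auto
    fix h y z assume h: "C1_near f d h" and yz: "y \<in> ball x d" "z \<in> ball x d"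
    have h': "C1_map A h" "C1_dist A g \<iota> f h < d" using h by (auto simp: C1_near_def)
    let ?w = "disp x y z" and ?w' = "disp (f x) (h y) (h z)"
    define n n' where "n = norm ?w" and "n' = norm (?w' - ?L ?w)"
    have 1: "norm (\<iota> (h z) - \<iota> (h y) - ?D ?w') \<le> \<epsilon>1 * norm ?w'"
      using near[OF h yz(1)] near[OF h yz(2)] r(3) by (intro d1(2)) auto
    have 2: "norm (\<iota> (f z) - \<iota> (f y) - ?D (?L ?w)) \<le> \<eta> * n"
      using d2(2)[of y z] yz d(2) by (simp add: n_def)
    have "norm ((\<iota> (f z) - \<iota> (h z)) - (\<iota> (f y) - \<iota> (h y))) \<le> C1_dist A g \<iota> f h * (K * n)"
      unfolding n_def by (rule d3(4)[OF f h'(1)]) (use yz d(3) in auto)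
    also have "\<dots> \<le> (\<eta> / K) * (K * n)"
      using h'(2) d(6) d3(2) by (intro mult_right_mono) (auto simp: n_def)
    finally have 3: "norm ((\<iota> (f z) - \<iota> (h z)) - (\<iota> (f y) - \<iota> (h y))) \<le> \<eta> * n" using d3(2) by simp
    have "norm ?w' \<le> n' + norm (?L ?w)" unfolding n'_def by (metis add.commute diff_add_cancel norm_triangle_ineq)
    also have "\<dots> \<le> n' + \<Lambda> * n" using \<Lambda>(2)[of ?w] by (simp add: n_def)
    finally have "\<epsilon>1 * norm ?w' \<le> \<epsilon>1 * (n' + \<Lambda> * n)" using e1(1) by (intro mult_left_mono) auto
    also have "\<dots> \<le> \<beta>/2 * n' + \<eta> * n"
      using mult_right_mono[OF e1(2), of n'] mult_right_mono[OF e1(3), of n]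
      by (simp add: n_def n'_def distrib_left mult.assoc)
    finally have 4: "\<epsilon>1 * norm ?w' \<le> \<beta>/2 * n' + \<eta> * n" .
    have eq: "?D (?w' - ?L ?w) = (\<iota> (f z) - \<iota> (f y) - ?D (?L ?w)) - ((\<iota> (f z) - \<iota> (h z)) - (\<iota> (f y) - \<iota> (h y)))
        - (\<iota> (h z) - \<iota> (h y) - ?D ?w')" by (simp add: linear_diff[OF embedding_deriv_linear])
    have "norm (?D (?w' - ?L ?w)) \<le> norm (\<iota> (f z) - \<iota> (f y) - ?D (?L ?w)) +
        norm ((\<iota> (f z) - \<iota> (h z)) - (\<iota> (f y) - \<iota> (h y))) + norm (\<iota> (h z) - \<iota> (h y) - ?D ?w')"
      unfolding eq by (intro order_trans[OF norm_triangle_ineq4] add_mono norm_triangle_ineq4 order_refl)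
    then have "\<beta> * n' \<le> \<eta> * n + \<eta> * n + (\<beta>/2 * n' + \<eta> * n)"
      using \<beta>(2)[of "?w' - ?L ?w"] 1 2 3 4 unfolding n'_def by linarith
    then have "\<beta> * n' \<le> \<beta> * (\<epsilon> * n)" by (simp add: \<eta>_def)
    then show "norm (?w' - ?L ?w) \<le> \<epsilon> * norm ?w" using \<beta>(1) by (simp add: n_def n'_def)
  qed
qed

text \<open>The property of \<open>C1_near_local\<close> is stable under composition, so iterates
  need no estimate of the distance between \<open>h ^^ n\<close> and \<open>f ^^ n\<close>.\<close>

lemma C1_near_local_iterate:
  assumes f: "C1_map A f" and \<epsilon>: "\<epsilon> > 0"
  shows "\<exists>d>0. ball x d \<subseteq> dom x \<and>
    (\<forall>h y. C1_near f d h \<longrightarrow> y \<in> ball x d \<longrightarrow> (h ^^ n) y \<in> ball ((f ^^ n) x) \<epsilon> \<inter> dom ((f ^^ n) x)) \<and>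
    (\<forall>h y z. C1_near f d h \<longrightarrow> y \<in> ball x d \<longrightarrow> z \<in> ball x d \<longrightarrow>
      norm (disp ((f ^^ n) x) ((h ^^ n) y) ((h ^^ n) z) - manifold_deriv A (f ^^ n) x (disp x y z)) \<le> \<epsilon> * norm (disp x y z))"
  using \<epsilon>
proof (induction n arbitrary: \<epsilon>)
  case 0
  obtain r where r: "r > 0" "ball x r \<subseteq> dom x"
    using open_dom chart_at(2) open_contains_ball by metis
  then have "ball x (min r \<epsilon>) \<subseteq> dom x" by auto
  moreover have "manifold_deriv A (\<lambda>a. a) x w = w" for w
    using has_mderiv_eq[OF has_mderiv_id[of x]] by (simp add: id_def)
  ultimately show ?case
    using r 0 by (intro exI[of _ "min r \<epsilon>"]) auto
next
  case (Suc n)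
  let ?M = "manifold_deriv A (f ^^ n) x" and ?p = "(f ^^ n) x"
  let ?L = "manifold_deriv A f ?p"
  have L: "linear ?L" using has_mderiv_linear[OF C1_map_mderiv[OF f]] .
  have M: "linear ?M" using has_mderiv_linear[OF iterate_mderiv(1)[OF f]] .
  obtain \<Lambda> where \<Lambda>: "\<Lambda> > 0" "\<And>w. norm (?L w) \<le> \<Lambda> * norm w" using linear_bound_pos[OF L] by blast
  obtain C where C: "C > 0" "\<And>w. norm (?M w) \<le> C * norm w" using linear_bound_pos[OF M] by blast
  define \<epsilon>2 where "\<epsilon>2 = min \<epsilon> (\<epsilon> / (2 * (C + 1)))"
  have e2: "\<epsilon>2 > 0" "\<epsilon>2 \<le> \<epsilon>" "\<epsilon>2 * (C + 1) \<le> \<epsilon> / 2"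
    using Suc.prems C by (auto simp: \<epsilon>2_def min_def field_simps add_pos_pos)
  obtain d2 where d2: "d2 > 0"
    "\<And>h y. C1_near f d2 h \<Longrightarrow> y \<in> ball ?p d2 \<Longrightarrow> h y \<in> ball (f ?p) \<epsilon>2 \<inter> dom (f ?p)"
    "\<And>h y z. C1_near f d2 h \<Longrightarrow> y \<in> ball ?p d2 \<Longrightarrow> z \<in> ball ?p d2 \<Longrightarrow>
      norm (disp (f ?p) (h y) (h z) - ?L (disp ?p y z)) \<le> \<epsilon>2 * norm (disp ?p y z)"
    using C1_near_local[OF f e2(1), of ?p] by metis
  define \<epsilon>1 where "\<epsilon>1 = Min {d2, 1, \<epsilon> / (2 * \<Lambda>)}"
  have e1: "\<epsilon>1 > 0" "\<epsilon>1 \<le> d2" "\<epsilon>1 \<le> 1" "\<epsilon>1 \<le> \<epsilon> / (2 * \<Lambda>)" using d2(1) Suc.prems \<Lambda> by (auto simp: \<epsilon>1_def)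
  obtain d1 where d1: "d1 > 0" "ball x d1 \<subseteq> dom x"
    "\<And>h y. C1_near f d1 h \<Longrightarrow> y \<in> ball x d1 \<Longrightarrow> (h ^^ n) y \<in> ball ?p \<epsilon>1 \<inter> dom ?p"
    "\<And>h y z. C1_near f d1 h \<Longrightarrow> y \<in> ball x d1 \<Longrightarrow> z \<in> ball x d1 \<Longrightarrow>
      norm (disp ?p ((h ^^ n) y) ((h ^^ n) z) - ?M (disp x y z)) \<le> \<epsilon>1 * norm (disp x y z)"
    using Suc.IH[OF e1(1)] by metis
  define d where "d = min d1 d2"
  have d: "d > 0" "d \<le> d1" "d \<le> d2" using d1 d2 by (auto simp: d_def)
  have in_p: "(h ^^ n) y \<in> ball ?p d2" if "C1_near f d h" "y \<in> ball x d" for h y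
    using d1(3)[OF C1_near_mono[OF that(1) d(2)], of y] that(2) d e1 by auto
  show ?case
  proof (intro exI[of _ d] conjI allI impI)
    show "d > 0" by (rule d(1))
    show "ball x d \<subseteq> dom x" using d1(2) d by auto
    show "(h ^^ Suc n) y \<in> ball ((f ^^ Suc n) x) \<epsilon> \<inter> dom ((f ^^ Suc n) x)"
      if "C1_near f d h" "y \<in> ball x d" for h y
      using d2(2)[OF C1_near_mono[OF that(1) d(3)] in_p[OF that]] e2(2) by auto
    fix h y z assume h: "C1_near f d h" and yz: "y \<in> ball x d" "z \<in> ball x d"
    let ?w = "disp x y z" and ?v = "disp ?p ((h ^^ n) y) ((h ^^ n) z)"
    have 1: "norm (?v - ?M ?w) \<le> \<epsilon>1 * norm ?w"
      using yz d by (intro d1(4) C1_near_mono[OF h d(2)]) auto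
    have 2: "norm (disp (f ?p) (h ((h ^^ n) y)) (h ((h ^^ n) z)) - ?L ?v) \<le> \<epsilon>2 * norm ?v"
      using in_p[OF h] yz by (intro d2(3) C1_near_mono[OF h d(3)]) auto
    have "norm ?v \<le> norm (?v - ?M ?w) + norm (?M ?w)" by (metis add.commute diff_add_cancel norm_triangle_ineq)
    also have "\<dots> \<le> (C + 1) * norm ?w"
      using 1 C(2)[of ?w] mult_right_mono[OF e1(3), of "norm ?w"] by (simp add: distrib_right)
    finally have "\<epsilon>2 * norm ?v \<le> \<epsilon>2 * ((C + 1) * norm ?w)" using e2(1) by (intro mult_left_mono) auto
    then have 3: "\<epsilon>2 * norm ?v \<le> \<epsilon>/2 * norm ?w"
      using mult_right_mono[OF e2(3) norm_ge_zero, of ?w] by (simp only: mult.assoc)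
    have "norm (?L (?v - ?M ?w)) \<le> \<Lambda> * norm (?v - ?M ?w)" by (rule \<Lambda>(2))
    also have "\<dots> \<le> \<Lambda> * ((\<epsilon> / (2 * \<Lambda>)) * norm ?w)"
      using order_trans[OF 1 mult_right_mono[OF e1(4) norm_ge_zero]] \<Lambda>(1) by (intro mult_left_mono) auto
    finally have 4: "norm (?L (?v - ?M ?w)) \<le> \<epsilon>/2 * norm ?w" using \<Lambda>(1) by simp
    have eq: "disp (f ?p) (h ((h ^^ n) y)) (h ((h ^^ n) z)) - ?L (?M ?w) =
        (disp (f ?p) (h ((h ^^ n) y)) (h ((h ^^ n) z)) - ?L ?v) + ?L (?v - ?M ?w)"
      by (simp add: linear_diff[OF L])
    have "norm (disp (f ?p) (h ((h ^^ n) y)) (h ((h ^^ n) z)) - ?L (?M ?w)) \<le> \<epsilon>/2 * norm ?w + \<epsilon>/2 * norm ?w"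
      unfolding eq by (rule norm_triangle_le) (use 2 3 4 in linarith)
    moreover have "manifold_deriv A (f ^^ Suc n) x ?w = ?L (?M ?w)" using iterate_mderiv(3)[OF f, of n x] by simp
    moreover have "(f ^^ Suc n) x = f ?p" "(h ^^ Suc n) y = h ((h ^^ n) y)" "(h ^^ Suc n) z = h ((h ^^ n) z)" by simp_all
    ultimately show "norm (disp ((f ^^ Suc n) x) ((h ^^ Suc n) y) ((h ^^ Suc n) z) - manifold_deriv A (f ^^ Suc n) x ?w) \<le> \<epsilon> * norm ?w"
      by (simp only:)
  qed
qed

end

section \<open>Local expansion and covering\<close>

context embedded_manifold
begin

lemma C1_near_local_tnorm:
  assumes f: "C1_map A f" and \<epsilon>: "\<epsilon> > 0"
  obtains d where "d > 0" "ball x d \<subseteq> dom x"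
    "\<And>h y. C1_near f d h \<Longrightarrow> y \<in> ball x d \<Longrightarrow> h y \<in> ball (f x) \<epsilon> \<inter> dom (f x)"
    "\<And>h y z. C1_near f d h \<Longrightarrow> y \<in> ball x d \<Longrightarrow> z \<in> ball x d \<Longrightarrow>
      tnorm g (f x) (disp (f x) (h y) (h z) - manifold_deriv A f x (disp x y z)) \<le> \<epsilon> * tnorm g x (disp x y z)"
proof -
  obtain \<beta> B where \<beta>: "\<beta> > 0" "\<And>w. \<beta> * norm w \<le> tnorm g x w" using tnorm_bounds[of x] by metis
  obtain \<beta>' B where B: "B > 0" "\<And>w. tnorm g (f x) w \<le> B * norm w" using tnorm_bounds[of "f x"] by metis
  define \<epsilon>' where "\<epsilon>' = min \<epsilon> (\<epsilon> * \<beta> / B)"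
  have e': "\<epsilon>' > 0" "\<epsilon>' \<le> \<epsilon>" "B * \<epsilon>' \<le> \<epsilon> * \<beta>" using \<epsilon> \<beta> B by (auto simp: \<epsilon>'_def min_def field_simps)
  obtain d where d: "d > 0" "ball x d \<subseteq> dom x"
    "\<And>h y. C1_near f d h \<Longrightarrow> y \<in> ball x d \<Longrightarrow> h y \<in> ball (f x) \<epsilon>' \<inter> dom (f x)"
    "\<And>h y z. C1_near f d h \<Longrightarrow> y \<in> ball x d \<Longrightarrow> z \<in> ball x d \<Longrightarrow>
      norm (disp (f x) (h y) (h z) - manifold_deriv A f x (disp x y z)) \<le> \<epsilon>' * norm (disp x y z)"
    using C1_near_local[OF f e'(1), of x] by blast
  show ?thesis
  proof (rule that[OF d(1,2)])
    fix h y assume "C1_near f d h" "y \<in> ball x d"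
    then show "h y \<in> ball (f x) \<epsilon> \<inter> dom (f x)" using d(3)[of h y] e'(2) by auto
  next
    fix h y z assume h: "C1_near f d h" "y \<in> ball x d" "z \<in> ball x d"
    let ?v = "disp (f x) (h y) (h z) - manifold_deriv A f x (disp x y z)" and ?w = "disp x y z"
    have "tnorm g (f x) ?v \<le> B * (\<epsilon>' * norm ?w)"
      using B(2)[of ?v] mult_left_mono[OF d(4)[OF h], of B] B(1) by linarith
    also have "\<dots> \<le> \<epsilon> * \<beta> * norm ?w" using mult_right_mono[OF e'(3) norm_ge_zero, of ?w] by (simp only: mult.assoc)
    also have "\<dots> \<le> \<epsilon> * tnorm g x ?w" using mult_left_mono[OF \<beta>(2)[of ?w], of \<epsilon>] \<epsilon> by (simp only: mult.assoc less_imp_le)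
    finally show "tnorm g (f x) ?v \<le> \<epsilon> * tnorm g x ?w" .
  qed
qed

text \<open>Compares the derivative of \<open>h ^^ n\<close> at \<open>y\<close> with that of
  \<open>f ^^ n\<close> at \<open>x\<close>. The linearization error is additive, a multiple of
  \<open>norm w\<close>; the hypothesis \<open>exp\<close> turns it into a small fraction of the
  image vector, hence into a factor.\<close>

lemma C1_near_frame:
  assumes f: "C1_map A f" and a: "a > 1"
    and exp: "\<And>w. tnorm g x w \<le> tnorm g ((f ^^ n) x) (manifold_deriv A (f ^^ n) x w)"
  obtains d where "d > 0" "ball x d \<subseteq> dom x"
    "\<And>h y w. C1_near f d h \<Longrightarrow> y \<in> ball x d \<Longrightarrow>
      tnorm g x w \<le> a * tnorm g y (frame x y w) \<and>
      tnorm g y (frame x y w) \<le> a * tnorm g x w \<and>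
      tnorm g ((f ^^ n) x) (manifold_deriv A (f ^^ n) x w) \<le> a * tnorm g ((h ^^ n) y) (manifold_deriv A (h ^^ n) y (frame x y w)) \<and>
      tnorm g ((h ^^ n) y) (manifold_deriv A (h ^^ n) y (frame x y w)) \<le> a * tnorm g ((f ^^ n) x) (manifold_deriv A (f ^^ n) x w)"
proof -
  let ?q = "(f ^^ n) x" and ?D = "manifold_deriv A (f ^^ n) x"
  have D: "linear ?D" using has_mderiv_linear[OF iterate_mderiv(1)[OF f]] .
  \<comment> \<open>One factor \<open>b\<close> is for the metric at the image point, one for the
    linearization.\<close>
  define b where "b = sqrt a"
  have b: "b > 1" "b * b = a" using a by (auto simp: b_def)
  have ba: "b \<le> a" using b mult_left_mono[of 1 b b] by simp
  obtain \<beta> B0 where \<beta>: "\<beta> > 0" "\<And>w. \<beta> * norm w \<le> tnorm g x w" using tnorm_bounds[of x] by metis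
  obtain \<beta>' B where B: "B > 0" "\<And>w. tnorm g ?q w \<le> B * norm w" using tnorm_bounds[of ?q] by metis
  obtain d1 where d1: "d1 > 0" "ball x d1 \<subseteq> dom x"
    "\<And>y w. y \<in> ball x d1 \<Longrightarrow> tnorm g x w \<le> b * tnorm g y (frame x y w)"
    "\<And>y w. y \<in> ball x d1 \<Longrightarrow> tnorm g y (frame x y w) \<le> b * tnorm g x w"
    using tnorm_frame[OF b(1), of x] by metis
  obtain d2 where d2: "d2 > 0" "ball ?q d2 \<subseteq> dom ?q"
    "\<And>y w. y \<in> ball ?q d2 \<Longrightarrow> tnorm g ?q w \<le> b * tnorm g y (frame ?q y w)"
    "\<And>y w. y \<in> ball ?q d2 \<Longrightarrow> tnorm g y (frame ?q y w) \<le> b * tnorm g ?q w"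
    using tnorm_frame[OF b(1), of ?q] by metis
  define \<theta> where "\<theta> = 1 - 1 / b"
  have th: "\<theta> > 0" "1 + \<theta> \<le> b" "1 - \<theta> = 1 / b"
  proof -
    have "2 \<le> b + 1 / b"
      using zero_le_power2[of "b - 1"] b by (simp add: field_simps power2_eq_square)
    then show "1 + \<theta> \<le> b" by (simp add: \<theta>_def)
  qed (use b in \<open>auto simp: \<theta>_def\<close>)
  define \<epsilon> where "\<epsilon> = min d2 (\<theta> * \<beta> / B)"
  have e: "\<epsilon> > 0" "\<epsilon> \<le> d2" "B * \<epsilon> \<le> \<theta> * \<beta>" using d2 th \<beta> B by (auto simp: \<epsilon>_def min_def field_simps)
  obtain d3 where d3: "d3 > 0" "ball x d3 \<subseteq> dom x"
    "\<And>h y. C1_near f d3 h \<Longrightarrow> y \<in> ball x d3 \<Longrightarrow> (h ^^ n) y \<in> ball ?q \<epsilon> \<inter> dom ?q"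
    "\<And>h y z. C1_near f d3 h \<Longrightarrow> y \<in> ball x d3 \<Longrightarrow> z \<in> ball x d3 \<Longrightarrow>
      norm (disp ?q ((h ^^ n) y) ((h ^^ n) z) - ?D (disp x y z)) \<le> \<epsilon> * norm (disp x y z)"
    using C1_near_local_iterate[OF f e(1), of x n] by metis
  define d where "d = min d1 d3"
  have d: "d > 0" "d \<le> d1" "d \<le> d3" using d1 d3 by (auto simp: d_def)
  have sub: "ball x d \<subseteq> dom x" using d1(2) d by auto
  show ?thesis
  proof (rule that[OF d(1) sub])
    fix h y w assume h: "C1_near f d h" and y: "y \<in> ball x d"
    note h3 = C1_near_mono[OF h d(3)]
    have hC: "C1_map A h" using h by (simp add: C1_near_def)
    have y1: "y \<in> ball x d1" "y \<in> ball x d3" using y d by auto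
    let ?hy = "(h ^^ n) y" and ?E = "manifold_deriv A (h ^^ n) y" and ?T = "frame x y"
    have hy: "?hy \<in> ball ?q d2" "?hy \<in> dom ?q" using d3(3)[OF h3 y1(2)] e(2) by auto
    have idd: "(coord ?q \<circ> par ?q has_derivative id) (at (coord ?q ?hy))"
    proof -
      have "(id has_derivative id) (at (coord ?q ?hy))" by (rule has_derivative_id)
      then show ?thesis
        by (rule has_derivative_transform_within_open[OF _ open_img[of ?q]])
          (use hy(2) in \<open>auto simp: coord_in_img coord_par\<close>)
    qed
    obtain S where S: "frame ?q ?hy \<circ> S = id"
      "(coord ?q \<circ> (h ^^ n) \<circ> par y has_derivative id \<circ> (S \<circ> ?E)) (at (coord y y))"
      using has_mderiv_post[OF iterate_mderiv(1)[OF hC] iterate_continuous[OF C1_map_continuous[OF hC]] hy(2) idd] by metis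
    \<comment> \<open>The derivative of \<open>h ^^ n\<close> at \<open>y\<close>, applied to the
      transported vector and read in the chart at \<open>(f ^^ n) x\<close>, where it can be
      subtracted from \<open>?D w\<close>.\<close>
    define M where "M = S (?E (?T w))"
    have "norm ((id \<circ> (S \<circ> ?E)) (?T w) - ?D w) \<le> \<epsilon> * norm w"
    proof (rule lipschitz_deriv[OF sub y D])
      show "(coord ?q \<circ> (h ^^ n) \<circ> par y has_derivative id \<circ> (S \<circ> ?E)) (at (coord y y))" by (rule S(2))
      show "norm ((coord ?q \<circ> (h ^^ n)) z - (coord ?q \<circ> (h ^^ n)) y - ?D (disp x y z)) \<le> \<epsilon> * norm (disp x y z)"
        if "z \<in> ball x d" for z using d3(4)[OF h3 y1(2), of z] that d by simp
    qed
    then have "norm (M - ?D w) \<le> \<epsilon> * norm w" by (simp add: M_def)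
    then have "tnorm g ?q (M - ?D w) \<le> B * (\<epsilon> * norm w)"
      using B(2)[of "M - ?D w"] mult_left_mono[of "norm (M - ?D w)" "\<epsilon> * norm w" B] B(1) by linarith
    also have "\<dots> \<le> \<theta> * \<beta> * norm w" using mult_right_mono[OF e(3) norm_ge_zero, of w] by (simp only: mult.assoc)
    also have "\<dots> \<le> \<theta> * tnorm g x w" using mult_left_mono[OF \<beta>(2)[of w], of \<theta>] th(1) by (simp only: mult.assoc less_imp_le)
    also have "\<dots> \<le> \<theta> * tnorm g ?q (?D w)" using exp[of w] th(1) by simp
    finally have near: "tnorm g ?q (M - ?D w) \<le> \<theta> * tnorm g ?q (?D w)" .
    have "tnorm g ?q M \<le> tnorm g ?q (?D w) + tnorm g ?q (M - ?D w)"
      using tnorm_triangle[of ?q "?D w" "M - ?D w"] by simp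
    also have "\<dots> \<le> (1 + \<theta>) * tnorm g ?q (?D w)" using near by (simp add: distrib_right)
    also have "\<dots> \<le> b * tnorm g ?q (?D w)" by (rule mult_right_mono[OF th(2) tnorm_nonneg])
    finally have up: "tnorm g ?q M \<le> b * tnorm g ?q (?D w)" .
    have "tnorm g ?q (?D w) \<le> tnorm g ?q M + tnorm g ?q (M - ?D w)"
      using tnorm_triangle[of ?q M "?D w - M"] tnorm_minus[of ?q M "?D w"] by simp
    then have "(1 - \<theta>) * tnorm g ?q (?D w) \<le> tnorm g ?q M" using near by (simp add: left_diff_distrib)
    then have lo: "tnorm g ?q (?D w) \<le> b * tnorm g ?q M" using th(3) b(1) by (simp add: field_simps)
    have FM: "frame ?q ?hy M = ?E (?T w)" using fun_cong[OF S(1), of "?E (?T w)"] by (simp add: M_def)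
    have 1: "tnorm g ?q M \<le> b * tnorm g ?hy (?E (?T w))" using d2(3)[OF hy(1), of M] FM by simp
    have 2: "tnorm g ?hy (?E (?T w)) \<le> b * tnorm g ?q M" using d2(4)[OF hy(1), of M] FM by simp
    have "tnorm g ?q (?D w) \<le> a * tnorm g ?hy (?E (?T w))"
      using order_trans[OF lo mult_left_mono[OF 1, of b]] b by (simp add: mult.assoc[symmetric])
    moreover have "tnorm g ?hy (?E (?T w)) \<le> a * tnorm g ?q (?D w)"
      using order_trans[OF 2 mult_left_mono[OF up, of b]] b by (simp add: mult.assoc[symmetric])
    moreover have "tnorm g x w \<le> a * tnorm g y (?T w)"
      using order_trans[OF d1(3)[OF y1(1), of w] mult_right_mono[OF ba tnorm_nonneg]] .
    moreover have "tnorm g y (?T w) \<le> a * tnorm g x w"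
      using order_trans[OF d1(4)[OF y1(1), of w] mult_right_mono[OF ba tnorm_nonneg]] .
    ultimately show "tnorm g x w \<le> a * tnorm g y (?T w) \<and> tnorm g y (?T w) \<le> a * tnorm g x w \<and>
      tnorm g ?q (?D w) \<le> a * tnorm g ?hy (?E (?T w)) \<and> tnorm g ?hy (?E (?T w)) \<le> a * tnorm g ?q (?D w)" by simp
  qed
qed

text \<open>Of the rate \<open>s\<^sup>2\<close> one factor \<open>s\<close> pays for replacing
  chart norms by \<open>Q\<close> at source and target, \<open>sqrt s\<close> each. The error
  \<epsilon> is chosen so that \<open>s\<^sup>2 - \<epsilon>\<close> is \<open>s\<close> times the
  remaining rate \<open>(1 + s) / 2\<close>.\<close>

lemma C1_near_expands:
  assumes f: "C1_map A f" and s: "s > 1"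
    and exp: "\<And>w. s\<^sup>2 * tnorm g x w \<le> tnorm g (f x) (manifold_deriv A f x w)"
  shows "\<exists>d>0. \<forall>y\<in>ball x d. \<forall>z\<in>ball x d. \<forall>h. C1_near f d h \<longrightarrow>
    (1 + s) / 2 * Q y z \<le> Q (h y) (h z) \<and>
    (\<forall>v. (1 + s) / 2 * tnorm g y v \<le> tnorm g (h y) (manifold_deriv A h y v))"
proof -
  let ?L = "manifold_deriv A f x"
  define a where "a = sqrt s"
  have a: "a > 1" "a * a = s" using s by (auto simp: a_def)
  define \<epsilon> where "\<epsilon> = s * (s - 1) / 2"
  have \<epsilon>: "\<epsilon> > 0" using s by (simp add: \<epsilon>_def)
  have s\<epsilon>: "s\<^sup>2 - \<epsilon> = s * ((1 + s) / 2)" by (simp add: \<epsilon>_def power2_eq_square field_simps)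
  have exp1: "tnorm g x w \<le> tnorm g ((f ^^ 1) x) (manifold_deriv A (f ^^ 1) x w)" for w
  proof -
    have "1 * tnorm g x w \<le> s\<^sup>2 * tnorm g x w" using s tnorm_nonneg by (intro mult_right_mono) (auto simp: one_le_power)
    then show ?thesis using exp[of w] by simp
  qed
  obtain d1 where d1: "d1 > 0" "ball x d1 \<subseteq> dom x"
    "\<And>h y w. C1_near f d1 h \<Longrightarrow> y \<in> ball x d1 \<Longrightarrow>
      tnorm g x w \<le> a * tnorm g y (frame x y w) \<and>
      tnorm g y (frame x y w) \<le> a * tnorm g x w \<and>
      tnorm g ((f ^^ 1) x) (manifold_deriv A (f ^^ 1) x w) \<le> a * tnorm g ((h ^^ 1) y) (manifold_deriv A (h ^^ 1) y (frame x y w)) \<and>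
      tnorm g ((h ^^ 1) y) (manifold_deriv A (h ^^ 1) y (frame x y w)) \<le> a * tnorm g ((f ^^ 1) x) (manifold_deriv A (f ^^ 1) x w)"
    using C1_near_frame[OF f a(1) exp1] by blast
  obtain d2 where d2: "d2 > 0"
    "\<And>y z. y \<in> ball x d2 \<Longrightarrow> z \<in> ball x d2 \<Longrightarrow> Q y z \<le> a * tnorm g x (disp x y z)"
    using Q_local[OF a(1), of x] by metis
  obtain d3 where d3: "d3 > 0"
    "\<And>y z. y \<in> ball (f x) d3 \<Longrightarrow> z \<in> ball (f x) d3 \<Longrightarrow> tnorm g (f x) (disp (f x) y z) \<le> a * Q y z"
    using Q_local[OF a(1), of "f x"] by metis
  define \<epsilon>' where "\<epsilon>' = min \<epsilon> d3"
  have e': "\<epsilon>' > 0" "\<epsilon>' \<le> \<epsilon>" "\<epsilon>' \<le> d3" using \<epsilon> d3 by (auto simp: \<epsilon>'_def)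
  obtain d4 where d4: "d4 > 0"
    "\<And>h y. C1_near f d4 h \<Longrightarrow> y \<in> ball x d4 \<Longrightarrow> h y \<in> ball (f x) \<epsilon>' \<inter> dom (f x)"
    "\<And>h y z. C1_near f d4 h \<Longrightarrow> y \<in> ball x d4 \<Longrightarrow> z \<in> ball x d4 \<Longrightarrow>
      tnorm g (f x) (disp (f x) (h y) (h z) - ?L (disp x y z)) \<le> \<epsilon>' * tnorm g x (disp x y z)"
    using C1_near_local_tnorm[OF f e'(1), of x] by metis
  define d where "d = Min {d1, d2, d4}"
  have d: "d > 0" "d \<le> d1" "d \<le> d2" "d \<le> d4" using d1 d2 d4 by (auto simp: d_def)
  show ?thesis
  proof (intro exI[of _ d] conjI d(1) ballI allI impI)
    fix y z h assume y: "y \<in> ball x d" and z: "z \<in> ball x d" and h: "C1_near f d h"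
    let ?w = "disp x y z" and ?w' = "disp (f x) (h y) (h z)"
    have yz: "y \<in> ball x d1" "y \<in> ball x d2" "z \<in> ball x d2" "y \<in> ball x d4" "z \<in> ball x d4" using y z d by auto
    note h4 = C1_near_mono[OF h d(4)]
    have "tnorm g (f x) (?L ?w) \<le> tnorm g (f x) ?w' + tnorm g (f x) (?w' - ?L ?w)"
      using tnorm_triangle[of "f x" ?w' "?L ?w - ?w'"] tnorm_minus[of "f x" ?w' "?L ?w"] by simp
    moreover have "tnorm g (f x) (?w' - ?L ?w) \<le> \<epsilon> * tnorm g x ?w"
      using d4(3)[OF h4 yz(4,5)] mult_right_mono[OF e'(2) tnorm_nonneg, of x ?w] by linarith
    ultimately have "s * ((1 + s) / 2) * tnorm g x ?w \<le> tnorm g (f x) ?w'"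
      using exp[of ?w] by (simp only: s\<epsilon>[symmetric] left_diff_distrib)
    also have "\<dots> \<le> a * Q (h y) (h z)"
      using d4(2)[OF h4 yz(4)] d4(2)[OF h4 yz(5)] e'(3) by (intro d3(2)) auto
    finally have "a * (s * ((1 + s) / 2) * tnorm g x ?w) \<le> a * (a * Q (h y) (h z))" using a(1) by simp
    then have "s * ((1 + s) / 2 * (a * tnorm g x ?w)) \<le> s * Q (h y) (h z)"
      using a(2) by (simp only: mult.assoc[symmetric]) (simp add: mult_ac)
    then have "(1 + s) / 2 * (a * tnorm g x ?w) \<le> Q (h y) (h z)" using s by simp
    moreover have "(1 + s) / 2 * Q y z \<le> (1 + s) / 2 * (a * tnorm g x ?w)"
      using d2(2)[OF yz(2,3)] s by (intro mult_left_mono) auto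
    ultimately show "(1 + s) / 2 * Q y z \<le> Q (h y) (h z)" by linarith
    fix v
    obtain w where w: "v = frame x y w" using frame_bij[of y x] yz(1) d1(2) by (metis bij_pointE subsetD)
    note fr = d1(3)[OF C1_near_mono[OF h d(2)] yz(1), of w, folded w, simplified]
    have "(a * a) * (a * a * tnorm g x w) \<le> a * tnorm g (h y) (manifold_deriv A h y v)"
      using exp[of w] fr a(2) by (simp add: power2_eq_square)
    moreover have "a * (s * (a * tnorm g x w)) = (a * a) * (a * a * tnorm g x w)"
      unfolding a(2)[symmetric] by (simp only: mult_ac)
    ultimately have "a * (s * (a * tnorm g x w)) \<le> a * tnorm g (h y) (manifold_deriv A h y v)" by (simp only:)
    then have 1: "s * (a * tnorm g x w) \<le> tnorm g (h y) (manifold_deriv A h y v)" using a(1) by simp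
    have "(1 + s) / 2 * tnorm g y v \<le> s * tnorm g y v" using s tnorm_nonneg by (intro mult_right_mono) auto
    also have "\<dots> \<le> s * (a * tnorm g x w)" using fr s by (intro mult_left_mono) auto
    finally show "(1 + s) / 2 * tnorm g y v \<le> tnorm g (h y) (manifold_deriv A h y v)" using 1 by linarith
  qed
qed

lemma tnorm_ball_compact_convex: "compact {u. tnorm g x (u - p) \<le> c}" "convex {u. tnorm g x (u - p) \<le> c}"
proof -
  obtain \<beta> B where \<beta>: "\<beta> > 0" "\<And>w. \<beta> * norm w \<le> tnorm g x w" using tnorm_bounds[of x] by metis
  have cont: "continuous_on UNIV (\<lambda>u. tnorm g x (u - p))"
    unfolding tnorm_def
    by (intro continuous_on_real_sqrt continuous_on_compose2[OF sym_form_continuous[OF inner_form_sym_form[OF metric_inner_form[of x]], of UNIV]]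
        continuous_intros) auto
  have "bounded {u. tnorm g x (u - p) \<le> c}"
  proof (rule boundedI)
    fix u assume "u \<in> {u. tnorm g x (u - p) \<le> c}"
    then have "\<beta> * norm (u - p) \<le> c" using \<beta>(2)[of "u - p"] by simp
    then have "norm (u - p) \<le> c / \<beta>" using \<beta>(1) by (simp add: field_simps)
    then show "norm u \<le> norm p + c / \<beta>" using norm_triangle_sub[of u p] by simp
  qed
  moreover have "closed {u. tnorm g x (u - p) \<le> c}" by (intro closed_Collect_le cont continuous_on_const)
  ultimately show "compact {u. tnorm g x (u - p) \<le> c}" by (simp add: compact_eq_bounded_closed)
  show "convex {u. tnorm g x (u - p) \<le> c}"
  proof (rule convexI)
    fix u v s t assume uv: "u \<in> {u. tnorm g x (u - p) \<le> c}" "v \<in> {u. tnorm g x (u - p) \<le> c}"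
      and st: "0 \<le> s" "0 \<le> t" "s + t = (1::real)"
    have "s *\<^sub>R u + t *\<^sub>R v - p = s *\<^sub>R (u - p) + t *\<^sub>R (v - p)"
      using st(3) by (simp add: algebra_simps flip: scaleR_add_left)
    then have "tnorm g x (s *\<^sub>R u + t *\<^sub>R v - p) \<le> s * tnorm g x (u - p) + t * tnorm g x (v - p)"
      using tnorm_triangle[of x "s *\<^sub>R (u - p)" "t *\<^sub>R (v - p)"] st by (simp add: tnorm_scale)
    also have "\<dots> \<le> s * c + t * c" using uv st by (intro add_mono mult_left_mono) auto
    also have "\<dots> = c" using st(3) by (metis distrib_right mult_1)
    finally show "s *\<^sub>R u + t *\<^sub>R v \<in> {u. tnorm g x (u - p) \<le> c}" by simp
  qed
qed

text \<open>The preimage is a fixed point of the quasi-Newton map \<open>u \<mapsto> u + L\<inverse> (z - h\<^sub>2 u)\<close> in the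
  chart at \<open>x\<close>, where \<open>L\<close> is the derivative of \<open>f\<close> at \<open>x\<close>.\<close>

lemma C1_near_covers:
  assumes f: "C1_map A f" and s: "s > 1"
    and exp: "\<And>w. s\<^sup>2 * tnorm g x w \<le> tnorm g (f x) (manifold_deriv A f x w)"
  shows "\<exists>d>0. \<forall>p\<in>ball x d. \<forall>z\<in>ball x d. \<forall>r h1 h2 q. 0 < r \<and> r \<le> d \<and> C1_near f (d * r) h1 \<and> C1_near f (d * r) h2 \<and>
    Q (h1 p) q \<le> r \<longrightarrow> (\<exists>y. Q p y \<le> r \<and> h2 y = q)"
proof -
  let ?L = "manifold_deriv A f x" and ?N = "tnorm g x" and ?N' = "tnorm g (f x)"
  have L: "linear ?L" using has_mderiv_linear[OF C1_map_mderiv[OF f]] .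
  have s2: "s\<^sup>2 > 0" using s by simp
  have "inj ?L"
  proof (rule linear_injective_0[OF L, THEN iffD2], intro allI impI)
    fix w assume "?L w = 0"
    then have "s\<^sup>2 * ?N w \<le> 0" using exp[of w] by simp
    then have "\<not> 0 < ?N w" using s2 by (simp add: mult_le_0_iff)
    then show "w = 0" using tnorm_pos by blast
  qed
  then obtain Li where Li: "linear Li" "\<And>v. Li (?L v) = v" "\<And>v. ?L (Li v) = v"
    using linear_injective_isomorphism[OF L] by blast
  have NLi: "?N (Li v) \<le> ?N' v / s\<^sup>2" for v
    using exp[of "Li v"] s2 by (simp add: Li(3) field_simps)
  define a where "a = sqrt s"
  have a: "a > 1" "a * a = s" using s by (auto simp: a_def)
  define \<epsilon> where "\<epsilon> = s * (s - 1) / 2"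
  have \<epsilon>: "\<epsilon> > 0" using s by (simp add: \<epsilon>_def)
  obtain \<beta> B where \<beta>: "\<beta> > 0" "\<And>w. \<beta> * norm w \<le> ?N w" using tnorm_bounds[of x] by metis
  obtain d2 where d2: "d2 > 0"
    "\<And>y z. y \<in> ball x d2 \<Longrightarrow> z \<in> ball x d2 \<Longrightarrow> Q y z \<le> a * ?N (disp x y z)"
    using Q_local[OF a(1), of x] by metis
  obtain d3 where d3: "d3 > 0"
    "\<And>y z. y \<in> ball (f x) d3 \<Longrightarrow> z \<in> ball (f x) d3 \<Longrightarrow> ?N' (disp (f x) y z) \<le> a * Q y z"
    using Q_local[OF a(1), of "f x"] by metis
  obtain d3' where d3': "d3' > 0" "ball (f x) d3' \<subseteq> dom (f x)"
    using open_dom chart_at(2) open_contains_ball by metis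
  define e where "e = min d3 d3' / 2"
  have e: "e > 0" "2 * e \<le> d3" "2 * e \<le> d3'" using d3 d3' by (auto simp: e_def)
  obtain rQ where rQ: "rQ > 0" "\<And>y z. Q y z \<le> rQ \<Longrightarrow> dist y z < e" using Q_dist[OF e(1)] by blast
  define \<epsilon>' where "\<epsilon>' = min \<epsilon> e"
  have e': "\<epsilon>' > 0" "\<epsilon>' \<le> \<epsilon>" "\<epsilon>' \<le> e" using \<epsilon> e by (auto simp: \<epsilon>'_def)
  obtain d4 where d4: "d4 > 0" "ball x d4 \<subseteq> dom x"
    "\<And>h y. C1_near f d4 h \<Longrightarrow> y \<in> ball x d4 \<Longrightarrow> h y \<in> ball (f x) \<epsilon>' \<inter> dom (f x)"
    "\<And>h y z. C1_near f d4 h \<Longrightarrow> y \<in> ball x d4 \<Longrightarrow> z \<in> ball x d4 \<Longrightarrow>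
      ?N' (disp (f x) (h y) (h z) - ?L (disp x y z)) \<le> \<epsilon>' * ?N (disp x y z)"
    using C1_near_local_tnorm[OF f e'(1), of x] by metis
  define d5 where "d5 = min d2 d4"
  have d5: "d5 > 0" "d5 \<le> d2" "d5 \<le> d4" using d2 d4 by (auto simp: d5_def)
  have "open (img x \<inter> par x -` ball x d5)" by (rule open_par_vimage) simp
  moreover have "coord x x \<in> img x \<inter> par x -` ball x d5"
    using coord_in_img[OF chart_at(2)] par_coord[OF chart_at(2)] d5(1) by auto
  ultimately obtain \<rho> where \<rho>: "\<rho> > 0" "ball (coord x x) \<rho> \<subseteq> img x \<inter> par x -` ball x d5"
    using open_contains_ball by metis
  obtain d6 where d6: "d6 > 0" "ball x d6 \<subseteq> dom x" "coord x ` ball x d6 \<subseteq> ball (coord x x) (\<rho> / 2)"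
    using ball_in_chart[of "ball (coord x x) (\<rho> / 2)" x] \<rho>(1) by auto
  \<comment> \<open>\<open>rQ\<close> keeps \<open>q\<close> in the chart at \<open>f x\<close>;
    \<open>\<beta> * \<rho> / 4\<close> keeps the ball \<open>K\<close> in the image of the chart at
    \<open>x\<close>; the last entry bounds \<open>Q (h2 p) (h1 p)\<close> by
    \<open>(s - 1) / 2 * r\<close>. For that the distance of the maps must scale with
    \<open>r\<close>, hence \<open>d * r\<close>.\<close>
  define d where "d = Min {1, d5, d6, rQ, \<beta> * \<rho> / 4, (s - 1) / (4 * Cemb)}"
  have "d > 0" using d5(1) d6(1) rQ(1) \<beta>(1) \<rho>(1) s Cemb(1) by (simp add: d_def)
  moreover have "d \<le> 1" "d \<le> d5" "d \<le> d6" "d \<le> rQ" "d \<le> \<beta> * \<rho> / 4" "d \<le> (s - 1) / (4 * Cemb)"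
    unfolding d_def by (rule Min_le; simp)+
  ultimately have d: "d > 0" "d \<le> 1" "d \<le> d5" "d \<le> d6" "d \<le> rQ" "d \<le> \<beta> * \<rho> / 4" "d \<le> (s - 1) / (4 * Cemb)"
    by blast+
  have "\<exists>y. Q p y \<le> r \<and> h2 y = q"
    if p: "p \<in> ball x d" and r: "0 < r" "r \<le> d" and h: "C1_near f (d * r) h1" "C1_near f (d * r) h2"
      and q: "Q (h1 p) q \<le> r" for p r h1 h2 q
  proof -
    have "d * r \<le> d4" using r d d5 mult_mono[of d 1 r d4] by simp
    then have h4: "C1_near f d4 h1" "C1_near f d4 h2" using h C1_near_mono by blast+
    have h2: "continuous_on UNIV h2" using h(2) C1_map_continuous by (simp add: C1_near_def)
    have p4: "p \<in> ball x d4" "p \<in> ball x d2" "p \<in> ball x d5" using p d d5 by auto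
    have pd: "p \<in> dom x" using p4 d4(2) by blast
    let ?cp = "coord x p" and ?c' = "coord (f x)"
    have hp: "h1 p \<in> ball (f x) e" "h2 p \<in> ball (f x) e" using d4(3)[OF h4(1) p4(1)] d4(3)[OF h4(2) p4(1)] e' by auto
    have "dist (h1 p) q < e" using q r d by (intro rQ(2)) auto
    then have "dist (f x) q < 2 * e" using hp(1) dist_triangle[of "f x" q "h1 p"] by simp
    then have qd: "q \<in> ball (f x) d3" "q \<in> dom (f x)" using e d3'(2) by auto
    have hp3: "h1 p \<in> ball (f x) d3" "h2 p \<in> ball (f x) d3" using hp e by auto
    \<comment> \<open>The radius \<open>r / a\<close> in the chart guarantees
      \<open>Q p y \<le> r\<close> after the distortion allowed by \<open>Q_local\<close>.\<close>
    define K where "K = {u. ?N (u - ?cp) \<le> r / a}"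
    have Kball: "u \<in> ball (coord x x) \<rho>" if u: "u \<in> K" for u
    proof -
      have "\<beta> * norm (u - ?cp) \<le> r / a" using u \<beta>(2)[of "u - ?cp"] by (simp add: K_def)
      also have "\<dots> \<le> r" using a(1) r(1) by (simp add: divide_le_eq)
      also have "\<dots> \<le> \<beta> * (\<rho> / 4)" using r d(6) by simp
      finally have "norm (u - ?cp) \<le> \<rho> / 4" using \<beta>(1) by simp
      moreover have "p \<in> ball x d6" using p d(4) by simp
      then have "dist (coord x x) ?cp < \<rho> / 2" using d6(3) by (auto simp: image_subset_iff)
      ultimately show ?thesis
        using dist_triangle[of "coord x x" u ?cp] \<rho>(1) by (simp add: dist_norm norm_minus_commute)
    qed
    have Kpar: "u \<in> img x" "par x u \<in> ball x d4" "par x u \<in> ball x d2" if "u \<in> K" for u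
      using Kball[OF that] \<rho>(2) d5 by auto
    define H where "H u = ?c' (h2 (par x u))" for u
    define G where "G u = u + Li (?c' q - H u)" for u
    have "\<exists>u\<in>K. G u = u"
    proof (rule brouwer[of K G])
      show "compact K" "convex K" unfolding K_def by (rule tnorm_ball_compact_convex)+
      have "?cp \<in> K" using r a by (simp add: K_def)
      then show "K \<noteq> {}" by blast
      have "continuous_on K (\<lambda>u. h2 (par x u))"
        using Kpar by (intro continuous_on_compose2[OF h2] continuous_on_subset[OF continuous_par]) auto
      then have "continuous_on K H"
        unfolding H_def using Kpar d4(3)[OF h4(2)]
        by (intro continuous_on_compose2[OF continuous_coord[of "f x"]]) auto
      then have "continuous_on K (\<lambda>u. Li (?c' q - H u))"
        using Li(1) by (intro linear_continuous_on_compose[of _ _ Li] continuous_intros) (auto simp: linear_conv_bounded_linear)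
      then show "continuous_on K G" unfolding G_def by (intro continuous_intros)
      \<comment> \<open>Three contributions: nonlinearity of \<open>h2\<close>, the offset of
        \<open>q\<close> from \<open>h1 p\<close>, and the gap between \<open>h1 p\<close> and
        \<open>h2 p\<close>. The inverse of \<open>L\<close> divides them by
        \<open>s\<^sup>2\<close>, and the constants are balanced so that the total is exactly
        \<open>r / a\<close>.\<close>
      have GK: "G u \<in> K" if u: "u \<in> K" for u
      proof -
        let ?y = "par x u"
        have cy: "coord x ?y = u" using Kpar(1)[OF u] by (rule coord_par)
        have 1: "?N' (disp (f x) (h2 p) (h2 ?y) - ?L (u - ?cp)) \<le> \<epsilon> * (r / a)"
        proof -
          have "?N' (disp (f x) (h2 p) (h2 ?y) - ?L (u - ?cp)) \<le> \<epsilon>' * ?N (u - ?cp)"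
            using d4(4)[OF h4(2) p4(1) Kpar(2)[OF u]] cy by simp
          also have "\<dots> \<le> \<epsilon> * (r / a)"
            using u e' tnorm_nonneg by (intro mult_mono) (auto simp: K_def)
          finally show ?thesis .
        qed
        have "norm (\<iota> (h1 p) - \<iota> (h2 p)) \<le> 2 * (d * r)"
        proof -
          have "norm (\<iota> (f p) - \<iota> (h1 p)) \<le> d * r" "norm (\<iota> (f p) - \<iota> (h2 p)) \<le> d * r"
            using h C1_dist_bounds(1)[OF f, of h1 p] C1_dist_bounds(1)[OF f, of h2 p] by (auto simp: C1_near_def)
          then show ?thesis
            using norm_triangle_ineq4[of "\<iota> (f p) - \<iota> (h2 p)" "\<iota> (f p) - \<iota> (h1 p)"] by simp
        qed
        then have "Q (h2 p) (h1 p) \<le> Cemb * (2 * (d * r))"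
          using Q_le[of "h2 p" "h1 p"] Cemb(1) mult_left_mono[of "norm (\<iota> (h1 p) - \<iota> (h2 p))" "2 * (d * r)" Cemb] by linarith
        also have "\<dots> \<le> Cemb * (2 * ((s - 1) / (4 * Cemb) * r))"
          using d(7) r Cemb(1) by (intro mult_left_mono mult_right_mono) auto
        also have "\<dots> = (s - 1) / 2 * r" using Cemb(1) by (simp add: field_simps)
        finally have 2: "Q (h2 p) (h1 p) \<le> (s - 1) / 2 * r" .
        have "?N' (?c' q - ?c' (h2 p)) \<le> ?N' (disp (f x) (h1 p) q) + ?N' (disp (f x) (h2 p) (h1 p))"
          using tnorm_triangle[of "f x" "disp (f x) (h1 p) q" "disp (f x) (h2 p) (h1 p)"] by simp
        also have "\<dots> \<le> a * r + a * ((s - 1) / 2 * r)"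
        proof (intro add_mono)
          show "?N' (disp (f x) (h1 p) q) \<le> a * r"
            using d3(2)[OF hp3(1) qd(1)] q a(1) mult_left_mono[OF q, of a] by linarith
          show "?N' (disp (f x) (h2 p) (h1 p)) \<le> a * ((s - 1) / 2 * r)"
            using d3(2)[OF hp3(2,1)] a(1) mult_left_mono[OF 2, of a] by linarith
        qed
        also have "\<dots> = a * r * ((s + 1) / 2)" by (simp add: field_simps)
        finally have 3: "?N' (?c' q - ?c' (h2 p)) \<le> a * r * ((s + 1) / 2)" .
        have "G u - ?cp = Li (?L (u - ?cp) - disp (f x) (h2 p) (h2 ?y)) + Li (?c' q - ?c' (h2 p))"
          by (simp add: G_def H_def linear_diff[OF Li(1)] Li(2) linear_diff[OF L])
        then have "?N (G u - ?cp) \<le> ?N (Li (?L (u - ?cp) - disp (f x) (h2 p) (h2 ?y))) + ?N (Li (?c' q - ?c' (h2 p)))"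
          by (metis tnorm_triangle)
        also have "\<dots> \<le> \<epsilon> * (r / a) / s\<^sup>2 + a * r * ((s + 1) / 2) / s\<^sup>2"
        proof (intro add_mono)
          show "?N (Li (?L (u - ?cp) - disp (f x) (h2 p) (h2 ?y))) \<le> \<epsilon> * (r / a) / s\<^sup>2"
            using NLi[of "?L (u - ?cp) - disp (f x) (h2 p) (h2 ?y)"] 1 s2
            by (subst (asm) tnorm_minus) (meson divide_right_mono less_imp_le order_trans)
          show "?N (Li (?c' q - ?c' (h2 p))) \<le> a * r * ((s + 1) / 2) / s\<^sup>2"
            using NLi[of "?c' q - ?c' (h2 p)"] 3 s2 by (meson divide_right_mono less_imp_le order_trans)
        qed
        also have "\<dots> = (r / a) * ((\<epsilon> + (a * a) * ((s + 1) / 2)) / s\<^sup>2)"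
          using a(1) s by (simp add: field_simps)
        also have "(\<epsilon> + (a * a) * ((s + 1) / 2)) / s\<^sup>2 = 1"
          using s by (simp add: a(2) \<epsilon>_def power2_eq_square field_simps)
        finally show ?thesis by (simp add: K_def)
      qed
      then show "G \<in> K \<rightarrow> K" by blast
    qed (use that in blast)+
    then obtain u where u: "u \<in> K" "G u = u" by blast
    let ?y = "par x u"
    have "Li (?c' q - H u) = 0" using u(2) by (simp add: G_def)
    then have "?c' q - H u = 0" using Li(3)[of "?c' q - H u"] linear_0[OF L] by simp
    then have "?c' (h2 ?y) = ?c' q" by (simp add: H_def)
    moreover have "h2 ?y \<in> dom (f x)" using d4(3)[OF h4(2) Kpar(2)[OF u(1)]] by simp
    ultimately have "h2 ?y = q" using qd(2) by (metis par_coord)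
    moreover have "Q p ?y \<le> r"
    proof -
      have "Q p ?y \<le> a * ?N (disp x p ?y)" by (rule d2(2)[OF p4(2) Kpar(3)[OF u(1)]])
      also have "disp x p ?y = u - ?cp" using coord_par[OF Kpar(1)[OF u(1)]] by simp
      also have "a * ?N (u - ?cp) \<le> a * (r / a)" using u(1) a(1) by (intro mult_left_mono) (auto simp: K_def)
      also have "\<dots> = r" using a(1) by simp
      finally show ?thesis .
    qed
    ultimately show ?thesis by blast
  qed
  then show ?thesis using d(1) by blast
qed

end

section \<open>Continuation of repellers\<close>

text \<open>The preimage of a closed set is the projection of a compact part of the graph.\<close>

lemma continuous_on_compact_graph:
  fixes f :: "'a::t2_space \<Rightarrow> 'b::t2_space"
  assumes S: "compact S" and gr: "compact ((\<lambda>x. (x, f x)) ` S)"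
  shows "continuous_on S f"
proof (subst continuous_on_closed_vimage[OF compact_imp_closed[OF S]], intro allI impI)
  fix C :: "'b set" assume "closed C"
  then have "compact ((\<lambda>x. (x, f x)) ` S \<inter> (UNIV \<times> C))"
    by (intro compact_Int_closed gr closed_Times) auto
  then have "compact (fst ` ((\<lambda>x. (x, f x)) ` S \<inter> (UNIV \<times> C)))"
    by (intro compact_continuous_image continuous_on_fst continuous_on_id)
  moreover have "fst ` ((\<lambda>x. (x, f x)) ` S \<inter> (UNIV \<times> C)) = f -` C \<inter> S" by force
  ultimately show "closed (f -` C \<inter> S)" by (simp add: compact_imp_closed)
qed

context embedded_manifold
begin

text \<open>The covering property treats the two maps symmetrically, so orbits of \<open>f\<close>
  can be shadowed by \<open>h\<close> and orbits of \<open>h\<close> by \<open>f\<close>. The radius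
  \<open>r\<close> stays free, since the shadowing must be as precise as the prescribed
  closeness.\<close>

definition adapted_nbhd :: "('m \<Rightarrow> 'm) \<Rightarrow> 'm set \<Rightarrow> real \<Rightarrow> real \<Rightarrow> bool" where
  "adapted_nbhd f \<Lambda> \<kappa> d \<longleftrightarrow> \<kappa> > 1 \<and> d > 0 \<and>
     (\<forall>x\<in>\<Lambda>. \<forall>y\<in>ball x d. \<forall>z\<in>ball x d. \<forall>h. C1_near f d h \<longrightarrow>
        \<kappa> * Q y z \<le> Q (h y) (h z) \<and> (\<forall>v. \<kappa> * tnorm g y v \<le> tnorm g (h y) (manifold_deriv A h y v))) \<and>
     (\<forall>x\<in>\<Lambda>. \<forall>p\<in>ball x d. \<forall>r h1 h2 q. 0 < r \<and> r \<le> d \<and> C1_near f (d * r) h1 \<and> C1_near f (d * r) h2 \<and>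
        Q (h1 p) q \<le> r \<longrightarrow> (\<exists>y. Q p y \<le> r \<and> h2 y = q))"

lemma adapted_nbhd_exists:
  assumes f: "C1_map A f" and rep: "repeller A g f \<Lambda>"
  obtains \<kappa> d where "adapted_nbhd f \<Lambda> \<kappa> d"
proof -
  have K: "compact \<Lambda>" using rep by (simp add: repeller_def)
  obtain k where k: "k > 1" "\<And>x v. x \<in> \<Lambda> \<Longrightarrow> k * tnorm g x v \<le> tnorm g (f x) (manifold_deriv A f x v)"
    using rep by (auto simp: repeller_def)
  define s where "s = sqrt k"
  have s: "s > 1" "s\<^sup>2 = k" using k(1) by (auto simp: s_def)
  have exp: "s\<^sup>2 * tnorm g x v \<le> tnorm g (f x) (manifold_deriv A f x v)" if "x \<in> \<Lambda>" for x v
    using k(2)[OF that] s(2) by simp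
  define R1 where "R1 d y z \<longleftrightarrow> (\<forall>h. C1_near f d h \<longrightarrow>
      (1 + s) / 2 * Q y z \<le> Q (h y) (h z) \<and> (\<forall>v. (1 + s) / 2 * tnorm g y v \<le> tnorm g (h y) (manifold_deriv A h y v)))"
    for d y z
  define R2 where "R2 d p z \<longleftrightarrow> (\<forall>r h1 h2 q. 0 < r \<and> r \<le> d \<and> C1_near f (d * r) h1 \<and> C1_near f (d * r) h2 \<and>
        Q (h1 p) q \<le> r \<longrightarrow> (\<exists>y. Q p y \<le> r \<and> h2 y = q))" for d p and z :: 'm
  have "\<forall>x\<in>\<Lambda>. \<exists>d>0. \<forall>y\<in>ball x d. \<forall>z\<in>ball x d. R1 d y z"
    unfolding R1_def using C1_near_expands[OF f s(1) exp] by simp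
  moreover have m1: "\<forall>d d' y z. R1 d y z \<longrightarrow> 0 < d' \<longrightarrow> d' \<le> d \<longrightarrow> R1 d' y z"
    unfolding R1_def using C1_near_mono by blast
  ultimately obtain d1 where d1: "d1 > 0" "\<forall>x\<in>\<Lambda>. \<forall>y\<in>ball x d1. \<forall>z\<in>ball x d1. R1 d1 y z"
    using compact_local_uniform[OF K] by blast
  have "\<forall>x\<in>\<Lambda>. \<exists>d>0. \<forall>p\<in>ball x d. \<forall>z\<in>ball x d. R2 d p z"
    unfolding R2_def using C1_near_covers[OF f s(1) exp] by simp
  moreover have m2: "\<forall>d d' p z. R2 d p z \<longrightarrow> 0 < d' \<longrightarrow> d' \<le> d \<longrightarrow> R2 d' p z"
  proof (intro allI impI)
    fix d d' p z assume R: "R2 d p z" and d': "0 < d'" "d' \<le> d"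
    show "R2 d' p z"
      unfolding R2_def
    proof (intro allI impI)
      fix r h1 h2 q assume h: "0 < r \<and> r \<le> d' \<and> C1_near f (d' * r) h1 \<and> C1_near f (d' * r) h2 \<and> Q (h1 p) q \<le> r"
      have "d' * r \<le> d * r" using h d' by simp
      then show "\<exists>y. Q p y \<le> r \<and> h2 y = q"
        using h d' R C1_near_mono unfolding R2_def by (meson order_trans)
    qed
  qed
  ultimately obtain d2 where d2: "d2 > 0" "\<forall>x\<in>\<Lambda>. \<forall>y\<in>ball x d2. \<forall>z\<in>ball x d2. R2 d2 y z"
    using compact_local_uniform[OF K] by blast
  define d where "d = min d1 d2"
  have d: "d > 0" "d \<le> d1" "d \<le> d2" using d1 d2 by (auto simp: d_def)
  have 1: "R1 d y z" if "x \<in> \<Lambda>" "y \<in> ball x d" "z \<in> ball x d" for x y z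
    using that d d1(2) m1 by (meson subset_ball subsetD)
  have 2: "R2 d y y" if "x \<in> \<Lambda>" "y \<in> ball x d" for x y
    using that d d2(2) m2 by (meson subset_ball subsetD)
  have "1 < (1 + s) / 2" using s(1) by simp
  then have "adapted_nbhd f \<Lambda> ((1 + s) / 2) d"
    unfolding adapted_nbhd_def using d(1) 1[unfolded R1_def] 2[unfolded R2_def] by blast
  then show ?thesis using that by blast
qed

section \<open>Expansivity, shadowing and the conjugacy\<close>

context
  fixes f \<Lambda> \<kappa> d
  assumes f: "C1_map A f" and ad: "adapted_nbhd f \<Lambda> \<kappa> d"
begin

lemma adapted_pos: "\<kappa> > 1" "d > 0"
  using ad by (auto simp: adapted_nbhd_def)

lemma adapted_expands:
  assumes "x \<in> \<Lambda>" "y \<in> ball x d" "z \<in> ball x d" "C1_near f d h"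
  shows "\<kappa> * Q y z \<le> Q (h y) (h z)" "\<kappa> * tnorm g y v \<le> tnorm g (h y) (manifold_deriv A h y v)"
  using ad assms unfolding adapted_nbhd_def by blast+

lemma adapted_covers:
  assumes "x \<in> \<Lambda>" "p \<in> ball x d" "0 < r" "r \<le> d" "C1_near f (d * r) h1" "C1_near f (d * r) h2" "Q (h1 p) q \<le> r"
  obtains y where "Q p y \<le> r" "h2 y = q"
  using ad assms unfolding adapted_nbhd_def by blast

text \<open>\<open>Q\<close> between the two orbits would grow at least like
  \<open>\<kappa> ^ n\<close>, yet it is bounded because the manifold is compact.\<close>

lemma adapted_expansive:
  assumes h: "C1_near f d h"
    and near: "\<And>n. \<exists>x\<in>\<Lambda>. (h ^^ n) y \<in> ball x d \<and> (h ^^ n) z \<in> ball x d"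
  shows "y = z"
proof (rule ccontr)
  assume "y \<noteq> z"
  then have q: "Q y z > 0" using Q_eq_0 Q_nonneg[of y z] by (metis order_le_less)
  have pow: "\<kappa> ^ n * Q y z \<le> Q ((h ^^ n) y) ((h ^^ n) z)" for n
  proof (induction n)
    case (Suc n)
    obtain x where "x \<in> \<Lambda>" "(h ^^ n) y \<in> ball x d" "(h ^^ n) z \<in> ball x d" using near by blast
    from adapted_expands(1)[OF this h]
    have "\<kappa> * Q ((h ^^ n) y) ((h ^^ n) z) \<le> Q ((h ^^ Suc n) y) ((h ^^ Suc n) z)" by simp
    moreover have "\<kappa> * (\<kappa> ^ n * Q y z) \<le> \<kappa> * Q ((h ^^ n) y) ((h ^^ n) z)"
      using Suc adapted_pos(1) by (intro mult_left_mono) auto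
    ultimately show ?case by (simp add: mult.assoc)
  qed simp
  have "bounded (range \<iota>)"
    by (intro compact_imp_bounded compact_continuous_image embedding_continuous compact_manifold)
  then obtain M where M: "\<And>x. norm (\<iota> x) \<le> M" by (auto simp: bounded_iff)
  have bd: "Q u v \<le> Cemb * (2 * M)" for u v
  proof -
    have "norm (\<iota> v - \<iota> u) \<le> 2 * M" using norm_triangle_ineq4[of "\<iota> v" "\<iota> u"] M[of u] M[of v] by linarith
    then have "Cemb * norm (\<iota> v - \<iota> u) \<le> Cemb * (2 * M)" using Cemb(1) by (intro mult_left_mono) auto
    then show ?thesis using Q_le[of u v] by linarith
  qed
  obtain n where "Cemb * (2 * M) / Q y z < \<kappa> ^ n"
    using real_arch_pow[OF adapted_pos(1)] by blast
  then have "Cemb * (2 * M) < \<kappa> ^ n * Q y z" using q by (simp add: divide_less_eq)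
  then show False using pow[of n] bd[of "(h ^^ n) y" "(h ^^ n) z"] by linarith
qed

text \<open>Finite orbit segments are shadowed by pulling back with the covering property; the
  points shadowing ever longer segments form a decreasing sequence of nonempty compact sets.\<close>

lemma adapted_shadowing:
  assumes r: "0 < r" "r \<le> d" and h: "C1_near f (d * r) h1" "C1_near f (d * r) h2"
    and p: "\<And>n. \<exists>x\<in>\<Lambda>. (h1 ^^ n) p \<in> ball x d"
  obtains y where "\<And>n. Q ((h1 ^^ n) p) ((h2 ^^ n) y) \<le> r"
proof -
  define F where "F n = (\<Inter>i\<le>n. {y. Q ((h1 ^^ i) p) ((h2 ^^ i) y) \<le> r})" for n
  have cont: "continuous_on UNIV h2" using h(2) C1_map_continuous by (simp add: C1_near_def)
  have "closed (F n)" for n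
    unfolding F_def
    by (intro closed_INT ballI closed_Collect_le continuous_on_const
        continuous_on_compose2[OF Q_continuous iterate_continuous[OF cont]]) auto
  then have "compact (F n)" for n
    using compact_Int_closed[OF compact_manifold] by (metis Int_UNIV_left)
  moreover have "F n \<noteq> {}" for n
  proof -
    \<comment> \<open>The induction extends the segment at its beginning: a point shadowing the
      orbit of \<open>h1 p\<close> is lifted to a preimage near \<open>p\<close>, and
      \<open>r\<close> does not deteriorate. Hence the base point is generalized.\<close>
    have "\<exists>y. \<forall>i\<le>n. Q ((h1 ^^ i) p) ((h2 ^^ i) y) \<le> r" if "\<And>n. \<exists>x\<in>\<Lambda>. (h1 ^^ n) p \<in> ball x d" for p
      using that
    proof (induction n arbitrary: p)
      case 0
      then show ?case using Q_self[of p] r by (intro exI[of _ p]) simp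
    next
      case (Suc n)
      have sh: "(h1 ^^ i) (h1 p) = (h1 ^^ Suc i) p" for i by (simp add: funpow_swap1)
      have "\<exists>x\<in>\<Lambda>. (h1 ^^ i) (h1 p) \<in> ball x d" for i
        unfolding sh by (rule Suc.prems)
      from Suc.IH[OF this] obtain y' where y': "\<And>i. i \<le> n \<Longrightarrow> Q ((h1 ^^ i) (h1 p)) ((h2 ^^ i) y') \<le> r" by blast
      obtain x where x: "x \<in> \<Lambda>" "p \<in> ball x d" using Suc.prems[of 0] by auto
      have "Q (h1 p) y' \<le> r" using y'[of 0] by simp
      then obtain y where y: "Q p y \<le> r" "h2 y = y'" using adapted_covers[OF x r h] by blast
      have "Q ((h1 ^^ i) p) ((h2 ^^ i) y) \<le> r" if i: "i \<le> Suc n" for i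
      proof (cases i)
        case 0 then show ?thesis using y(1) by simp
      next
        case (Suc j)
        then show ?thesis using y'[of j] i y(2) by (simp add: funpow_swap1)
      qed
      then show ?case by blast
    qed
    from this[OF p] obtain y where "\<forall>i\<le>n. Q ((h1 ^^ i) p) ((h2 ^^ i) y) \<le> r" by blast
    then have "y \<in> F n" by (simp add: F_def)
    then show ?thesis by blast
  qed
  moreover have "F n \<subseteq> F m" if "m \<le> n" for m n using that by (auto simp: F_def)
  ultimately have "(\<Inter>n. F n) \<noteq> {}" by (rule compact_decreasing_Inter)
  then obtain y where "y \<in> F n" for n by blast
  then have "Q ((h1 ^^ n) p) ((h2 ^^ n) y) \<le> r" for n unfolding F_def by blast
  then show ?thesis using that by blast
qed

lemma conjugacy_iterate:
  assumes "f ` \<Lambda> \<subseteq> \<Lambda>" "\<forall>x\<in>\<Lambda>. \<pi> (f x) = h (\<pi> x)" "x \<in> \<Lambda>"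
  shows "\<pi> ((f ^^ n) x) = (h ^^ n) (\<pi> x)"
  by (induction n) (use assms iterate_in[OF assms(1)] in auto)

text \<open>Both conjugacies send \<open>x\<close> to points whose \<open>h\<close>-orbits stay
  within \<open>d\<close> of the \<open>f\<close>-orbit of \<open>x\<close>; expansivity of
  \<open>h\<close> identifies them.\<close>

lemma continuation_unique:
  assumes fL: "f ` \<Lambda> \<subseteq> \<Lambda>" and h: "C1_near f d h" and \<eta>: "\<eta> \<le> d"
    and c1: "repeller_continuation A g \<eta> f \<Lambda> h \<Lambda>1" and c2: "repeller_continuation A g \<eta> f \<Lambda> h \<Lambda>2"
  shows "\<Lambda>1 = \<Lambda>2"
proof -
  obtain \<pi>1 where 1: "\<pi>1 ` \<Lambda> = \<Lambda>1" "\<And>x. x \<in> \<Lambda> \<Longrightarrow> dist (\<pi>1 x) x < \<eta>" "\<forall>x\<in>\<Lambda>. \<pi>1 (f x) = h (\<pi>1 x)"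
    using c1 by (auto simp: repeller_continuation_def homeomorphism_def)
  obtain \<pi>2 where 2: "\<pi>2 ` \<Lambda> = \<Lambda>2" "\<And>x. x \<in> \<Lambda> \<Longrightarrow> dist (\<pi>2 x) x < \<eta>" "\<forall>x\<in>\<Lambda>. \<pi>2 (f x) = h (\<pi>2 x)"
    using c2 by (auto simp: repeller_continuation_def homeomorphism_def)
  have "\<pi>1 x = \<pi>2 x" if x: "x \<in> \<Lambda>" for x
  proof (rule adapted_expansive[OF h])
    fix n
    have fx: "(f ^^ n) x \<in> \<Lambda>" by (rule iterate_in[OF fL x])
    have "(h ^^ n) (\<pi>1 x) \<in> ball ((f ^^ n) x) d"
      using 1(2)[OF fx] conjugacy_iterate[where \<pi> = \<pi>1 and h = h and n = n, OF fL 1(3) x] \<eta> by (simp add: dist_commute)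
    moreover have "(h ^^ n) (\<pi>2 x) \<in> ball ((f ^^ n) x) d"
      using 2(2)[OF fx] conjugacy_iterate[where \<pi> = \<pi>2 and h = h and n = n, OF fL 2(3) x] \<eta> by (simp add: dist_commute)
    ultimately show "\<exists>p\<in>\<Lambda>. (h ^^ n) (\<pi>1 x) \<in> ball p d \<and> (h ^^ n) (\<pi>2 x) \<in> ball p d" using fx by blast
  qed
  then show ?thesis using 1(1) 2(1) by auto
qed

lemma repeller_expansive:
  assumes fL: "f ` \<Lambda> \<subseteq> \<Lambda>"
  shows "expansive_on \<Lambda> f (d / 2)"
  unfolding expansive_on_def
proof (intro ballI impI)
  fix x y assume xy: "x \<in> \<Lambda>" "y \<in> \<Lambda>" and near: "\<forall>n. dist ((f ^^ n) x) ((f ^^ n) y) \<le> d / 2"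
  show "x = y"
  proof (rule adapted_expansive[OF C1_near_self[OF f adapted_pos(2)]])
    fix n
    have "(f ^^ n) x \<in> \<Lambda>" by (rule iterate_in[OF fL xy(1)])
    moreover have "(f ^^ n) y \<in> ball ((f ^^ n) x) d" "(f ^^ n) x \<in> ball ((f ^^ n) x) d"
      using near[rule_format, of n] adapted_pos(2) by auto
    ultimately show "\<exists>p\<in>\<Lambda>. (f ^^ n) x \<in> ball p d \<and> (f ^^ n) y \<in> ball p d" by blast
  qed
qed

text \<open>The conjugacy assigns to \<open>x\<close> the unique point whose \<open>h\<close>-orbit
  shadows the \<open>f\<close>-orbit of \<open>x\<close>. Uniqueness gives the conjugacy equation
  and a closed graph; expansivity of \<open>f\<close> gives injectivity; shadowing in the other
  direction shows that the image is isolated.\<close>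

lemma continuation_exists:
  assumes rep: "repeller A g f \<Lambda>" and \<eta>: "\<eta> > 0"
  obtains \<delta> where "\<delta> > 0" "\<And>h. C1_near f \<delta> h \<Longrightarrow> \<exists>\<Lambda>'. repeller_continuation A g \<eta> f \<Lambda> h \<Lambda>'"
proof -
  have K: "compact \<Lambda>" and fL: "f ` \<Lambda> \<subseteq> \<Lambda>" using rep by (auto simp: repeller_def)
  obtain U where U: "open U" "\<Lambda> \<subseteq> U" "\<Lambda> = {x \<in> U. \<forall>n. (f ^^ n) x \<in> U}" using rep by (auto simp: repeller_def)
  obtain s0 where s0: "s0 > 0" "(\<Union>x\<in>\<Lambda>. ball x s0) \<subseteq> U"
    using compact_subset_open_imp_ball_epsilon_subset[OF K U(1,2)] by blast
  note d = adapted_pos(2)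
  \<comment> \<open>\<open>d / 2\<close>: points \<sigma>-close to a common point are
    \<open>d\<close>-close, within reach of expansivity. \<open>s0 / 2\<close>: a shadow of an orbit
    near \<open>\<Lambda>\<close> stays in the isolating neighbourhood \<open>U\<close>. \<eta> is
    the required closeness.\<close>
  define \<sigma> where "\<sigma> = Min {d / 2, s0 / 2, \<eta>}"
  have \<sigma>: "\<sigma> > 0" "2 * \<sigma> \<le> d" "2 * \<sigma> \<le> s0" "\<sigma> \<le> \<eta>" using d s0(1) \<eta> by (auto simp: \<sigma>_def min_def)
  obtain rQ where rQ: "rQ > 0" "\<And>y z. Q y z \<le> rQ \<Longrightarrow> dist y z < \<sigma>" using Q_dist[OF \<sigma>(1)] by blast
  define r where "r = Min {d, rQ, 1}"
  have r: "0 < r" "r \<le> d" "r \<le> rQ" "r \<le> 1" using d rQ(1) by (auto simp: r_def)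
  have Qr: "dist y z < \<sigma>" if "Q y z \<le> r" for y z using that r(3) by (intro rQ(2)) simp
  show ?thesis
  proof (rule that)
    show "d * r > 0" using d r by simp
    fix h assume h: "C1_near f (d * r) h"
    have hd: "C1_near f d h" using h d r(4) by (intro C1_near_mono[OF h]) (simp add: mult_left_le)
    have ff: "C1_near f (d * r) f" "C1_near f d f" using C1_near_self[OF f] d r(1) by auto
    have hc: "continuous_on UNIV h" using h C1_map_continuous by (simp add: C1_near_def)
    note fc = C1_map_continuous[OF f]
    have uniq: "y = z" if x: "x \<in> \<Lambda>" and near: "\<And>n. dist ((f ^^ n) x) ((h ^^ n) y) \<le> \<sigma>" "\<And>n. dist ((f ^^ n) x) ((h ^^ n) z) \<le> \<sigma>" for x y z
    proof (rule adapted_expansive[OF hd])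
      fix n
      have "(f ^^ n) x \<in> \<Lambda>" by (rule iterate_in[OF fL x])
      moreover have "(h ^^ n) y \<in> ball ((f ^^ n) x) d" "(h ^^ n) z \<in> ball ((f ^^ n) x) d"
        using near(1)[of n] near(2)[of n] \<sigma>(1,2) by auto
      ultimately show "\<exists>x\<in>\<Lambda>. (h ^^ n) y \<in> ball x d \<and> (h ^^ n) z \<in> ball x d" by blast
    qed
    have "\<exists>y. \<forall>n. Q ((f ^^ n) x) ((h ^^ n) y) \<le> r" if x: "x \<in> \<Lambda>" for x
    proof -
      have "\<exists>p\<in>\<Lambda>. (f ^^ n) x \<in> ball p d" for n
        using iterate_in[OF fL x] d by (metis centre_in_ball)
      then obtain y where "\<And>n. Q ((f ^^ n) x) ((h ^^ n) y) \<le> r"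
        using adapted_shadowing[OF r(1,2) ff(1) h] by blast
      then show ?thesis by blast
    qed
    then obtain \<pi> where \<pi>Q: "\<And>x n. x \<in> \<Lambda> \<Longrightarrow> Q ((f ^^ n) x) ((h ^^ n) (\<pi> x)) \<le> r" by metis
    have \<pi>: "dist ((f ^^ n) x) ((h ^^ n) (\<pi> x)) < \<sigma>" if "x \<in> \<Lambda>" for x n using Qr[OF \<pi>Q[OF that]] .
    have conj: "\<pi> (f x) = h (\<pi> x)" if x: "x \<in> \<Lambda>" for x
    proof (rule uniq)
      show "f x \<in> \<Lambda>" using fL x by blast
      then show "dist ((f ^^ n) (f x)) ((h ^^ n) (\<pi> (f x))) \<le> \<sigma>" for n using \<pi> by (simp add: less_imp_le)
      show "dist ((f ^^ n) (f x)) ((h ^^ n) (h (\<pi> x))) \<le> \<sigma>" for n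
        using \<pi>[OF x, of "Suc n"] by (simp add: funpow_swap1)
    qed
    \<comment> \<open>By uniqueness the graph consists of all pairs whose orbits stay
      \<sigma>-close, with weak inequalities, and is therefore closed.\<close>
    have cont: "continuous_on \<Lambda> \<pi>"
    proof (rule continuous_on_compact_graph[OF K])
      have "(\<lambda>x. (x, \<pi> x)) ` \<Lambda> = (\<Lambda> \<times> UNIV) \<inter> (\<Inter>n. {p. dist ((f ^^ n) (fst p)) ((h ^^ n) (snd p)) \<le> \<sigma>})"
      proof (intro equalityI subsetI)
        fix p assume "p \<in> (\<lambda>x. (x, \<pi> x)) ` \<Lambda>"
        then show "p \<in> (\<Lambda> \<times> UNIV) \<inter> (\<Inter>n. {p. dist ((f ^^ n) (fst p)) ((h ^^ n) (snd p)) \<le> \<sigma>})"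
          using \<pi> by (auto intro: less_imp_le)
      next
        fix p assume p: "p \<in> (\<Lambda> \<times> UNIV) \<inter> (\<Inter>n. {p. dist ((f ^^ n) (fst p)) ((h ^^ n) (snd p)) \<le> \<sigma>})"
        then have fp: "fst p \<in> \<Lambda>" by auto
        have "snd p = \<pi> (fst p)"
          by (rule uniq[OF fp]) (use p \<pi>[OF fp] in \<open>auto intro: less_imp_le\<close>)
        then have "p = (fst p, \<pi> (fst p))" by (simp add: prod_eq_iff)
        then show "p \<in> (\<lambda>x. (x, \<pi> x)) ` \<Lambda>" using fp by (rule image_eqI)
      qed
      moreover have "closed {p. dist ((f ^^ n) (fst p)) ((h ^^ n) (snd p)) \<le> \<sigma>}" for n
        by (intro closed_Collect_le continuous_intros
            continuous_on_compose2[OF iterate_continuous[OF fc]] continuous_on_compose2[OF iterate_continuous[OF hc]]) auto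
      ultimately show "compact ((\<lambda>x. (x, \<pi> x)) ` \<Lambda>)"
        using compact_Times[OF K compact_manifold] by (simp only:) (intro compact_Int_closed closed_INT ballI)
    qed
    have inj: "inj_on \<pi> \<Lambda>"
    proof (rule inj_onI)
      fix x x' assume x: "x \<in> \<Lambda>" "x' \<in> \<Lambda>" "\<pi> x = \<pi> x'"
      show "x = x'"
      proof (rule adapted_expansive[OF ff(2)])
        fix n
        have "dist ((f ^^ n) x) ((f ^^ n) x') < d"
          using \<pi>[OF x(1), of n] \<pi>[OF x(2), of n] x(3) \<sigma>(2) dist_triangle2[of "(f ^^ n) x" "(f ^^ n) x'" "(h ^^ n) (\<pi> x)"]
          by simp
        then show "\<exists>p\<in>\<Lambda>. (f ^^ n) x \<in> ball p d \<and> (f ^^ n) x' \<in> ball p d"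
          using iterate_in[OF fL x(1), of n] d by (intro bexI[of _ "(f ^^ n) x"]) auto
      qed
    qed
    define \<Lambda>' where "\<Lambda>' = \<pi> ` \<Lambda>"
    have "\<exists>\<rho>. homeomorphism \<Lambda> \<Lambda>' \<pi> \<rho>"
      using homeomorphism_compact[OF K cont _ inj] by (simp add: \<Lambda>'_def)
    moreover have "dist (\<pi> x) x < \<eta>" if "x \<in> \<Lambda>" for x
      using \<pi>[OF that, of 0] \<sigma>(4) by (simp add: dist_commute)
    moreover have "repeller A g h \<Lambda>'"
      unfolding repeller_def
    proof (intro conjI)
      show "compact \<Lambda>'" unfolding \<Lambda>'_def by (rule compact_continuous_image[OF cont K])
      show hL: "h ` \<Lambda>' \<subseteq> \<Lambda>'"
      proof -
        have "h (\<pi> x) \<in> \<pi> ` \<Lambda>" if "x \<in> \<Lambda>" for x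
          using conj[OF that, symmetric] fL that by (auto simp: image_subset_iff)
        then show ?thesis by (auto simp: \<Lambda>'_def)
      qed
      \<comment> \<open>The isolating neighbourhood surrounds \<open>\<Lambda>\<close>, not the new
        repeller: an \<open>h\<close>-orbit in \<open>V\<close> is then close enough to
        \<open>\<Lambda>\<close> for shadowing.\<close>
      define V where "V = (\<Union>x\<in>\<Lambda>. ball x \<sigma>)"
      have LV: "\<Lambda>' \<subseteq> V" unfolding \<Lambda>'_def V_def using \<pi>[of _ 0] by auto
      have "\<Lambda>' = {y \<in> V. \<forall>n. (h ^^ n) y \<in> V}"
      proof
        show "\<Lambda>' \<subseteq> {y \<in> V. \<forall>n. (h ^^ n) y \<in> V}" using LV iterate_in[OF hL] by blast
        show "{y \<in> V. \<forall>n. (h ^^ n) y \<in> V} \<subseteq> \<Lambda>'"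
        proof
          fix y assume "y \<in> {y \<in> V. \<forall>n. (h ^^ n) y \<in> V}"
          then have "\<exists>x\<in>\<Lambda>. dist x ((h ^^ n) y) < \<sigma>" for n by (auto simp: V_def)
          then obtain c where c: "\<And>n. c n \<in> \<Lambda>" "\<And>n. dist (c n) ((h ^^ n) y) < \<sigma>" by metis
          have "\<exists>x\<in>\<Lambda>. (h ^^ n) y \<in> ball x d" for n
            using c(1)[of n] c(2)[of n] \<sigma>(1,2) by (intro bexI[of _ "c n"]) auto
          \<comment> \<open>The roles are exchanged here: the orbit of \<open>h\<close> is given and
            \<open>f\<close> supplies the shadow.\<close>
          then obtain x where x: "\<And>n. Q ((h ^^ n) y) ((f ^^ n) x) \<le> r"
            using adapted_shadowing[OF r(1,2) h ff(1)] by blast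
          have near: "dist ((f ^^ n) x) ((h ^^ n) y) < \<sigma>" for n using Qr[OF x[of n]] by (simp add: dist_commute)
          have "(f ^^ n) x \<in> U" for n
          proof -
            have "dist (c n) ((f ^^ n) x) < s0"
              using c(2)[of n] near[of n] \<sigma>(3) dist_triangle2[of "c n" "(f ^^ n) x" "(h ^^ n) y"] by simp
            then show ?thesis using c(1)[of n] by (intro subsetD[OF s0(2)] UN_I[of "c n"]) auto
          qed
          then have "\<forall>n. (f ^^ n) x \<in> U" "x \<in> U" by (metis, metis funpow_0)
          then have xL: "x \<in> \<Lambda>" using U(3) by blast
          have "y = \<pi> x"
            by (rule uniq[OF xL]) (use near \<pi>[OF xL] in \<open>auto intro: less_imp_le\<close>)
          then show "y \<in> \<Lambda>'" using xL by (simp add: \<Lambda>'_def)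
        qed
      qed
      then show "\<exists>U. open U \<and> \<Lambda>' \<subseteq> U \<and> \<Lambda>' = {x \<in> U. \<forall>n. (h ^^ n) x \<in> U}"
        using LV by (intro exI[of _ V]) (auto simp: V_def)
      have "\<kappa> * tnorm g y v \<le> tnorm g (h y) (manifold_deriv A h y v)" if y: "y \<in> \<Lambda>'" for y v
      proof -
        obtain x where x: "x \<in> \<Lambda>" "y = \<pi> x" using y by (auto simp: \<Lambda>'_def)
        then have "y \<in> ball x d" using \<pi>[OF x(1), of 0] \<sigma>(1,2) by simp
        then show ?thesis using adapted_expands(2)[OF x(1) _ _ hd] by blast
      qed
      then show "\<exists>\<kappa>>1. \<forall>x\<in>\<Lambda>'. \<forall>v. \<kappa> * tnorm g x v \<le> tnorm g (h x) (manifold_deriv A h x v)"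
        using adapted_pos(1) by blast
    qed
    ultimately show "\<exists>\<Lambda>'. repeller_continuation A g \<eta> f \<Lambda> h \<Lambda>'"
      unfolding repeller_continuation_def using conj by blast
  qed
qed

end

end

section \<open>The singular valued potential\<close>

text \<open>The function \<open>\<phi>^t\<close> in terms of the ascending eigenvalues, counted from
  0. They are squares of singular values, hence the halves.\<close>

definition sv_potential :: "(nat \<Rightarrow> real) \<Rightarrow> real \<Rightarrow> real" where
  "sv_potential \<mu> t = (\<Sum>j<nat \<lfloor>t\<rfloor>. ln (\<mu> j)) / 2 + (t - real (nat \<lfloor>t\<rfloor>)) * (ln (\<mu> (nat \<lfloor>t\<rfloor>)) / 2)"

text \<open>As a convex combination of the values at two consecutive integers, the potential
  inherits super-additivity from volumes of integral dimension.\<close>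

lemma sv_potential_convex:
  "sv_potential \<mu> t = (1 - (t - real (nat \<lfloor>t\<rfloor>))) * ((\<Sum>j<nat \<lfloor>t\<rfloor>. ln (\<mu> j)) / 2) +
     (t - real (nat \<lfloor>t\<rfloor>)) * ((\<Sum>j<Suc (nat \<lfloor>t\<rfloor>). ln (\<mu> j)) / 2)"
proof -
  have "S / 2 + r * (l / 2) = (1 - r) * (S / 2) + r * ((S + l) / 2)" for S r l :: real
    by (simp add: field_simps)
  then show ?thesis unfolding sv_potential_def sum.lessThan_Suc .
qed

text \<open>Separates the endpoint \<open>t = m\<close>, where the index of the fractional term is
  out of range but its coefficient is 0.\<close>

lemma floor_part:
  assumes "0 \<le> t" "t \<le> real m"
  obtains "nat \<lfloor>t\<rfloor> < m" "0 \<le> t - real (nat \<lfloor>t\<rfloor>)" "t - real (nat \<lfloor>t\<rfloor>) \<le> 1"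
  | "nat \<lfloor>t\<rfloor> = m" "t - real (nat \<lfloor>t\<rfloor>) = 0"
proof -
  have 1: "real (nat \<lfloor>t\<rfloor>) \<le> t" "t < real (nat \<lfloor>t\<rfloor>) + 1" using assms(1) by linarith+
  show ?thesis
  proof (cases "nat \<lfloor>t\<rfloor> < m")
    case True
    moreover have "0 \<le> t - real (nat \<lfloor>t\<rfloor>)" "t - real (nat \<lfloor>t\<rfloor>) \<le> 1" using 1 by linarith+
    ultimately show ?thesis by (rule that(1))
  next
    case False
    then have "real m \<le> real (nat \<lfloor>t\<rfloor>)" by simp
    then have "real (nat \<lfloor>t\<rfloor>) = real m" "t = real m" using 1 assms by linarith+
    then show ?thesis by (intro that(2)) auto
  qed
qed

lemma sv_potential_mono:
  assumes t: "0 \<le> t" "t \<le> real m" and c: "c \<ge> 0" and le: "\<And>j. j < m \<Longrightarrow> ln (\<mu> j) \<le> ln (\<mu>' j) + 2 * c"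
  shows "sv_potential \<mu> t \<le> sv_potential \<mu>' t + t * c"
proof -
  let ?k = "nat \<lfloor>t\<rfloor>"
  have S: "(\<Sum>j<?k. ln (\<mu> j)) \<le> (\<Sum>j<?k. ln (\<mu>' j)) + real ?k * (2 * c)" if "?k \<le> m"
  proof -
    have "(\<Sum>j<?k. ln (\<mu> j)) \<le> (\<Sum>j<?k. ln (\<mu>' j) + 2 * c)" using le that by (intro sum_mono) auto
    then show ?thesis by (simp add: sum.distrib)
  qed
  from t show ?thesis
  proof (cases rule: floor_part)
    case 1
    have "(t - real ?k) * (ln (\<mu> ?k) / 2) \<le> (t - real ?k) * (ln (\<mu>' ?k) / 2 + c)"
      using le[OF 1(1)] 1(2) by (intro mult_left_mono) auto
    then show ?thesis using S 1(1) by (simp add: sv_potential_def algebra_simps)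
  next
    case 2
    then show ?thesis using S by (simp add: sv_potential_def algebra_simps)
  qed
qed

text \<open>Logarithms of the product inequality at \<open>k\<close> and at \<open>k + 1\<close> are
  combined with the nonnegative weights of \<open>sv_potential_convex\<close>.\<close>

lemma sv_potential_superadditive:
  assumes t: "0 \<le> t" "t \<le> real m" and pos: "\<forall>j<m. 0 < \<mu>1 j" "\<forall>j<m. 0 < \<mu>2 j" "\<forall>j<m. 0 < \<mu>3 j"
    and prod: "\<forall>k\<le>m. (\<Prod>j<k. \<mu>1 j) * (\<Prod>j<k. \<mu>2 j) \<le> (\<Prod>j<k. \<mu>3 j)"
  shows "sv_potential \<mu>1 t + sv_potential \<mu>2 t \<le> sv_potential \<mu>3 t"
proof -
  let ?k = "nat \<lfloor>t\<rfloor>"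
  have S: "(\<Sum>j<k. ln (\<mu>1 j)) / 2 + (\<Sum>j<k. ln (\<mu>2 j)) / 2 \<le> (\<Sum>j<k. ln (\<mu>3 j)) / 2" if k: "k \<le> m" for k
  proof -
    have p: "0 < (\<Prod>j<k. \<mu>1 j)" "0 < (\<Prod>j<k. \<mu>2 j)" "0 < (\<Prod>j<k. \<mu>3 j)"
      using pos k by (auto intro!: prod_pos)
    have l: "ln (\<Prod>j<k. \<mu> j) = (\<Sum>j<k. ln (\<mu> j))" if "\<forall>j<m. 0 < \<mu> j" for \<mu> :: "nat \<Rightarrow> real"
    proof (rule ln_prod)
      fix i assume "i \<in> {..<k}"
      then have "0 < \<mu> i" using that k by auto
      then show "\<mu> i \<noteq> 0" by simp
    qed simp
    have "ln ((\<Prod>j<k. \<mu>1 j) * (\<Prod>j<k. \<mu>2 j)) \<le> ln (\<Prod>j<k. \<mu>3 j)"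
      using p prod k by (subst ln_le_cancel_iff) auto
    then have "ln (\<Prod>j<k. \<mu>1 j) + ln (\<Prod>j<k. \<mu>2 j) \<le> ln (\<Prod>j<k. \<mu>3 j)"
      by (simp only: ln_mult_pos[OF p(1,2)])
    then show ?thesis unfolding l[OF pos(1)] l[OF pos(2)] l[OF pos(3)] by simp
  qed
  from t show ?thesis
  proof (cases rule: floor_part)
    case 1
    let ?s = "t - real ?k"
    have "(1 - ?s) * ((\<Sum>j<?k. ln (\<mu>1 j)) / 2 + (\<Sum>j<?k. ln (\<mu>2 j)) / 2) \<le> (1 - ?s) * ((\<Sum>j<?k. ln (\<mu>3 j)) / 2)"
      using S[of ?k] 1 by (intro mult_left_mono) auto
    moreover have "?s * ((\<Sum>j<Suc ?k. ln (\<mu>1 j)) / 2 + (\<Sum>j<Suc ?k. ln (\<mu>2 j)) / 2) \<le> ?s * ((\<Sum>j<Suc ?k. ln (\<mu>3 j)) / 2)"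
      using S[of "Suc ?k"] 1 by (intro mult_left_mono) auto
    ultimately show ?thesis unfolding sv_potential_convex by (simp only: distrib_left)
  next
    case 2
    then show ?thesis using S[of m] by (simp add: sv_potential_def)
  qed
qed

section \<open>The potential on repellers: sign, sub-additivity and continuity\<close>

context embedded_manifold
begin

definition sv_form :: "('m \<Rightarrow> 'm) \<Rightarrow> nat \<Rightarrow> 'm \<Rightarrow> 'e \<Rightarrow> 'e \<Rightarrow> real" where
  "sv_form h n y = pullback_form (g ((h ^^ n) y)) (manifold_deriv A (h ^^ n) y)"

lemma sv_form_eq: "sv_form h n y v v = (tnorm g ((h ^^ n) y) (manifold_deriv A (h ^^ n) y v))\<^sup>2"
  by (simp add: sv_form_def pullback_form_def tnorm_sq)

lemma sv_form_sym:
  assumes "C1_map A h"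
  shows "sym_form (sv_form h n y)"
  unfolding sv_form_def
  by (intro sym_form_pullback inner_form_sym_form metric_inner_form has_mderiv_linear[OF iterate_mderiv(1)[OF assms]])

lemma sv_form_diagonalizes:
  assumes "C1_map A h"
  obtains w \<mu> where "diagonalizes UNIV (g y) (sv_form h n y) DIM('e) w \<mu>"
  using diagonalizes_exists[OF metric_inner_form sv_form_sym[OF assms] subspace_UNIV] by (metis dim_UNIV)

lemma potential_eq:
  assumes h: "C1_map A h" and D: "diagonalizes UNIV (g y) (sv_form h n y) DIM('e) w \<mu>"
    and pos: "\<forall>j<DIM('e). 0 < \<mu> j" and t: "0 \<le> t" "t \<le> real DIM('e)"
  shows "potential_seq A g h t n y = - sv_potential \<mu> t"
proof -
  let ?m = "DIM('e)" and ?k = "nat \<lfloor>t\<rfloor>"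
  have sv: "singular_values (g y) (g ((h ^^ n) y)) (manifold_deriv A (h ^^ n) y) = rev (map (\<lambda>i. sqrt (\<mu> i)) [0..<?m])"
    using singular_values_eq[OF metric_inner_form metric_inner_form has_mderiv_linear[OF iterate_mderiv(1)[OF h]] D[unfolded sv_form_def]] .
  have \<alpha>: "singular_value A g h n y i = sqrt (\<mu> (?m - i))" if "1 \<le> i" "i \<le> ?m" for i
    unfolding singular_value_def sv using that by (simp add: rev_nth)
  have k: "?k \<le> ?m" using t by (cases rule: floor_part) auto
  have "(\<Sum>i = ?m - ?k + 1..?m. ln (singular_value A g h n y i)) = (\<Sum>i = ?m - ?k + 1..?m. ln (\<mu> (?m - i)) / 2)"
  proof (intro sum.cong refl)
    fix i assume "i \<in> {?m - ?k + 1..?m}"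
    then have "1 \<le> i" "i \<le> ?m" "0 < \<mu> (?m - i)" using pos by auto
    then show "ln (singular_value A g h n y i) = ln (\<mu> (?m - i)) / 2" using \<alpha> by (simp add: ln_sqrt)
  qed
  also have "\<dots> = (\<Sum>j<?k. ln (\<mu> j) / 2)"
    by (rule sum.reindex_bij_witness[of _ "\<lambda>j. ?m - j" "\<lambda>i. ?m - i"]) (use k in auto)
  finally have 1: "(\<Sum>i = ?m - ?k + 1..?m. ln (singular_value A g h n y i)) = (\<Sum>j<?k. ln (\<mu> j)) / 2"
    by (simp add: sum_divide_distrib)
  have 2: "(t - real ?k) * ln (singular_value A g h n y (?m - ?k)) = (t - real ?k) * (ln (\<mu> ?k) / 2)"
    using t
  proof (cases rule: floor_part)
    case 1
    then have "0 < \<mu> ?k" "singular_value A g h n y (?m - ?k) = sqrt (\<mu> ?k)"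
      using \<alpha>[of "?m - ?k"] pos by auto
    then show ?thesis by (simp only: ln_sqrt)
  qed simp
  show ?thesis
    unfolding potential_seq_def singular_potential_def Let_def sv_potential_def 1 2 by simp
qed

lemma diagonalizes_eigenvalue:
  assumes h: "C1_map A h" and D: "diagonalizes UNIV (g y) (sv_form h n y) DIM('e) w \<mu>" and j: "j < DIM('e)"
  shows "\<mu> j = (tnorm g ((h ^^ n) y) (manifold_deriv A (h ^^ n) y (w j)))\<^sup>2" "tnorm g y (w j) = 1"
proof -
  show "\<mu> j = (tnorm g ((h ^^ n) y) (manifold_deriv A (h ^^ n) y (w j)))\<^sup>2"
    using diagonalizes_b[OF metric_inner_form sv_form_sym[OF h] D j j] sv_form_eq[of h n y "w j"] by simp
  show "tnorm g y (w j) = 1"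
    using diagonalizes_G[OF metric_inner_form sv_form_sym[OF h] D j j] by (simp add: tnorm_def)
qed

text \<open>Keeping only the rate 1 is enough: it makes all eigenvalues at least 1, the derivatives
  injective, and \<open>C1_near_frame\<close> applicable at any time \<open>n\<close>.\<close>

lemma iterate_expands:
  assumes h: "C1_map A h" and rep: "repeller A g h Y" and y: "y \<in> Y"
  shows "tnorm g y v \<le> tnorm g ((h ^^ n) y) (manifold_deriv A (h ^^ n) y v)"
proof (induction n)
  case 0
  show ?case using iterate_mderiv(2)[OF h, of y] by (simp add: id_def)
next
  case (Suc n)
  obtain k where k: "k > 1" "\<And>x v. x \<in> Y \<Longrightarrow> k * tnorm g x v \<le> tnorm g (h x) (manifold_deriv A h x v)"
    using rep by (auto simp: repeller_def)
  have hn: "(h ^^ n) y \<in> Y" using rep y by (intro iterate_in) (auto simp: repeller_def)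
  let ?v = "manifold_deriv A (h ^^ n) y v"
  have "1 * tnorm g ((h ^^ n) y) ?v \<le> k * tnorm g ((h ^^ n) y) ?v"
    using k(1) tnorm_nonneg by (intro mult_right_mono) auto
  then have "tnorm g y v \<le> tnorm g (h ((h ^^ n) y)) (manifold_deriv A h ((h ^^ n) y) ?v)"
    using Suc k(2)[OF hn, of ?v] by linarith
  then show ?case unfolding iterate_mderiv(3)[OF h] by simp
qed

lemma repeller_eigenvalue_ge_1:
  assumes h: "C1_map A h" and rep: "repeller A g h Y" and y: "y \<in> Y"
    and D: "diagonalizes UNIV (g y) (sv_form h n y) DIM('e) w \<mu>" and j: "j < DIM('e)"
  shows "1 \<le> \<mu> j"
proof -
  have "1 \<le> tnorm g ((h ^^ n) y) (manifold_deriv A (h ^^ n) y (w j))"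
    using iterate_expands[OF h rep y, of "w j" n] diagonalizes_eigenvalue(2)[OF h D j] by simp
  then show ?thesis unfolding diagonalizes_eigenvalue(1)[OF h D j] by (simp add: one_le_power)
qed

lemma potential_nonpos:
  assumes h: "C1_map A h" and rep: "repeller A g h Y" and y: "y \<in> Y" and t: "0 \<le> t" "t \<le> real DIM('e)"
  shows "potential_seq A g h t n y \<le> 0"
proof -
  obtain w \<mu> where D: "diagonalizes UNIV (g y) (sv_form h n y) DIM('e) w \<mu>" using sv_form_diagonalizes[OF h] .
  note ge1 = repeller_eigenvalue_ge_1[OF h rep y D]
  have pos: "\<forall>j<DIM('e). 0 < \<mu> j" using ge1 by force
  have "sv_potential (\<lambda>_. 1) t \<le> sv_potential \<mu> t + t * 0"
    by (rule sv_potential_mono[OF t]) (use ge1 in auto)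
  then show ?thesis using potential_eq[OF h D pos t] by (simp add: sv_potential_def)
qed

text \<open>The derivative of the iterate is a composition, and \<open>prod_eigenvalues_comp\<close>
  makes the sums of logarithms super-additive; the potential carries the opposite sign.\<close>

lemma potential_subadditive:
  assumes h: "C1_map A h" and rep: "repeller A g h Y" and y: "y \<in> Y" and t: "0 \<le> t" "t \<le> real DIM('e)"
  shows "potential_seq A g h t (n + m) y \<le> potential_seq A g h t n y + potential_seq A g h t m ((h ^^ n) y)"
proof -
  let ?z = "(h ^^ n) y"
  have z: "?z \<in> Y" using rep y by (intro iterate_in) (auto simp: repeller_def)
  obtain w1 \<mu>1 where D1: "diagonalizes UNIV (g y) (sv_form h n y) DIM('e) w1 \<mu>1" using sv_form_diagonalizes[OF h] .
  obtain w2 \<mu>2 where D2: "diagonalizes UNIV (g ?z) (sv_form h m ?z) DIM('e) w2 \<mu>2" using sv_form_diagonalizes[OF h] .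
  obtain w3 \<mu>3 where D3: "diagonalizes UNIV (g y) (sv_form h (n + m) y) DIM('e) w3 \<mu>3" using sv_form_diagonalizes[OF h] .
  have p1: "\<forall>j<DIM('e). 0 < \<mu>1 j" using repeller_eigenvalue_ge_1[OF h rep y D1] by force
  have p2: "\<forall>j<DIM('e). 0 < \<mu>2 j" using repeller_eigenvalue_ge_1[OF h rep z D2] by force
  have p3: "\<forall>j<DIM('e). 0 < \<mu>3 j" using repeller_eigenvalue_ge_1[OF h rep y D3] by force
  let ?L1 = "manifold_deriv A (h ^^ n) y" and ?L2 = "manifold_deriv A (h ^^ m) ?z"
  have lin: "linear (manifold_deriv A (h ^^ k) x)" for k x using has_mderiv_linear[OF iterate_mderiv(1)[OF h]] .
  have inj: "inj (manifold_deriv A (h ^^ k) x)" if "x \<in> Y" for k x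
  proof (rule linear_injective_0[OF lin, THEN iffD2], intro allI impI)
    fix v assume "manifold_deriv A (h ^^ k) x v = 0"
    then have "\<not> 0 < tnorm g x v" using iterate_expands[OF h rep that, of v k] by simp
    then show "v = 0" using tnorm_pos by blast
  qed
  have nm: "(h ^^ (n + m)) y = (h ^^ m) ?z" by (simp add: add.commute[of n] funpow_add)
  have D3': "diagonalizes UNIV (g y) (pullback_form (g ((h ^^ m) ?z)) (?L2 \<circ> ?L1)) DIM('e) w3 \<mu>3"
    using D3 unfolding sv_form_def iterate_mderiv_add[OF h] nm .
  have "(\<Prod>j<k. \<mu>1 j) * (\<Prod>j<k. \<mu>2 j) \<le> (\<Prod>j<k. \<mu>3 j)" if "k \<le> DIM('e)" for k
    by (rule prod_eigenvalues_comp[OF metric_inner_form metric_inner_form metric_inner_form lin inj[OF y] lin inj[OF z]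
          D1[unfolded sv_form_def] D2[unfolded sv_form_def] D3' _ _ that])
      (use p1 p2 in \<open>auto intro: less_imp_le\<close>)
  then have "\<forall>k\<le>DIM('e). (\<Prod>j<k. \<mu>1 j) * (\<Prod>j<k. \<mu>2 j) \<le> (\<Prod>j<k. \<mu>3 j)" by blast
  from sv_potential_superadditive[OF t p1 p2 p3 this] show ?thesis
    unfolding potential_eq[OF h D1 p1 t] potential_eq[OF h D2 p2 t] potential_eq[OF h D3 p3 t] by simp
qed

text \<open>By \<open>C1_near_frame\<close> the inner products and the pulled back forms at
  \<open>x\<close> and \<open>y\<close> agree up to factors near 1 after transport by
  \<open>frame\<close>; \<open>rayleigh_comparison\<close>, applied in both directions, carries this
  over to the eigenvalues.\<close>

lemma potential_local:
  assumes f: "C1_map A f" and rep: "repeller A g f \<Lambda>" and x: "x \<in> \<Lambda>"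
    and t: "0 \<le> t" "t \<le> real DIM('e)" and \<epsilon>: "\<epsilon> > 0"
  obtains d where "d > 0"
    "\<And>h y. C1_near f d h \<Longrightarrow> y \<in> ball x d \<Longrightarrow> \<bar>potential_seq A g h t n y - potential_seq A g f t n x\<bar> \<le> \<epsilon>"
proof -
  let ?m = "DIM('e)"
  define c where "c = \<epsilon> / (real ?m)"
  have c: "c > 0" "t * c \<le> \<epsilon>"
    using \<epsilon> t mult_right_mono[OF t(2), of c] by (auto simp: c_def)
  \<comment> \<open>Norms agree up to \<open>a\<close>, quadratic forms up to
    \<open>a\<^sup>2\<close>, eigenvalues up to the square of that, which is
    \<open>exp (2 * c)\<close>: the error \<open>2 * c\<close> expected by
    \<open>sv_potential_mono\<close>.\<close>
  define a where "a = exp (c / 2)"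
  have a: "a > 1" "ln (a\<^sup>2) = c" using c(1) by (auto simp: a_def ln_realpow)
  obtain d where d: "d > 0" "ball x d \<subseteq> dom x"
    "\<And>h y w. C1_near f d h \<Longrightarrow> y \<in> ball x d \<Longrightarrow>
      tnorm g x w \<le> a * tnorm g y (frame x y w) \<and>
      tnorm g y (frame x y w) \<le> a * tnorm g x w \<and>
      tnorm g ((f ^^ n) x) (manifold_deriv A (f ^^ n) x w) \<le> a * tnorm g ((h ^^ n) y) (manifold_deriv A (h ^^ n) y (frame x y w)) \<and>
      tnorm g ((h ^^ n) y) (manifold_deriv A (h ^^ n) y (frame x y w)) \<le> a * tnorm g ((f ^^ n) x) (manifold_deriv A (f ^^ n) x w)"
    using C1_near_frame[OF f a(1) iterate_expands[OF f rep x]] by blast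
  show ?thesis
  proof (rule that[OF d(1)])
    fix h y assume h: "C1_near f d h" and y: "y \<in> ball x d"
    have hC: "C1_map A h" using h by (simp add: C1_near_def)
    have yd: "y \<in> dom x" using y d(2) by blast
    let ?T = "frame x y"
    obtain S where S: "(coord x \<circ> par y has_derivative S) (at (coord y y))" "S \<circ> ?T = id" "?T \<circ> S = id"
      using coframe_derivative[OF yd] .
    have T: "linear ?T" "inj ?T" using frame_linear[OF yd] frame_bij[OF yd] by (auto simp: bij_def)
    have Sl: "linear S" "inj S" using has_derivative_linear[OF S(1)] S(3) by (auto intro: inj_on_inverseI[of _ ?T] simp: fun_eq_iff)
    have TS: "?T (S v) = v" for v using S(3) by (simp add: fun_eq_iff)
    obtain w \<mu> where D: "diagonalizes UNIV (g x) (sv_form f n x) ?m w \<mu>" using sv_form_diagonalizes[OF f] .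
    obtain w' \<mu>' where D': "diagonalizes UNIV (g y) (sv_form h n y) ?m w' \<mu>'" using sv_form_diagonalizes[OF hC] .
    have \<mu>: "1 \<le> \<mu> j" if "j < ?m" for j using repeller_eigenvalue_ge_1[OF f rep x D that] .
    have sq: "u\<^sup>2 \<le> a\<^sup>2 * v\<^sup>2" if "u \<le> a * v" "0 \<le> u" for u v
      using power_mono[OF that, of 2] by (simp add: power_mult_distrib)
    note dd = d(3)[OF h y]
    have b1: "sv_form h n y (?T v) (?T v) \<le> a\<^sup>2 * sv_form f n x v v" for v
      unfolding sv_form_eq using dd[of v] tnorm_nonneg by (intro sq) auto
    have b2: "sv_form f n x v v \<le> a\<^sup>2 * sv_form h n y (?T v) (?T v)" for v
      unfolding sv_form_eq using dd[of v] tnorm_nonneg by (intro sq) auto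
    have g1: "g x v v \<le> a\<^sup>2 * g y (?T v) (?T v)" for v
      unfolding tnorm_sq[symmetric] using dd[of v] tnorm_nonneg by (intro sq) auto
    have g2: "g y (?T v) (?T v) \<le> a\<^sup>2 * g x v v" for v
      unfolding tnorm_sq[symmetric] using dd[of v] tnorm_nonneg by (intro sq) auto
    note mi = metric_inner_form and sf = sv_form_sym[OF f] and sh = sv_form_sym[OF hC]
    have nn: "0 \<le> \<mu>' j" if "j < ?m" for j unfolding diagonalizes_eigenvalue(1)[OF hC D' that] by simp
    have up: "\<mu>' j \<le> (a\<^sup>2)\<^sup>2 * \<mu> j" if j: "j < ?m" for j
    proof -
      have "0 \<le> \<mu> j" using \<mu>[OF j] by simp
      then show ?thesis by (intro rayleigh_comparison[OF mi mi sh sf D' D j T] b1 g1) auto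
    qed
    have lo: "\<mu> j \<le> (a\<^sup>2)\<^sup>2 * \<mu>' j" if j: "j < ?m" for j
      by (rule rayleigh_comparison[OF mi mi sf sh D D' j Sl _ nn[OF j]])
        (use b2[of "S _"] g2[of "S _"] in \<open>auto simp: TS\<close>)
    have \<mu>': "0 < \<mu>' j" if j: "j < ?m" for j
      using lo[OF j] \<mu>[OF j] nn[OF j] by (cases "\<mu>' j = 0") auto
    have l2: "ln ((a\<^sup>2)\<^sup>2 * r) = ln r + 2 * c" if "r > 0" for r
      using that a by (simp add: ln_mult ln_realpow)
    have "sv_potential \<mu>' t \<le> sv_potential \<mu> t + t * c"
    proof (rule sv_potential_mono[OF t])
      fix j assume j: "j < ?m"
      have "ln (\<mu>' j) \<le> ln ((a\<^sup>2)\<^sup>2 * \<mu> j)" using up[OF j] \<mu>'[OF j] by simp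
      then show "ln (\<mu>' j) \<le> ln (\<mu> j) + 2 * c" using l2[of "\<mu> j"] \<mu>[OF j] by simp
    qed (use c in simp)
    moreover have "sv_potential \<mu> t \<le> sv_potential \<mu>' t + t * c"
    proof (rule sv_potential_mono[OF t])
      fix j assume j: "j < ?m"
      have "ln (\<mu> j) \<le> ln ((a\<^sup>2)\<^sup>2 * \<mu>' j)" using lo[OF j] \<mu>[OF j] by simp
      then show "ln (\<mu> j) \<le> ln (\<mu>' j) + 2 * c" using l2[OF \<mu>'[OF j]] by simp
    qed (use c in simp)
    moreover have "potential_seq A g h t n y = - sv_potential \<mu>' t" using \<mu>' by (intro potential_eq[OF hC D' _ t]) blast
    moreover have "potential_seq A g f t n x = - sv_potential \<mu> t"
      using \<mu> by (intro potential_eq[OF f D _ t]) (force intro: less_le_trans)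
    ultimately show "\<bar>potential_seq A g h t n y - potential_seq A g f t n x\<bar> \<le> \<epsilon>" using c(2) by linarith
  qed
qed

text \<open>The local estimate is used twice, for \<open>h\<close> at \<open>y\<close> and for
  \<open>f\<close> itself at \<open>z\<close>; this removes the centre \<open>x\<close>, and
  compactness makes the radius uniform.\<close>

lemma potential_uniform:
  assumes f: "C1_map A f" and rep: "repeller A g f \<Lambda>" and t: "0 \<le> t" "t \<le> real DIM('e)" and \<epsilon>: "\<epsilon> > 0"
  obtains d where "d > 0"
    "\<And>h x y. C1_near f d h \<Longrightarrow> x \<in> \<Lambda> \<Longrightarrow> y \<in> ball x d \<Longrightarrow> potential_seq A g h t n y \<le> potential_seq A g f t n x + \<epsilon>"
proof -
  define R where "R d y z \<longleftrightarrow> (\<forall>h. C1_near f d h \<longrightarrow> potential_seq A g h t n y \<le> potential_seq A g f t n z + \<epsilon>)" for d y z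
  have K: "compact \<Lambda>" using rep by (simp add: repeller_def)
  have loc: "\<forall>x\<in>\<Lambda>. \<exists>d>0. \<forall>y\<in>ball x d. \<forall>z\<in>ball x d. R d y z"
  proof
    fix x assume x: "x \<in> \<Lambda>"
    have "\<epsilon> / 2 > 0" using \<epsilon> by simp
    then obtain d where d: "d > 0"
      "\<And>h y. C1_near f d h \<Longrightarrow> y \<in> ball x d \<Longrightarrow> \<bar>potential_seq A g h t n y - potential_seq A g f t n x\<bar> \<le> \<epsilon> / 2"
      using potential_local[OF f rep x t] by metis
    have "R d y z" if "y \<in> ball x d" "z \<in> ball x d" for y z
      unfolding R_def
    proof (intro allI impI)
      fix h assume "C1_near f d h"
      from d(2)[OF this that(1)] d(2)[OF C1_near_self[OF f d(1)] that(2)]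
      show "potential_seq A g h t n y \<le> potential_seq A g f t n z + \<epsilon>" by linarith
    qed
    then show "\<exists>d>0. \<forall>y\<in>ball x d. \<forall>z\<in>ball x d. R d y z" using d(1) by blast
  qed
  have mono: "\<forall>d d' y z. R d y z \<longrightarrow> 0 < d' \<longrightarrow> d' \<le> d \<longrightarrow> R d' y z"
    unfolding R_def using C1_near_mono by blast
  obtain d where d: "d > 0" "\<forall>x\<in>\<Lambda>. \<forall>y\<in>ball x d. \<forall>z\<in>ball x d. R d y z"
    using compact_local_uniform[OF K loc mono] by blast
  show ?thesis
  proof (rule that[OF d(1)])
    fix h x y assume "C1_near f d h" "x \<in> \<Lambda>" "y \<in> ball x d"
    moreover have "x \<in> ball x d" using d(1) by simp
    ultimately show "potential_seq A g h t n y \<le> potential_seq A g f t n x + \<epsilon>" using d(2) unfolding R_def by blast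
  qed
qed

lemma repeller_deriv_bounded:
  assumes f: "C1_map A f" and rep: "repeller A g f \<Lambda>"
  obtains K where "K \<ge> 1" "\<And>x v. x \<in> \<Lambda> \<Longrightarrow> tnorm g (f x) (manifold_deriv A f x v) \<le> K * tnorm g x v"
proof -
  define R where "R d y z \<longleftrightarrow> (\<forall>v. tnorm g (f y) (manifold_deriv A f y v) \<le> (1/d) * tnorm g y v)" for d and y z :: 'm
  have cpt: "compact \<Lambda>" using rep by (simp add: repeller_def)
  have loc: "\<forall>x\<in>\<Lambda>. \<exists>d>0. \<forall>y\<in>ball x d. \<forall>z\<in>ball x d. R d y z"
  proof
    fix x assume x: "x \<in> \<Lambda>"
    obtain d1 where d1: "d1 > 0" "ball x d1 \<subseteq> dom x"
      "\<And>h y w. C1_near f d1 h \<Longrightarrow> y \<in> ball x d1 \<Longrightarrow>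
        tnorm g x w \<le> 2 * tnorm g y (frame x y w) \<and>
        tnorm g y (frame x y w) \<le> 2 * tnorm g x w \<and>
        tnorm g ((f ^^ 1) x) (manifold_deriv A (f ^^ 1) x w) \<le> 2 * tnorm g ((h ^^ 1) y) (manifold_deriv A (h ^^ 1) y (frame x y w)) \<and>
        tnorm g ((h ^^ 1) y) (manifold_deriv A (h ^^ 1) y (frame x y w)) \<le> 2 * tnorm g ((f ^^ 1) x) (manifold_deriv A (f ^^ 1) x w)"
    proof -
      have "(2::real) > 1" by simp
      from C1_near_frame[OF f this iterate_expands[OF f rep x], of 1] show ?thesis using that by blast
    qed
    obtain \<beta> B0 where \<beta>: "\<beta> > 0" "\<And>w. \<beta> * norm w \<le> tnorm g x w" using tnorm_bounds[of x] by metis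
    obtain \<beta>' B where B: "B > 0" "\<And>w. tnorm g (f x) w \<le> B * norm w" using tnorm_bounds[of "f x"] by metis
    obtain C where C: "C > 0" "\<And>w. norm (manifold_deriv A f x w) \<le> C * norm w"
      using linear_bound_pos[OF has_mderiv_linear[OF C1_map_mderiv[OF f]]] by blast
    define d where "d = min d1 (\<beta> / (4 * (B * C)))"
    have d: "d > 0" "d \<le> d1" "d \<le> \<beta> / (4 * (B * C))" using d1(1) \<beta>(1) B(1) C(1) by (auto simp: d_def)
    have "R d y z" if y: "y \<in> ball x d" for y z
      unfolding R_def
    proof
      fix v
      have y1: "y \<in> ball x d1" using y d(2) by simp
      obtain w where w: "v = frame x y w" using frame_bij[of y x] y1 d1(2) by (metis bij_pointE subsetD)
      note dd = d1(3)[OF C1_near_self[OF f d1(1)] y1, of w, folded w, simplified]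
      have "tnorm g (f y) (manifold_deriv A f y v) \<le> 2 * (B * (C * norm w))"
        using dd B(2)[of "manifold_deriv A f x w"] mult_left_mono[OF C(2)[of w], of B] B(1) by linarith
      then have "d * tnorm g (f y) (manifold_deriv A f y v) \<le> (\<beta> / (4 * (B * C))) * (2 * (B * (C * norm w)))"
        using d tnorm_nonneg \<beta>(1) B(1) C(1) by (intro mult_mono) auto
      also have "\<dots> = \<beta> * norm w / 2" using B(1) C(1) by (simp add: field_simps)
      also have "\<dots> \<le> tnorm g y v" using \<beta>(2)[of w] dd by linarith
      finally show "tnorm g (f y) (manifold_deriv A f y v) \<le> (1/d) * tnorm g y v" using d(1) by (simp add: field_simps)
    qed
    then show "\<exists>d>0. \<forall>y\<in>ball x d. \<forall>z\<in>ball x d. R d y z" using d(1) by blast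
  qed
  have mono: "\<forall>d d' y z. R d y z \<longrightarrow> 0 < d' \<longrightarrow> d' \<le> d \<longrightarrow> R d' y z"
  proof (intro allI impI)
    fix d d' y z assume R: "R d y z" "0 < d'" "d' \<le> d"
    have "1/d \<le> 1/d'" using R by (simp add: frac_le)
    then show "R d' y z"
      using R(1) tnorm_nonneg unfolding R_def by (meson mult_right_mono order_trans)
  qed
  obtain d where d: "d > 0" "\<forall>x\<in>\<Lambda>. \<forall>y\<in>ball x d. \<forall>z\<in>ball x d. R d y z"
    using compact_local_uniform[OF cpt loc mono] by blast
  show ?thesis
  proof (rule that[of "max 1 (1/d)"])
    fix x v assume "x \<in> \<Lambda>"
    then have "R d x x" using d by (metis centre_in_ball)
    then show "tnorm g (f x) (manifold_deriv A f x v) \<le> max 1 (1/d) * tnorm g x v"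
      unfolding R_def using tnorm_nonneg[of x v] mult_right_mono[of "1/d" "max 1 (1/d)" "tnorm g x v"]
      by (meson max.cobounded2 order_trans)
  qed simp
qed

text \<open>Derivatives of \<open>f\<close> on \<open>\<Lambda>\<close> are bounded by some
  \<open>K\<close>, so singular values grow at most like \<open>K ^ n\<close>. This excludes
  pressure - \<infinity>.\<close>

lemma potential_lower_bound:
  assumes f: "C1_map A f" and rep: "repeller A g f \<Lambda>" and x: "x \<in> \<Lambda>" and t: "0 \<le> t" "t \<le> real DIM('e)"
  obtains c where "\<And>n. - c * real n \<le> potential_seq A g f t n x"
proof -
  obtain K where K: "K \<ge> 1" "\<And>x v. x \<in> \<Lambda> \<Longrightarrow> tnorm g (f x) (manifold_deriv A f x v) \<le> K * tnorm g x v"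
    using repeller_deriv_bounded[OF f rep] by blast
  have Kn: "tnorm g ((f ^^ n) x) (manifold_deriv A (f ^^ n) x v) \<le> K ^ n * tnorm g x v" for n v
  proof (induction n)
    case 0
    show ?case using iterate_mderiv(2)[OF f, of x] by (simp add: id_def)
  next
    case (Suc n)
    have "(f ^^ n) x \<in> \<Lambda>" using rep x by (intro iterate_in) (auto simp: repeller_def)
    note le = K(2)[OF this, of "manifold_deriv A (f ^^ n) x v"]
    have "tnorm g (f ((f ^^ n) x)) (manifold_deriv A f ((f ^^ n) x) (manifold_deriv A (f ^^ n) x v)) \<le> K ^ Suc n * tnorm g x v"
    proof -
      have "K * tnorm g ((f ^^ n) x) (manifold_deriv A (f ^^ n) x v) \<le> K * (K ^ n * tnorm g x v)"
        using Suc K(1) by (intro mult_left_mono) auto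
      with le show ?thesis by (simp add: mult.assoc)
    qed
    then show ?case unfolding iterate_mderiv(3)[OF f] by simp
  qed
  have "- (t * ln K) * real n \<le> potential_seq A g f t n x" for n
  proof -
    obtain w \<mu> where D: "diagonalizes UNIV (g x) (sv_form f n x) DIM('e) w \<mu>" using sv_form_diagonalizes[OF f] .
    note ge1 = repeller_eigenvalue_ge_1[OF f rep x D]
    have pos: "\<forall>j<DIM('e). 0 < \<mu> j" using ge1 by force
    have "sv_potential \<mu> t \<le> sv_potential (\<lambda>_. 1) t + t * (real n * ln K)"
    proof (rule sv_potential_mono[OF t])
      fix j assume j: "j < DIM('e)"
      have "\<mu> j \<le> (K ^ n)\<^sup>2"
        unfolding diagonalizes_eigenvalue(1)[OF f D j]
        using Kn[of n "w j"] diagonalizes_eigenvalue(2)[OF f D j] tnorm_nonneg by (intro power_mono) auto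
      then have "ln (\<mu> j) \<le> ln ((K ^ n)\<^sup>2)" using pos j K(1) by (subst ln_le_cancel_iff) auto
      also have "\<dots> = 2 * (real n * ln K)" using K(1) by (simp add: ln_realpow)
      finally show "ln (\<mu> j) \<le> ln 1 + 2 * (real n * ln K)" by simp
    qed (use K(1) in simp)
    then show ?thesis using potential_eq[OF f D pos t] by (simp add: sv_potential_def mult_ac)
  qed
  then show ?thesis using that by blast
qed

text \<open>\<open>pressure_block\<close> fixes \<open>N\<close>, \<open>E\<close> and
  \<open>w\<close> from \<open>f\<close>; only then is \<eta> chosen, so that the potentials at time
  \<open>N\<close> differ by at most \<open>\<epsilon> / 2\<close> along the conjugacy.
  \<open>pressure_le_block\<close> concludes.\<close>

lemma pressure_upper_semicontinuous:
  assumes f: "C1_map A f" and rep: "repeller A g f \<Lambda>" and ad: "adapted_nbhd f \<Lambda> \<kappa> d"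
    and t: "0 \<le> t" "t \<le> real DIM('e)" and \<epsilon>: "\<epsilon> > 0"
  obtains \<eta> where "\<eta> > 0"
    "\<And>h \<Lambda>'. C1_near f \<eta> h \<Longrightarrow> repeller_continuation A g \<eta> f \<Lambda> h \<Lambda>' \<Longrightarrow>
      pressure \<Lambda>' h (potential_seq A g h t) \<le> pressure \<Lambda> f (potential_seq A g f t) + ereal \<epsilon>"
proof -
  let ?\<phi> = "potential_seq A g f t"
  have K: "compact \<Lambda>" and fL: "f ` \<Lambda> \<subseteq> \<Lambda>" using rep by (auto simp: repeller_def)
  note fc = C1_map_continuous[OF f]
  show ?thesis
  \<comment> \<open>For an empty repeller the continuation is empty as well, and both pressures are
    the same expression, whatever its value.\<close>
  proof (cases "\<Lambda> = {}")
    case True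
    have "pressure \<Lambda>' h (potential_seq A g h t) \<le> pressure \<Lambda> f ?\<phi> + ereal \<epsilon>"
      if "repeller_continuation A g 1 f \<Lambda> h \<Lambda>'" for h \<Lambda>'
    proof -
      have L: "\<Lambda>' = {}" using that True by (auto simp: repeller_continuation_def homeomorphism_def)
      have "{E. E \<subseteq> {} \<and> separated k n e E} = {{}}" for k :: "'m \<Rightarrow> 'm" and n e
        by (auto simp: separated_def)
      then have "pressure \<Lambda>' h (potential_seq A g h t) = pressure \<Lambda> f ?\<phi>"
        by (simp add: pressure_def L True)
      then show ?thesis using \<epsilon> by (simp add: add_increasing2)
    qed
    then show ?thesis using that[of 1] by simp
  next
    case False
    have \<phi>: "\<forall>n. \<forall>x\<in>\<Lambda>. ?\<phi> n x \<le> 0" using potential_nonpos[OF f rep _ t] by blast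
    obtain x0 where x0: "x0 \<in> \<Lambda>" using False by blast
    obtain c where "\<And>n. - c * real n \<le> ?\<phi> n x0" using potential_lower_bound[OF f rep x0 t] by blast
    from pressure_not_MInfty[OF K False fc \<phi> x0 this] have nmi: "pressure \<Lambda> f ?\<phi> \<noteq> - \<infinity>" .
    show ?thesis
    proof (cases "pressure \<Lambda> f ?\<phi>")
      case (real p)
      have exp: "expansive_on \<Lambda> f (d / 2)" "d / 2 > 0"
        using repeller_expansive[OF f ad fL] ad by (auto simp: adapted_nbhd_def)
      have e2: "\<epsilon> / 2 > 0" using \<epsilon> by simp
      obtain N \<rho> E w where N: "N \<ge> 1" "2 * \<rho> \<le> d / 2" "finite E" "E \<noteq> {}"
        "\<And>x. x \<in> \<Lambda> \<Longrightarrow> \<exists>y\<in>E. (\<forall>i<N. dist ((f ^^ i) y) ((f ^^ i) x) \<le> \<rho>) \<and> ?\<phi> N x \<le> w y"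
        "ln (\<Sum>y\<in>E. exp (w y)) \<le> real N * (p + \<epsilon> / 2)"
        using pressure_block[OF K False fc fL \<phi> exp real e2] by blast
      obtain \<eta> where \<eta>: "\<eta> > 0"
        "\<And>h x y. C1_near f \<eta> h \<Longrightarrow> x \<in> \<Lambda> \<Longrightarrow> y \<in> ball x \<eta> \<Longrightarrow> potential_seq A g h t N y \<le> ?\<phi> N x + \<epsilon> / 2"
        using potential_uniform[OF f rep t e2, of N] by blast
      have "pressure \<Lambda>' h (potential_seq A g h t) \<le> pressure \<Lambda> f ?\<phi> + ereal \<epsilon>"
        if h: "C1_near f \<eta> h" and con: "repeller_continuation A g \<eta> f \<Lambda> h \<Lambda>'" for h \<Lambda>'
      proof -
        have hC: "C1_map A h" using h by (simp add: C1_near_def)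
        have rep': "repeller A g h \<Lambda>'" using con by (simp add: repeller_continuation_def)
        obtain \<pi> where \<pi>: "continuous_on \<Lambda> \<pi>" "\<pi> ` \<Lambda> = \<Lambda>'" "\<And>x. x \<in> \<Lambda> \<Longrightarrow> dist (\<pi> x) x < \<eta>"
          "\<And>x. x \<in> \<Lambda> \<Longrightarrow> \<pi> (f x) = h (\<pi> x)"
          using con by (auto simp: repeller_continuation_def homeomorphism_def)
        have "pressure \<Lambda>' h (potential_seq A g h t) \<le> ereal ((ln (\<Sum>y\<in>E. exp (w y)) + \<epsilon> / 2) / real N)"
        proof (rule pressure_le_block[OF K False fc fL exp(1) N(1-5) C1_map_continuous[OF hC] \<pi>(1,2,4)])
          show "\<forall>n. \<forall>y\<in>\<Lambda>'. potential_seq A g h t n y \<le> 0" using potential_nonpos[OF hC rep' _ t] by blast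
          show "\<forall>n m. \<forall>y\<in>\<Lambda>'. potential_seq A g h t (n + m) y \<le> potential_seq A g h t n y + potential_seq A g h t m ((h ^^ n) y)"
            using potential_subadditive[OF hC rep' _ t] by blast
          show "potential_seq A g h t N (\<pi> x) \<le> ?\<phi> N x + \<epsilon> / 2" if "x \<in> \<Lambda>" for x
            using \<pi>(3)[OF that] by (intro \<eta>(2)[OF h that]) (simp add: dist_commute)
        qed
        \<comment> \<open>Half of \<epsilon> is the loss in \<open>pressure_block\<close>; the other
          half, the difference of the potentials, is even divided by \<open>N\<close>.\<close>
        also have "(ln (\<Sum>y\<in>E. exp (w y)) + \<epsilon> / 2) / real N \<le> p + \<epsilon>"
        proof -
          have "1 * (\<epsilon> / 2) \<le> real N * (\<epsilon> / 2)" using N(1) \<epsilon> by (intro mult_right_mono) auto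
          then have "ln (\<Sum>y\<in>E. exp (w y)) + \<epsilon> / 2 \<le> real N * (p + \<epsilon>)"
            using N(6) by (simp add: algebra_simps)
          then show ?thesis using N(1) by (simp add: divide_le_eq mult.commute)
        qed
        finally show ?thesis using real by simp
      qed
      then show ?thesis using that \<eta>(1) by blast
    next
      case PInf
      then show ?thesis using that[of 1] by simp
    next
      case MInf
      then show ?thesis using nmi by simp
    qed
  qed
qed

end

lemma repeller_continuation_mono:
  "repeller_continuation A g \<eta> f \<Lambda> h \<Lambda>' \<Longrightarrow> \<eta> \<le> \<eta>' \<Longrightarrow> repeller_continuation A g \<eta>' f \<Lambda> h \<Lambda>'"
  unfolding repeller_continuation_def by (meson order_less_le_trans)

text \<open>The repeller of \<open>h\<close> is singled out as the only one conjugate to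
  \<open>\<Lambda>\<close> by a homeomorphism moving points less than \<eta>. This is meaningful
  once \<eta> is below a threshold depending on \<open>f\<close> and \<open>\<Lambda>\<close>, hence
  the outer quantifier; existence and uniqueness are part of the conclusion.\<close>

theorem theorem3p3:
  fixes A :: "('m::metric_space, 'e::euclidean_space) chart set"
    and g :: "'m \<Rightarrow> 'e \<Rightarrow> 'e \<Rightarrow> real"
    and \<iota> :: "'m \<Rightarrow> 'b::euclidean_space"
    and f :: "'m \<Rightarrow> 'm"
    and \<Lambda> :: "'m set"
  assumes "compact_riemannian_manifold A g"
    and "smooth_embedding A \<iota>"
    and "C1_map A f"
    and "repeller A g f \<Lambda>"
    and "topologically_transitive_on \<Lambda> f"
  shows "\<exists>\<eta>\<^sub>0>0. \<forall>\<eta>. 0 < \<eta> \<and> \<eta> \<le> \<eta>\<^sub>0 \<longrightarrow>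
    (\<forall>t::real. 0 \<le> t \<and> t \<le> real DIM('e) \<longrightarrow>
      (\<forall>\<epsilon>::real. \<epsilon> > 0 \<longrightarrow>
        (\<exists>\<delta>>0. \<forall>h. C1_map A h \<and> C1_dist A g \<iota> f h < \<delta> \<longrightarrow>
          (\<exists>!\<Lambda>\<^sub>h. repeller_continuation A g \<eta> f \<Lambda> h \<Lambda>\<^sub>h) \<and>
          (\<forall>\<Lambda>\<^sub>h. repeller_continuation A g \<eta> f \<Lambda> h \<Lambda>\<^sub>h \<longrightarrow>
            pressure \<Lambda>\<^sub>h h (potential_seq A g h t)
              \<le> pressure \<Lambda> f (potential_seq A g f t) + ereal \<epsilon>))))"
proof -
  interpret embedded_manifold A g \<iota>
    using assms(1,2) by unfold_locales
  note f = assms(3) and rep = assms(4)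
  obtain \<kappa> d where ad: "adapted_nbhd f \<Lambda> \<kappa> d" using adapted_nbhd_exists[OF f rep] by blast
  have d: "d > 0" using ad by (simp add: adapted_nbhd_def)
  have fL: "f ` \<Lambda> \<subseteq> \<Lambda>" using rep by (simp add: repeller_def)
  show ?thesis
  \<comment> \<open>The radius of the adapted neighbourhood is the threshold, as
    \<open>continuation_unique\<close> needs \<eta> at most \<open>d\<close>.\<close>
  proof (rule exI[of _ d], intro conjI d allI impI)
    fix \<eta> t \<epsilon> :: real
    assume \<eta>: "0 < \<eta> \<and> \<eta> \<le> d" and t: "0 \<le> t \<and> t \<le> real DIM('e)" and \<epsilon>: "0 < \<epsilon>"
    obtain \<eta>1 where \<eta>1: "\<eta>1 > 0"
      "\<And>h \<Lambda>'. C1_near f \<eta>1 h \<Longrightarrow> repeller_continuation A g \<eta>1 f \<Lambda> h \<Lambda>' \<Longrightarrow>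
        pressure \<Lambda>' h (potential_seq A g h t) \<le> pressure \<Lambda> f (potential_seq A g f t) + ereal \<epsilon>"
      using pressure_upper_semicontinuous[OF f rep ad _ _ \<epsilon>] t by metis
    \<comment> \<open>A continuation with the smaller constant qualifies at both levels: at level
      \<eta> it is the only one, and at level \<eta>1 the pressure estimate applies to it.\<close>
    have "0 < min \<eta> \<eta>1" using \<eta> \<eta>1(1) by simp
    then obtain \<delta>1 where \<delta>1: "\<delta>1 > 0" "\<And>h. C1_near f \<delta>1 h \<Longrightarrow> \<exists>\<Lambda>'. repeller_continuation A g (min \<eta> \<eta>1) f \<Lambda> h \<Lambda>'"
      using continuation_exists[OF f ad rep] by metis
    define \<delta> where "\<delta> = Min {d, \<delta>1, \<eta>1}"
    have \<delta>: "\<delta> > 0" "\<delta> \<le> d" "\<delta> \<le> \<delta>1" "\<delta> \<le> \<eta>1" using d \<delta>1(1) \<eta>1(1) by (auto simp: \<delta>_def)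
    have "(\<exists>!\<Lambda>\<^sub>h. repeller_continuation A g \<eta> f \<Lambda> h \<Lambda>\<^sub>h) \<and>
          (\<forall>\<Lambda>\<^sub>h. repeller_continuation A g \<eta> f \<Lambda> h \<Lambda>\<^sub>h \<longrightarrow>
            pressure \<Lambda>\<^sub>h h (potential_seq A g h t) \<le> pressure \<Lambda> f (potential_seq A g f t) + ereal \<epsilon>)"
      if h: "C1_near f \<delta> h" for h
    proof -
      obtain \<Lambda>' where L: "repeller_continuation A g (min \<eta> \<eta>1) f \<Lambda> h \<Lambda>'"
        using \<delta>1(2)[OF C1_near_mono[OF h \<delta>(3)]] by blast
      have L1: "repeller_continuation A g \<eta> f \<Lambda> h \<Lambda>'" "repeller_continuation A g \<eta>1 f \<Lambda> h \<Lambda>'"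
        using repeller_continuation_mono[OF L] by auto
      have uniq: "\<Lambda>'' = \<Lambda>'" if "repeller_continuation A g \<eta> f \<Lambda> h \<Lambda>''" for \<Lambda>''
        using continuation_unique[OF f ad fL C1_near_mono[OF h \<delta>(2)] _ that L1(1)] \<eta> by blast
      have "pressure \<Lambda>' h (potential_seq A g h t) \<le> pressure \<Lambda> f (potential_seq A g f t) + ereal \<epsilon>"
        by (rule \<eta>1(2)[OF C1_near_mono[OF h \<delta>(4)] L1(2)])
      then show ?thesis using L1(1) uniq by blast
    qed
    then show "\<exists>\<delta>>0. \<forall>h. C1_map A h \<and> C1_dist A g \<iota> f h < \<delta> \<longrightarrow>
          (\<exists>!\<Lambda>\<^sub>h. repeller_continuation A g \<eta> f \<Lambda> h \<Lambda>\<^sub>h) \<and>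
          (\<forall>\<Lambda>\<^sub>h. repeller_continuation A g \<eta> f \<Lambda> h \<Lambda>\<^sub>h \<longrightarrow>
            pressure \<Lambda>\<^sub>h h (potential_seq A g h t) \<le> pressure \<Lambda> f (potential_seq A g f t) + ereal \<epsilon>)"
      using \<delta>(1) unfolding C1_near_def by blast
  qed
qed

end
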